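(* Let $A$ be a finite-dimensional $\Bbbk$-algebra, let $X,Y,Z$ be finite-dimensional $(A,A)$-bimodules, and let $${}^{\mathrm r}\delta^{Z}_{X,Y}\colon X\otimes_A\underline{\mathrm{Hom}}^{\mathrm r}(Z,Y)\to\underline{\mathrm{Hom}}^{\mathrm r}(Z,X\otimes_AY)\quad\text{and}\quad{}^{\mathrm l}\delta^{Z}_{X,Y}\colon\underline{\mathrm{Hom}}^{\mathrm l}(Z,X)\otimes_AY\to\underline{\mathrm{Hom}}^{\mathrm l}(Z,X\otimes_AY)$$ be the respective lax module functor structures on the functors $\underline{\mathrm{Hom}}^{\mathrm r}(Z,-)$ and $\underline{\mathrm{Hom}}^{\mathrm l}(Z,-)$. Then $$\partial^{\mathrm r}_{X,Y,Z}={}^{\mathrm l}\delta^{X^*}_{Y,Z}=\widetilde\partial^{\mathrm r}_{X,Y,Z}\qquad\text{and}\qquad\partial^{\mathrm l}_{X,Y,Z}={}^{\mathrm r}\delta^{Z^*}_{X,Y}=\widetilde\partial^{\mathrm l}_{X,Y,Z}.$$ Further, $\partial^{\mathrm r}$ and $\partial^{\mathrm l}$ are explicitly given by $$\partial^{\mathrm r}_{X,Y,Z}\Big(\sum_i[(x_i\otimes y_i)\otimes z]\Big)=\sum_ix_i\otimes[y_i\otimes z]\qquad\text{and}\qquad\partial^{\mathrm l}_{X,Y,Z}\Big(\sum_j[x\otimes(y_j\otimes z_j)]\Big)=\sum_j[x\otimes y_j]\otimes z_j$$ for $\sum_ix_i\otimes y_i\in X\otimes^AY$, $z\in Z$, and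 for $x\in X$, $\sum_jy_j\otimes z_j\in Y\otimes^AZ$, respectively.
   Context: $\Bbbk$ is an algebraically closed field; algebras are unital associative and, like bimodules, finite-dimensional. Tensor products. $\pi_{X,Y}\colon X\otimes_\Bbbk Y\to X\otimes_AY$ is the canonical surjection, $[x\otimes y]$ denotes the class of $x\otimes y$. $X\otimes^AY\subset X\otimes_\Bbbk Y$ is the sub-bimodule (for the outer actions) of elements $\sum_ix_i\otimes y_i$ with $\sum_ix_i.a\otimes y_i=\sum_ix_i\otimes a.y_i$ for all $a\in A$; $\imath_{X,Y}\colon X\otimes^AY\to X\otimes_\Bbbk Y$ is the inclusion. $\alpha_{\mathrm{vect}}\colon(X\otimes_\Bbbk Y)\otimes_\Bbbk Z\to X\otimes_\Bbbk(Y\otimes_\Bbbk Z)$ is the associator of vector spaces. In expressions such as $(X\otimes_\Bbbk Y)\otimes^AZ$ and $X\otimes_A(Y\otimes_\Bbbk Z)$ the relevant $A$-actions are the right action of $Y$ and the left action of $Z$, respectively the right action of $X$ and the left action of $Y$; similarly for $X\otimes^A(Y\otimes_\Bbbk Z)$ and $(X\otimes_\Bbbk Y)\otimes_AZ$. Dual. $X^*=\mathrm{Hom}_\Bbbk(X,\Bbbk)$ with $(a.\beta.a')(x)=\beta(a'.x.a)$; $X^{**}$ is canonically identified with $X$. Internal Homs. $\underline{\mathrm{Hom}}^{\mathrm r}(Z,-)$ is the right adjoint of ${-}\otimes_AZ$ and $\underline{\mathrm{Hom}}^{\mathrm l}(Z,-)$ is the right adjoint of $Z\otimes_A{-}$ on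 the category of finite-dimensional $A$-bimodules. They are identified as $\underline{\mathrm{Hom}}^{\mathrm r}(Z,Y)=\mathrm{Hom}_A(Z_A,Y_A)\cong Y\otimes^AZ^*$ via $y\otimes\beta\mapsto(z\mapsto\beta(z)y)$ and $\underline{\mathrm{Hom}}^{\mathrm l}(Z,Y)=\mathrm{Hom}_A({}_AZ,{}_AY)\cong Z^*\otimes^AY$ via $\beta\otimes y\mapsto(z\mapsto\beta(z)y)$, with evaluations (counits) $f\otimes z\mapsto f(z)$ and $z\otimes f\mapsto f(z)$. In particular $\underline{\mathrm{Hom}}^{\mathrm r}(Z^*,Y)=Y\otimes^AZ$ and $\underline{\mathrm{Hom}}^{\mathrm l}(X^*,Y)=X\otimes^AY$. Lax structures. ${}^{\mathrm r}\delta^Z_{X,Y}$ is the morphism corresponding under the adjunction to $(X\otimes_A\underline{\mathrm{Hom}}^{\mathrm r}(Z,Y))\otimes_AZ\cong X\otimes_A(\underline{\mathrm{Hom}}^{\mathrm r}(Z,Y)\otimes_AZ)\to X\otimes_AY$ (associator followed by evaluation). ${}^{\mathrm l}\delta^Z_{X,Y}$ is the morphism corresponding under the adjunction to $Z\otimes_A(\underline{\mathrm{Hom}}^{\mathrm l}(Z,X)\otimes_AY)\cong(Z\otimes_A\underline{\mathrm{Hom}}^{\mathrm l}(Z,X))\otimes_AY\to X\otimes_AY$. The four bimodule maps. $\partial^{\mathrm l}_{X,Y,Z},\widetilde\partial^{\mathrm l}_{X,Y,Z}\colon X\otimes_A(Y\otimes^AZ)\to(X\otimes_AY)\otimes^AZ$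 and $\partial^{\mathrm r}_{X,Y,Z},\widetilde\partial^{\mathrm r}_{X,Y,Z}\colon(X\otimes^AY)\otimes_AZ\to X\otimes^A(Y\otimes_AZ)$ are the unique homomorphisms determined as follows. (1) $\partial^{\mathrm l}$: let $\gamma^{\mathrm l}\colon X\otimes_\Bbbk(Y\otimes^AZ)\to(X\otimes_\Bbbk Y)\otimes^AZ$ be the isomorphism obtained by restricting $\alpha_{\mathrm{vect}}^{-1}$, i.e. $\imath\circ\gamma^{\mathrm l}=\alpha_{\mathrm{vect}}^{-1}\circ(\mathrm{id}_X\otimes_\Bbbk\imath_{Y,Z})$ with $\imath\colon(X\otimes_\Bbbk Y)\otimes^AZ\to(X\otimes_\Bbbk Y)\otimes_\Bbbk Z$ the inclusion. Then $\partial^{\mathrm l}_{X,Y,Z}\circ\pi=(\pi_{X,Y}\otimes^A\mathrm{id}_Z)\circ\gamma^{\mathrm l}$ with $\pi\colon X\otimes_\Bbbk(Y\otimes^AZ)\to X\otimes_A(Y\otimes^AZ)$ the surjection. (2) $\widetilde\partial^{\mathrm l}$: let $\widetilde\gamma^{\mathrm l}\colon X\otimes_A(Y\otimes_\Bbbk Z)\to(X\otimes_AY)\otimes_\Bbbk Z$ be the isomorphism induced by $\alpha_{\mathrm{vect}}^{-1}$ on quotients, i.e. $\widetilde\gamma^{\mathrm l}\circ\widetilde\pi=(\pi_{X,Y}\otimes_\Bbbk\mathrm{id}_Z)\circ\alpha_{\mathrm{vect}}^{-1}$ with $\widetilde\pi\colon X\otimes_\Bbbk(Y\otimes_\Bbbk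 Z)\to X\otimes_A(Y\otimes_\Bbbk Z)$ the surjection. Then $\widetilde\imath\circ\widetilde\partial^{\mathrm l}_{X,Y,Z}=\widetilde\gamma^{\mathrm l}\circ(\mathrm{id}_X\otimes_A\imath_{Y,Z})$ with $\widetilde\imath\colon(X\otimes_AY)\otimes^AZ\to(X\otimes_AY)\otimes_\Bbbk Z$ the inclusion. (3) $\partial^{\mathrm r}$: let $\gamma^{\mathrm r}\colon(X\otimes^AY)\otimes_\Bbbk Z\to X\otimes^A(Y\otimes_\Bbbk Z)$ be the isomorphism obtained by restricting $\alpha_{\mathrm{vect}}$. Then $\partial^{\mathrm r}_{X,Y,Z}\circ\pi=(\mathrm{id}_X\otimes^A\pi_{Y,Z})\circ\gamma^{\mathrm r}$ with $\pi\colon(X\otimes^AY)\otimes_\Bbbk Z\to(X\otimes^AY)\otimes_AZ$ the surjection. (4) $\widetilde\partial^{\mathrm r}$: let $\widetilde\gamma^{\mathrm r}\colon(X\otimes_\Bbbk Y)\otimes_AZ\to X\otimes_\Bbbk(Y\otimes_AZ)$ be the isomorphism induced by $\alpha_{\mathrm{vect}}$ on quotients. Then $\widetilde\imath\circ\widetilde\partial^{\mathrm r}_{X,Y,Z}=\widetilde\gamma^{\mathrm r}\circ(\imath_{X,Y}\otimes_A\mathrm{id}_Z)$ with $\widetilde\imath\colon X\otimes^A(Y\otimes_AZ)\to X\otimes_\Bbbk(Y\otimes_AZ)$ the inclusion. *)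

theory Defs
  imports "HOL-Algebra.Algebra"
begin

(* frees the name X, which the library uses for the polynomial indeterminate *)
no_notation var (\<open>X\<index>\<close>)

section \<open>Linear algebra over a field\<close>

text \<open>
  All spaces live on explicit carriers, in the style of HOL-Algebra, because the quotients and
  subspaces below depend on the actions.  The fields \<^const>\<open>monoid.mult\<close> and \<^const>\<open>one\<close>, which the library's
  record of modules inherits from rings, are meaningful for the algebra \<open>A\<close> only; for every other
  space they are left \<^const>\<open>undefined\<close>.  Maps are extensional (\<^const>\<open>undefined\<close> outside the carrier of
  their domain), so that equality of maps is equality of functions; a map determined by a universal
  property or a commutative diagram is then the unique function satisfying it, whence the uses
  of \<open>THE\<close>.
\<close>

definition lin_span :: "('k, 'c) ring_scheme \<Rightarrow> ('k, 'x, 'm) module_scheme \<Rightarrow> 'x set \<Rightarrow> 'x set" where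
  "lin_span K M S = \<Inter>{N. submodule N K M \<and> S \<subseteq> N}"

definition finite_dim :: "('k, 'c) ring_scheme \<Rightarrow> ('k, 'x, 'm) module_scheme \<Rightarrow> bool" where
  "finite_dim K M \<longleftrightarrow> (\<exists>B. finite B \<and> B \<subseteq> carrier M \<and> lin_span K M B = carrier M)"

definition linear_maps ::
  "('k, 'c) ring_scheme \<Rightarrow> ('k, 'x, 'm) module_scheme \<Rightarrow> ('k, 'y, 'n) module_scheme \<Rightarrow> ('x \<Rightarrow> 'y) set" where
  "linear_maps K M N = {f \<in> carrier M \<rightarrow>\<^sub>E carrier N.
     (\<forall>x\<in>carrier M. \<forall>y\<in>carrier M. f (x \<oplus>\<^bsub>M\<^esub> y) = f x \<oplus>\<^bsub>N\<^esub> f y) \<and>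
     (\<forall>c\<in>carrier K. \<forall>x\<in>carrier M. f (c \<odot>\<^bsub>M\<^esub> x) = c \<odot>\<^bsub>N\<^esub> f x)}"

definition lin_hom ::
  "('k, 'c) ring_scheme \<Rightarrow> ('k, 'x, 'm) module_scheme \<Rightarrow> ('k, 'y, 'n) module_scheme
    \<Rightarrow> ('k, 'x \<Rightarrow> 'y) module" where
  "lin_hom K M N =
     \<lparr>carrier = linear_maps K M N, monoid.mult = undefined, one = undefined,
      ring.zero = (\<lambda>x\<in>carrier M. \<zero>\<^bsub>N\<^esub>), ring.add = (\<lambda>f g. \<lambda>x\<in>carrier M. f x \<oplus>\<^bsub>N\<^esub> g x),
      smult = (\<lambda>c f. \<lambda>x\<in>carrier M. c \<odot>\<^bsub>N\<^esub> f x)\<rparr>"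

definition ground_module :: "'k ring \<Rightarrow> ('k, 'k) module" where
  "ground_module K = ring.extend K (module.fields (monoid.mult K))"

definition free_module :: "('k, 'c) ring_scheme \<Rightarrow> 's set \<Rightarrow> ('k, 's \<Rightarrow> 'k) module" where
  "free_module K S =
     \<lparr>carrier = {f \<in> S \<rightarrow>\<^sub>E carrier K. finite {s \<in> S. f s \<noteq> \<zero>\<^bsub>K\<^esub>}}, monoid.mult = undefined, one = undefined,
      ring.zero = (\<lambda>s\<in>S. \<zero>\<^bsub>K\<^esub>), ring.add = (\<lambda>f g. \<lambda>s\<in>S. f s \<oplus>\<^bsub>K\<^esub> g s),
      smult = (\<lambda>c f. \<lambda>s\<in>S. c \<otimes>\<^bsub>K\<^esub> f s)\<rparr>"

definition free_gen :: "('k, 'c) ring_scheme \<Rightarrow> 's set \<Rightarrow> 's \<Rightarrow> 's \<Rightarrow> 'k" where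
  "free_gen K S s = (\<lambda>t\<in>S. if t = s then \<one>\<^bsub>K\<^esub> else \<zero>\<^bsub>K\<^esub>)"

text \<open>
  For a submodule \<open>N\<close> stable under \<open>f\<close>, the map \<open>coset_map M N f\<close> is the map induced by \<open>f\<close> on
  cosets: the cosets united on the right-hand side all coincide.
\<close>

definition coset_map :: "('x, 'm) ring_scheme \<Rightarrow> 'x set \<Rightarrow> ('x \<Rightarrow> 'x) \<Rightarrow> 'x set \<Rightarrow> 'x set" where
  "coset_map M N f C = (\<Union>x\<in>C. N +>\<^bsub>M\<^esub> f x)"

definition factor_module :: "('k, 'x, 'm) module_scheme \<Rightarrow> 'x set \<Rightarrow> ('k, 'x set) module" where
  "factor_module M N =
     \<lparr>carrier = a_rcosets\<^bsub>M\<^esub> N, monoid.mult = undefined, one = undefined, ring.zero = N, ring.add = set_add M,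
      smult = (\<lambda>c. coset_map M N (\<lambda>x. c \<odot>\<^bsub>M\<^esub> x))\<rparr>"

text \<open>The tensor product of vector spaces: the free space on \<open>X \<times> Y\<close> modulo the bilinearity relations.\<close>

type_synonym ('k, 'x, 'y) tensor = "('x \<times> 'y \<Rightarrow> 'k) set"

definition bilinearity_rels ::
  "('k, 'c) ring_scheme \<Rightarrow> ('k, 'x, 'm) module_scheme \<Rightarrow> ('k, 'y, 'n) module_scheme
    \<Rightarrow> ('x \<times> 'y \<Rightarrow> 'k) set" where
  "bilinearity_rels K X Y =
    (let S = carrier X \<times> carrier Y; F = free_module K S; e = (\<lambda>x y. free_gen K S (x, y)) in
     lin_span K F
      ({e (x \<oplus>\<^bsub>X\<^esub> x') y \<ominus>\<^bsub>F\<^esub> (e x y \<oplus>\<^bsub>F\<^esub> e x' y) |x x' y. x \<in> carrier X \<and> x' \<in> carrier X \<and> y \<in> carrier Y} \<union>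
       {e x (y \<oplus>\<^bsub>Y\<^esub> y') \<ominus>\<^bsub>F\<^esub> (e x y \<oplus>\<^bsub>F\<^esub> e x y') |x y y'. x \<in> carrier X \<and> y \<in> carrier Y \<and> y' \<in> carrier Y} \<union>
       {e (c \<odot>\<^bsub>X\<^esub> x) y \<ominus>\<^bsub>F\<^esub> (c \<odot>\<^bsub>F\<^esub> e x y) |c x y. c \<in> carrier K \<and> x \<in> carrier X \<and> y \<in> carrier Y} \<union>
       {e x (c \<odot>\<^bsub>Y\<^esub> y) \<ominus>\<^bsub>F\<^esub> (c \<odot>\<^bsub>F\<^esub> e x y) |c x y. c \<in> carrier K \<and> x \<in> carrier X \<and> y \<in> carrier Y}))"

definition tensor_module ::
  "('k, 'c) ring_scheme \<Rightarrow> ('k, 'x, 'm) module_scheme \<Rightarrow> ('k, 'y, 'n) module_scheme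
    \<Rightarrow> ('k, ('k, 'x, 'y) tensor) module" where
  "tensor_module K X Y =
     factor_module (free_module K (carrier X \<times> carrier Y)) (bilinearity_rels K X Y)"

definition pure_tensor ::
  "('k, 'c) ring_scheme \<Rightarrow> ('k, 'x, 'm) module_scheme \<Rightarrow> ('k, 'y, 'n) module_scheme
    \<Rightarrow> 'x \<Rightarrow> 'y \<Rightarrow> ('k, 'x, 'y) tensor" where
  "pure_tensor K X Y x y =
     bilinearity_rels K X Y +>\<^bsub>free_module K (carrier X \<times> carrier Y)\<^esub>
       free_gen K (carrier X \<times> carrier Y) (x, y)"

definition tensor_map ::
  "('k, 'c) ring_scheme \<Rightarrow> ('k, 'x, 'm) module_scheme \<Rightarrow> ('k, 'y, 'n) module_scheme
    \<Rightarrow> ('k, 'x2, 'm2) module_scheme \<Rightarrow> ('k, 'y2, 'n2) module_scheme \<Rightarrow> ('x \<Rightarrow> 'x2) \<Rightarrow> ('y \<Rightarrow> 'y2)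
    \<Rightarrow> ('k, 'x, 'y) tensor \<Rightarrow> ('k, 'x2, 'y2) tensor" where
  "tensor_map K X Y X' Y' f g =
     (THE h. h \<in> linear_maps K (tensor_module K X Y) (tensor_module K X' Y') \<and>
        (\<forall>x\<in>carrier X. \<forall>y\<in>carrier Y.
           h (pure_tensor K X Y x y) = pure_tensor K X' Y' (f x) (g y)))"

section \<open>Algebras and bimodules\<close>

text \<open>The library's locale of algebras is restricted to commutative algebras.\<close>

locale fd_algebra =
  fixes K :: "'k ring" and A :: "('k, 'a) module"
  assumes is_module: "module K A"
    and is_ring: "ring A"
    and smult_mult_left: "\<lbrakk>c \<in> carrier K; a \<in> carrier A; b \<in> carrier A\<rbrakk>
      \<Longrightarrow> (c \<odot>\<^bsub>A\<^esub> a) \<otimes>\<^bsub>A\<^esub> b = c \<odot>\<^bsub>A\<^esub> (a \<otimes>\<^bsub>A\<^esub> b)"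
    and smult_mult_right: "\<lbrakk>c \<in> carrier K; a \<in> carrier A; b \<in> carrier A\<rbrakk>
      \<Longrightarrow> a \<otimes>\<^bsub>A\<^esub> (c \<odot>\<^bsub>A\<^esub> b) = c \<odot>\<^bsub>A\<^esub> (a \<otimes>\<^bsub>A\<^esub> b)"
    and finite_dim: "finite_dim K A"

record ('a, 'k, 'x) bimodule = "('k, 'x) module" +
  lact :: "'a \<Rightarrow> 'x \<Rightarrow> 'x"
  ract :: "'x \<Rightarrow> 'a \<Rightarrow> 'x"

locale fd_bimodule =
  fixes K :: "'k ring" and A :: "('k, 'a) module" and M :: "('a, 'k, 'x) bimodule"
  assumes is_module: "module K M"
    and lact_closed: "\<lbrakk>a \<in> carrier A; x \<in> carrier M\<rbrakk> \<Longrightarrow> lact M a x \<in> carrier M"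
    and ract_closed: "\<lbrakk>a \<in> carrier A; x \<in> carrier M\<rbrakk> \<Longrightarrow> ract M x a \<in> carrier M"
    and lact_add: "\<lbrakk>a \<in> carrier A; x \<in> carrier M; y \<in> carrier M\<rbrakk>
      \<Longrightarrow> lact M a (x \<oplus>\<^bsub>M\<^esub> y) = lact M a x \<oplus>\<^bsub>M\<^esub> lact M a y"
    and ract_add: "\<lbrakk>a \<in> carrier A; x \<in> carrier M; y \<in> carrier M\<rbrakk>
      \<Longrightarrow> ract M (x \<oplus>\<^bsub>M\<^esub> y) a = ract M x a \<oplus>\<^bsub>M\<^esub> ract M y a"
    and lact_smult: "\<lbrakk>c \<in> carrier K; a \<in> carrier A; x \<in> carrier M\<rbrakk>
      \<Longrightarrow> lact M a (c \<odot>\<^bsub>M\<^esub> x) = c \<odot>\<^bsub>M\<^esub> lact M a x"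
    and ract_smult: "\<lbrakk>c \<in> carrier K; a \<in> carrier A; x \<in> carrier M\<rbrakk>
      \<Longrightarrow> ract M (c \<odot>\<^bsub>M\<^esub> x) a = c \<odot>\<^bsub>M\<^esub> ract M x a"
    and add_lact: "\<lbrakk>a \<in> carrier A; b \<in> carrier A; x \<in> carrier M\<rbrakk>
      \<Longrightarrow> lact M (a \<oplus>\<^bsub>A\<^esub> b) x = lact M a x \<oplus>\<^bsub>M\<^esub> lact M b x"
    and add_ract: "\<lbrakk>a \<in> carrier A; b \<in> carrier A; x \<in> carrier M\<rbrakk>
      \<Longrightarrow> ract M x (a \<oplus>\<^bsub>A\<^esub> b) = ract M x a \<oplus>\<^bsub>M\<^esub> ract M x b"
    and smult_lact: "\<lbrakk>c \<in> carrier K; a \<in> carrier A; x \<in> carrier M\<rbrakk>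
      \<Longrightarrow> lact M (c \<odot>\<^bsub>A\<^esub> a) x = c \<odot>\<^bsub>M\<^esub> lact M a x"
    and smult_ract: "\<lbrakk>c \<in> carrier K; a \<in> carrier A; x \<in> carrier M\<rbrakk>
      \<Longrightarrow> ract M x (c \<odot>\<^bsub>A\<^esub> a) = c \<odot>\<^bsub>M\<^esub> ract M x a"
    and mult_lact: "\<lbrakk>a \<in> carrier A; b \<in> carrier A; x \<in> carrier M\<rbrakk>
      \<Longrightarrow> lact M (a \<otimes>\<^bsub>A\<^esub> b) x = lact M a (lact M b x)"
    and mult_ract: "\<lbrakk>a \<in> carrier A; b \<in> carrier A; x \<in> carrier M\<rbrakk>
      \<Longrightarrow> ract M x (a \<otimes>\<^bsub>A\<^esub> b) = ract M (ract M x a) b"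
    and one_lact: "x \<in> carrier M \<Longrightarrow> lact M \<one>\<^bsub>A\<^esub> x = x"
    and one_ract: "x \<in> carrier M \<Longrightarrow> ract M x \<one>\<^bsub>A\<^esub> = x"
    and lact_ract: "\<lbrakk>a \<in> carrier A; b \<in> carrier A; x \<in> carrier M\<rbrakk>
      \<Longrightarrow> ract M (lact M a x) b = lact M a (ract M x b)"
    and finite_dim: "finite_dim K M"

abbreviation idm :: "('x, 'm) ring_scheme \<Rightarrow> 'x \<Rightarrow> 'x" where
  "idm X \<equiv> (\<lambda>x\<in>carrier X. x)"

text \<open>Composition of extensional maps with domain \<open>M\<close>, and the inverse of a bijection \<open>M \<rightarrow> N\<close>.\<close>

abbreviation comp_on :: "('x, 'm) ring_scheme \<Rightarrow> ('y \<Rightarrow> 'z) \<Rightarrow> ('x \<Rightarrow> 'y) \<Rightarrow> 'x \<Rightarrow> 'z" where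
  "comp_on M g f \<equiv> compose (carrier M) g f"

abbreviation inv_on :: "('x, 'm) ring_scheme \<Rightarrow> ('y, 'n) ring_scheme \<Rightarrow> ('x \<Rightarrow> 'y) \<Rightarrow> 'y \<Rightarrow> 'x" where
  "inv_on M N f \<equiv> (\<lambda>y\<in>carrier N. inv_into (carrier M) f y)"

context
  fixes K :: "'k ring" and A :: "('k, 'a) module"
begin

definition bimod_hom :: "('a, 'k, 'x) bimodule \<Rightarrow> ('a, 'k, 'y) bimodule \<Rightarrow> ('x \<Rightarrow> 'y) set" where
  "bimod_hom M N = {f \<in> linear_maps K M N. \<forall>a\<in>carrier A. \<forall>x\<in>carrier M.
     f (lact M a x) = lact N a (f x) \<and> f (ract M x a) = ract N (f x) a}"

section \<open>The tensor products\<close>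

text \<open>\<open>X \<otimes>\<^sub>K Y\<close> carries the outer actions, the left one of \<open>X\<close> and the right one of \<open>Y\<close>.\<close>

definition tensor_field ::
  "('a, 'k, 'x) bimodule \<Rightarrow> ('a, 'k, 'y) bimodule \<Rightarrow> ('a, 'k, ('k, 'x, 'y) tensor) bimodule"
  (infixr "\<otimes>\<^sub>K" 70) where
  "X \<otimes>\<^sub>K Y = module.extend (tensor_module K X Y)
     (bimodule.fields
       (\<lambda>a. tensor_map K X Y X Y (lact X a) (idm Y))
       (\<lambda>t a. tensor_map K X Y X Y (idm X) (\<lambda>y. ract Y y a) t))"

definition balance_rels ::
  "('a, 'k, 'x) bimodule \<Rightarrow> ('a, 'k, 'y) bimodule \<Rightarrow> ('k, 'x, 'y) tensor set" where
  "balance_rels X Y = lin_span K (X \<otimes>\<^sub>K Y)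
     {pure_tensor K X Y (ract X x a) y \<ominus>\<^bsub>X \<otimes>\<^sub>K Y\<^esub> pure_tensor K X Y x (lact Y a y) |x a y.
        x \<in> carrier X \<and> a \<in> carrier A \<and> y \<in> carrier Y}"

definition tensor_over ::
  "('a, 'k, 'x) bimodule \<Rightarrow> ('a, 'k, 'y) bimodule \<Rightarrow> ('a, 'k, ('k, 'x, 'y) tensor set) bimodule"
  (infixr "\<otimes>\<^sub>A" 70) where
  "X \<otimes>\<^sub>A Y = module.extend (factor_module (X \<otimes>\<^sub>K Y) (balance_rels X Y))
     (bimodule.fields
       (\<lambda>a. coset_map (X \<otimes>\<^sub>K Y) (balance_rels X Y) (lact (X \<otimes>\<^sub>K Y) a))
       (\<lambda>C a. coset_map (X \<otimes>\<^sub>K Y) (balance_rels X Y) (\<lambda>t. ract (X \<otimes>\<^sub>K Y) t a) C))"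

definition proj ::
  "('a, 'k, 'x) bimodule \<Rightarrow> ('a, 'k, 'y) bimodule \<Rightarrow> ('k, 'x, 'y) tensor \<Rightarrow> ('k, 'x, 'y) tensor set" where
  "proj X Y = (\<lambda>t\<in>carrier (X \<otimes>\<^sub>K Y). balance_rels X Y +>\<^bsub>X \<otimes>\<^sub>K Y\<^esub> t)"

text \<open>The class of \<open>x \<otimes> y\<close> in \<open>X \<otimes>\<^sub>A Y\<close>.\<close>

definition tensor_class ::
  "('a, 'k, 'x) bimodule \<Rightarrow> ('a, 'k, 'y) bimodule \<Rightarrow> 'x \<Rightarrow> 'y \<Rightarrow> ('k, 'x, 'y) tensor set" where
  "tensor_class X Y x y = proj X Y (pure_tensor K X Y x y)"

definition cotensor ::
  "('a, 'k, 'x) bimodule \<Rightarrow> ('a, 'k, 'y) bimodule \<Rightarrow> ('a, 'k, ('k, 'x, 'y) tensor) bimodule"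
  (infixr "\<otimes>\<^sup>A" 70) where
  "X \<otimes>\<^sup>A Y = (X \<otimes>\<^sub>K Y)\<lparr>carrier := {t \<in> carrier (X \<otimes>\<^sub>K Y). \<forall>a\<in>carrier A.
     tensor_map K X Y X Y (\<lambda>x. ract X x a) (idm Y) t = tensor_map K X Y X Y (idm X) (lact Y a) t}\<rparr>"

definition incl ::
  "('a, 'k, 'x) bimodule \<Rightarrow> ('a, 'k, 'y) bimodule \<Rightarrow> ('k, 'x, 'y) tensor \<Rightarrow> ('k, 'x, 'y) tensor" where
  "incl X Y = (\<lambda>t\<in>carrier (X \<otimes>\<^sup>A Y). t)"

definition tensor_over_map ::
  "('a, 'k, 'x) bimodule \<Rightarrow> ('a, 'k, 'y) bimodule \<Rightarrow> ('a, 'k, 'x2) bimodule \<Rightarrow> ('a, 'k, 'y2) bimodule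
    \<Rightarrow> ('x \<Rightarrow> 'x2) \<Rightarrow> ('y \<Rightarrow> 'y2) \<Rightarrow> ('k, 'x, 'y) tensor set \<Rightarrow> ('k, 'x2, 'y2) tensor set" where
  "tensor_over_map X Y X' Y' f g =
     (THE h. h \<in> bimod_hom (X \<otimes>\<^sub>A Y) (X' \<otimes>\<^sub>A Y') \<and>
        comp_on (X \<otimes>\<^sub>K Y) h (proj X Y) =
        comp_on (X \<otimes>\<^sub>K Y) (proj X' Y') (tensor_map K X Y X' Y' f g))"

definition cotensor_map ::
  "('a, 'k, 'x) bimodule \<Rightarrow> ('a, 'k, 'y) bimodule \<Rightarrow> ('a, 'k, 'x2) bimodule \<Rightarrow> ('a, 'k, 'y2) bimodule
    \<Rightarrow> ('x \<Rightarrow> 'x2) \<Rightarrow> ('y \<Rightarrow> 'y2) \<Rightarrow> ('k, 'x, 'y) tensor \<Rightarrow> ('k, 'x2, 'y2) tensor" where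
  "cotensor_map X Y X' Y' f g = restrict (tensor_map K X Y X' Y' f g) (carrier (X \<otimes>\<^sup>A Y))"

definition assoc_vect ::
  "('a, 'k, 'x) bimodule \<Rightarrow> ('a, 'k, 'y) bimodule \<Rightarrow> ('a, 'k, 'z) bimodule
    \<Rightarrow> ('k, ('k, 'x, 'y) tensor, 'z) tensor \<Rightarrow> ('k, 'x, ('k, 'y, 'z) tensor) tensor" where
  "assoc_vect X Y Z =
     (THE h. h \<in> linear_maps K ((X \<otimes>\<^sub>K Y) \<otimes>\<^sub>K Z) (X \<otimes>\<^sub>K (Y \<otimes>\<^sub>K Z)) \<and>
        (\<forall>x\<in>carrier X. \<forall>y\<in>carrier Y. \<forall>z\<in>carrier Z.
           h (pure_tensor K (X \<otimes>\<^sub>K Y) Z (pure_tensor K X Y x y) z) =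
           pure_tensor K X (Y \<otimes>\<^sub>K Z) x (pure_tensor K Y Z y z)))"

definition assoc_vect_inv ::
  "('a, 'k, 'x) bimodule \<Rightarrow> ('a, 'k, 'y) bimodule \<Rightarrow> ('a, 'k, 'z) bimodule
    \<Rightarrow> ('k, 'x, ('k, 'y, 'z) tensor) tensor \<Rightarrow> ('k, ('k, 'x, 'y) tensor, 'z) tensor" where
  "assoc_vect_inv X Y Z = inv_on ((X \<otimes>\<^sub>K Y) \<otimes>\<^sub>K Z) (X \<otimes>\<^sub>K (Y \<otimes>\<^sub>K Z)) (assoc_vect X Y Z)"

definition assoc_over ::
  "('a, 'k, 'x) bimodule \<Rightarrow> ('a, 'k, 'y) bimodule \<Rightarrow> ('a, 'k, 'z) bimodule
    \<Rightarrow> ('k, ('k, 'x, 'y) tensor set, 'z) tensor set \<Rightarrow> ('k, 'x, ('k, 'y, 'z) tensor set) tensor set" where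
  "assoc_over X Y Z =
     (THE h. h \<in> bimod_hom ((X \<otimes>\<^sub>A Y) \<otimes>\<^sub>A Z) (X \<otimes>\<^sub>A (Y \<otimes>\<^sub>A Z)) \<and>
        (\<forall>x\<in>carrier X. \<forall>y\<in>carrier Y. \<forall>z\<in>carrier Z.
           h (tensor_class (X \<otimes>\<^sub>A Y) Z (tensor_class X Y x y) z) =
           tensor_class X (Y \<otimes>\<^sub>A Z) x (tensor_class Y Z y z)))"

definition assoc_over_inv ::
  "('a, 'k, 'x) bimodule \<Rightarrow> ('a, 'k, 'y) bimodule \<Rightarrow> ('a, 'k, 'z) bimodule
    \<Rightarrow> ('k, 'x, ('k, 'y, 'z) tensor set) tensor set \<Rightarrow> ('k, ('k, 'x, 'y) tensor set, 'z) tensor set" where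
  "assoc_over_inv X Y Z = inv_on ((X \<otimes>\<^sub>A Y) \<otimes>\<^sub>A Z) (X \<otimes>\<^sub>A (Y \<otimes>\<^sub>A Z)) (assoc_over X Y Z)"

section \<open>Duals and internal Homs\<close>

definition dual :: "('a, 'k, 'x) bimodule \<Rightarrow> ('a, 'k, 'x \<Rightarrow> 'k) bimodule" where
  "dual X = module.extend (lin_hom K X (ground_module K))
     (bimodule.fields
       (\<lambda>a \<beta>. \<lambda>x\<in>carrier X. \<beta> (ract X x a))
       (\<lambda>\<beta> a. \<lambda>x\<in>carrier X. \<beta> (lact X a x)))"

definition bidual_map :: "('a, 'k, 'x) bimodule \<Rightarrow> 'x \<Rightarrow> ('x \<Rightarrow> 'k) \<Rightarrow> 'k" where
  "bidual_map X = (\<lambda>x\<in>carrier X. \<lambda>\<beta>\<in>carrier (dual X). \<beta> x)"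

text \<open>
  \<open>hom_r Z Y\<close> consists of the maps linear over the right actions, \<open>hom_l Z Y\<close> of those linear over the
  left actions.  Their bimodule structures are \<open>(a.f.b)(z) = a.f(b.z)\<close> and \<open>(a.f.b)(z) = f(z.a).b\<close>.
\<close>

definition hom_r :: "('a, 'k, 'z) bimodule \<Rightarrow> ('a, 'k, 'y) bimodule \<Rightarrow> ('a, 'k, 'z \<Rightarrow> 'y) bimodule" where
  "hom_r Z Y = module.extend
     ((lin_hom K Z Y)\<lparr>carrier := {f \<in> linear_maps K Z Y.
        \<forall>a\<in>carrier A. \<forall>z\<in>carrier Z. f (ract Z z a) = ract Y (f z) a}\<rparr>)
     (bimodule.fields
       (\<lambda>a f. \<lambda>z\<in>carrier Z. lact Y a (f z))
       (\<lambda>f a. \<lambda>z\<in>carrier Z. f (lact Z a z)))"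

definition hom_l :: "('a, 'k, 'z) bimodule \<Rightarrow> ('a, 'k, 'y) bimodule \<Rightarrow> ('a, 'k, 'z \<Rightarrow> 'y) bimodule" where
  "hom_l Z Y = module.extend
     ((lin_hom K Z Y)\<lparr>carrier := {f \<in> linear_maps K Z Y.
        \<forall>a\<in>carrier A. \<forall>z\<in>carrier Z. f (lact Z a z) = lact Y a (f z)}\<rparr>)
     (bimodule.fields
       (\<lambda>a f. \<lambda>z\<in>carrier Z. f (ract Z z a))
       (\<lambda>f a. \<lambda>z\<in>carrier Z. ract Y (f z) a))"

definition eval_r ::
  "('a, 'k, 'z) bimodule \<Rightarrow> ('a, 'k, 'y) bimodule \<Rightarrow> ('k, 'z \<Rightarrow> 'y, 'z) tensor set \<Rightarrow> 'y" where
  "eval_r Z Y = (THE h. h \<in> bimod_hom (hom_r Z Y \<otimes>\<^sub>A Z) Y \<and>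
     (\<forall>f\<in>carrier (hom_r Z Y). \<forall>z\<in>carrier Z. h (tensor_class (hom_r Z Y) Z f z) = f z))"

definition eval_l ::
  "('a, 'k, 'z) bimodule \<Rightarrow> ('a, 'k, 'y) bimodule \<Rightarrow> ('k, 'z, 'z \<Rightarrow> 'y) tensor set \<Rightarrow> 'y" where
  "eval_l Z Y = (THE h. h \<in> bimod_hom (Z \<otimes>\<^sub>A hom_l Z Y) Y \<and>
     (\<forall>z\<in>carrier Z. \<forall>f\<in>carrier (hom_l Z Y). h (tensor_class Z (hom_l Z Y) z f) = f z))"

text \<open>
  The adjunctions: \<open>transpose_r W Z Y f : W \<rightarrow> hom_r Z Y\<close> corresponds to \<open>f : W \<otimes>\<^sub>A Z \<rightarrow> Y\<close>, and
  \<open>transpose_l Z W Y f : W \<rightarrow> hom_l Z Y\<close> corresponds to \<open>f : Z \<otimes>\<^sub>A W \<rightarrow> Y\<close>.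
\<close>

definition transpose_r ::
  "('a, 'k, 'w) bimodule \<Rightarrow> ('a, 'k, 'z) bimodule \<Rightarrow> ('a, 'k, 'y) bimodule
    \<Rightarrow> (('k, 'w, 'z) tensor set \<Rightarrow> 'y) \<Rightarrow> 'w \<Rightarrow> 'z \<Rightarrow> 'y" where
  "transpose_r W Z Y f = (THE g. g \<in> bimod_hom W (hom_r Z Y) \<and>
     comp_on (W \<otimes>\<^sub>A Z) (eval_r Z Y) (tensor_over_map W Z (hom_r Z Y) Z g (idm Z)) = f)"

definition transpose_l ::
  "('a, 'k, 'z) bimodule \<Rightarrow> ('a, 'k, 'w) bimodule \<Rightarrow> ('a, 'k, 'y) bimodule
    \<Rightarrow> (('k, 'z, 'w) tensor set \<Rightarrow> 'y) \<Rightarrow> 'w \<Rightarrow> 'z \<Rightarrow> 'y" where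
  "transpose_l Z W Y f = (THE g. g \<in> bimod_hom W (hom_l Z Y) \<and>
     comp_on (Z \<otimes>\<^sub>A W) (eval_l Z Y) (tensor_over_map Z W Z (hom_l Z Y) (idm Z) g) = f)"

section \<open>The lax module functor structures\<close>

definition delta_r ::
  "('a, 'k, 'z) bimodule \<Rightarrow> ('a, 'k, 'x) bimodule \<Rightarrow> ('a, 'k, 'y) bimodule
    \<Rightarrow> ('k, 'x, 'z \<Rightarrow> 'y) tensor set \<Rightarrow> 'z \<Rightarrow> ('k, 'x, 'y) tensor set" where
  "delta_r Z X Y = transpose_r (X \<otimes>\<^sub>A hom_r Z Y) Z (X \<otimes>\<^sub>A Y)
     (comp_on ((X \<otimes>\<^sub>A hom_r Z Y) \<otimes>\<^sub>A Z)
       (tensor_over_map X (hom_r Z Y \<otimes>\<^sub>A Z) X Y (idm X) (eval_r Z Y))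
       (assoc_over X (hom_r Z Y) Z))"

definition delta_l ::
  "('a, 'k, 'z) bimodule \<Rightarrow> ('a, 'k, 'x) bimodule \<Rightarrow> ('a, 'k, 'y) bimodule
    \<Rightarrow> ('k, 'z \<Rightarrow> 'x, 'y) tensor set \<Rightarrow> 'z \<Rightarrow> ('k, 'x, 'y) tensor set" where
  "delta_l Z X Y = transpose_l Z (hom_l Z X \<otimes>\<^sub>A Y) (X \<otimes>\<^sub>A Y)
     (comp_on (Z \<otimes>\<^sub>A (hom_l Z X \<otimes>\<^sub>A Y))
       (tensor_over_map (Z \<otimes>\<^sub>A hom_l Z X) Y X Y (eval_l Z X) (idm Y))
       (assoc_over_inv Z (hom_l Z X) Y))"

text \<open>
  The identifications \<open>Y \<otimes>\<^sup>A Z\<^sup>* \<cong> hom_r Z Y\<close> and \<open>Z\<^sup>* \<otimes>\<^sup>A Y \<cong> hom_l Z Y\<close>.  A tensor of \<open>Y \<otimes>\<^sup>A Z\<^sup>*\<close> is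
  in general not a sum of pure tensors lying in this subspace, so the maps are defined on the
  tensor products over \<open>K\<close> and then restricted.
\<close>

definition hom_r_ident ::
  "('a, 'k, 'z) bimodule \<Rightarrow> ('a, 'k, 'y) bimodule \<Rightarrow> ('k, 'y, 'z \<Rightarrow> 'k) tensor \<Rightarrow> 'z \<Rightarrow> 'y" where
  "hom_r_ident Z Y = restrict
     (THE h. h \<in> linear_maps K (Y \<otimes>\<^sub>K dual Z) (lin_hom K Z Y) \<and>
        (\<forall>y\<in>carrier Y. \<forall>\<beta>\<in>carrier (dual Z).
           h (pure_tensor K Y (dual Z) y \<beta>) = (\<lambda>z\<in>carrier Z. \<beta> z \<odot>\<^bsub>Y\<^esub> y)))
     (carrier (Y \<otimes>\<^sup>A dual Z))"

definition hom_l_ident ::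
  "('a, 'k, 'z) bimodule \<Rightarrow> ('a, 'k, 'y) bimodule \<Rightarrow> ('k, 'z \<Rightarrow> 'k, 'y) tensor \<Rightarrow> 'z \<Rightarrow> 'y" where
  "hom_l_ident Z Y = restrict
     (THE h. h \<in> linear_maps K (dual Z \<otimes>\<^sub>K Y) (lin_hom K Z Y) \<and>
        (\<forall>\<beta>\<in>carrier (dual Z). \<forall>y\<in>carrier Y.
           h (pure_tensor K (dual Z) Y \<beta> y) = (\<lambda>z\<in>carrier Z. \<beta> z \<odot>\<^bsub>Y\<^esub> y)))
     (carrier (dual Z \<otimes>\<^sup>A Y))"

text \<open>
  Combined with the canonical isomorphisms to the biduals they become
  \<open>Y \<otimes>\<^sup>A Z \<cong> Y \<otimes>\<^sup>A Z\<^sup>*\<^sup>* \<cong> hom_r Z\<^sup>* Y\<close> and \<open>X \<otimes>\<^sup>A Y \<cong> X\<^sup>*\<^sup>* \<otimes>\<^sup>A Y \<cong> hom_l X\<^sup>* Y\<close>.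
\<close>

definition cotensor_hom_r ::
  "('a, 'k, 'y) bimodule \<Rightarrow> ('a, 'k, 'z) bimodule \<Rightarrow> ('k, 'y, 'z) tensor \<Rightarrow> ('z \<Rightarrow> 'k) \<Rightarrow> 'y" where
  "cotensor_hom_r Y Z = comp_on (Y \<otimes>\<^sup>A Z) (hom_r_ident (dual Z) Y)
     (cotensor_map Y Z Y (dual (dual Z)) (idm Y) (bidual_map Z))"

definition cotensor_hom_l ::
  "('a, 'k, 'x) bimodule \<Rightarrow> ('a, 'k, 'y) bimodule \<Rightarrow> ('k, 'x, 'y) tensor \<Rightarrow> ('x \<Rightarrow> 'k) \<Rightarrow> 'y" where
  "cotensor_hom_l X Y = comp_on (X \<otimes>\<^sup>A Y) (hom_l_ident (dual X) Y)
     (cotensor_map X Y (dual (dual X)) Y (bidual_map X) (idm Y))"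

text \<open>
  The lax structure \<open>\<^sup>r\<delta>\<close> with superscript \<open>Z\<^sup>*\<close>, read through these identifications as a map
  \<open>X \<otimes>\<^sub>A (Y \<otimes>\<^sup>A Z) \<rightarrow> (X \<otimes>\<^sub>A Y) \<otimes>\<^sup>A Z\<close>; similarly \<open>\<^sup>l\<delta>\<close> with superscript \<open>X\<^sup>*\<close> as a map
  \<open>(X \<otimes>\<^sup>A Y) \<otimes>\<^sub>A Z \<rightarrow> X \<otimes>\<^sup>A (Y \<otimes>\<^sub>A Z)\<close>.
\<close>

definition delta_r_dual ::
  "('a, 'k, 'x) bimodule \<Rightarrow> ('a, 'k, 'y) bimodule \<Rightarrow> ('a, 'k, 'z) bimodule
    \<Rightarrow> ('k, 'x, ('k, 'y, 'z) tensor) tensor set \<Rightarrow> ('k, ('k, 'x, 'y) tensor set, 'z) tensor" where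
  "delta_r_dual X Y Z =
     comp_on (X \<otimes>\<^sub>A (Y \<otimes>\<^sup>A Z))
       (inv_on ((X \<otimes>\<^sub>A Y) \<otimes>\<^sup>A Z) (hom_r (dual Z) (X \<otimes>\<^sub>A Y)) (cotensor_hom_r (X \<otimes>\<^sub>A Y) Z))
       (comp_on (X \<otimes>\<^sub>A (Y \<otimes>\<^sup>A Z))
         (delta_r (dual Z) X Y)
         (tensor_over_map X (Y \<otimes>\<^sup>A Z) X (hom_r (dual Z) Y) (idm X) (cotensor_hom_r Y Z)))"

definition delta_l_dual ::
  "('a, 'k, 'x) bimodule \<Rightarrow> ('a, 'k, 'y) bimodule \<Rightarrow> ('a, 'k, 'z) bimodule
    \<Rightarrow> ('k, ('k, 'x, 'y) tensor, 'z) tensor set \<Rightarrow> ('k, 'x, ('k, 'y, 'z) tensor set) tensor" where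
  "delta_l_dual X Y Z =
     comp_on ((X \<otimes>\<^sup>A Y) \<otimes>\<^sub>A Z)
       (inv_on (X \<otimes>\<^sup>A (Y \<otimes>\<^sub>A Z)) (hom_l (dual X) (Y \<otimes>\<^sub>A Z)) (cotensor_hom_l X (Y \<otimes>\<^sub>A Z)))
       (comp_on ((X \<otimes>\<^sup>A Y) \<otimes>\<^sub>A Z)
         (delta_l (dual X) Y Z)
         (tensor_over_map (X \<otimes>\<^sup>A Y) Z (hom_l (dual X) Y) Z (cotensor_hom_l X Y) (idm Z)))"

section \<open>The four bimodule maps\<close>

definition gamma_l ::
  "('a, 'k, 'x) bimodule \<Rightarrow> ('a, 'k, 'y) bimodule \<Rightarrow> ('a, 'k, 'z) bimodule
    \<Rightarrow> ('k, 'x, ('k, 'y, 'z) tensor) tensor \<Rightarrow> ('k, ('k, 'x, 'y) tensor, 'z) tensor" where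
  "gamma_l X Y Z =
     (THE h. h \<in> bimod_hom (X \<otimes>\<^sub>K (Y \<otimes>\<^sup>A Z)) ((X \<otimes>\<^sub>K Y) \<otimes>\<^sup>A Z) \<and>
        comp_on (X \<otimes>\<^sub>K (Y \<otimes>\<^sup>A Z)) (incl (X \<otimes>\<^sub>K Y) Z) h =
        comp_on (X \<otimes>\<^sub>K (Y \<otimes>\<^sup>A Z)) (assoc_vect_inv X Y Z)
          (tensor_map K X (Y \<otimes>\<^sup>A Z) X (Y \<otimes>\<^sub>K Z) (idm X) (incl Y Z)))"

definition partial_l ::
  "('a, 'k, 'x) bimodule \<Rightarrow> ('a, 'k, 'y) bimodule \<Rightarrow> ('a, 'k, 'z) bimodule
    \<Rightarrow> ('k, 'x, ('k, 'y, 'z) tensor) tensor set \<Rightarrow> ('k, ('k, 'x, 'y) tensor set, 'z) tensor" where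
  "partial_l X Y Z =
     (THE h. h \<in> bimod_hom (X \<otimes>\<^sub>A (Y \<otimes>\<^sup>A Z)) ((X \<otimes>\<^sub>A Y) \<otimes>\<^sup>A Z) \<and>
        comp_on (X \<otimes>\<^sub>K (Y \<otimes>\<^sup>A Z)) h (proj X (Y \<otimes>\<^sup>A Z)) =
        comp_on (X \<otimes>\<^sub>K (Y \<otimes>\<^sup>A Z))
          (cotensor_map (X \<otimes>\<^sub>K Y) Z (X \<otimes>\<^sub>A Y) Z (proj X Y) (idm Z)) (gamma_l X Y Z))"

definition gamma_l_tilde ::
  "('a, 'k, 'x) bimodule \<Rightarrow> ('a, 'k, 'y) bimodule \<Rightarrow> ('a, 'k, 'z) bimodule
    \<Rightarrow> ('k, 'x, ('k, 'y, 'z) tensor) tensor set \<Rightarrow> ('k, ('k, 'x, 'y) tensor set, 'z) tensor" where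
  "gamma_l_tilde X Y Z =
     (THE h. h \<in> bimod_hom (X \<otimes>\<^sub>A (Y \<otimes>\<^sub>K Z)) ((X \<otimes>\<^sub>A Y) \<otimes>\<^sub>K Z) \<and>
        comp_on (X \<otimes>\<^sub>K (Y \<otimes>\<^sub>K Z)) h (proj X (Y \<otimes>\<^sub>K Z)) =
        comp_on (X \<otimes>\<^sub>K (Y \<otimes>\<^sub>K Z))
          (tensor_map K (X \<otimes>\<^sub>K Y) Z (X \<otimes>\<^sub>A Y) Z (proj X Y) (idm Z)) (assoc_vect_inv X Y Z))"

definition partial_l_tilde ::
  "('a, 'k, 'x) bimodule \<Rightarrow> ('a, 'k, 'y) bimodule \<Rightarrow> ('a, 'k, 'z) bimodule
    \<Rightarrow> ('k, 'x, ('k, 'y, 'z) tensor) tensor set \<Rightarrow> ('k, ('k, 'x, 'y) tensor set, 'z) tensor" where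
  "partial_l_tilde X Y Z =
     (THE h. h \<in> bimod_hom (X \<otimes>\<^sub>A (Y \<otimes>\<^sup>A Z)) ((X \<otimes>\<^sub>A Y) \<otimes>\<^sup>A Z) \<and>
        comp_on (X \<otimes>\<^sub>A (Y \<otimes>\<^sup>A Z)) (incl (X \<otimes>\<^sub>A Y) Z) h =
        comp_on (X \<otimes>\<^sub>A (Y \<otimes>\<^sup>A Z)) (gamma_l_tilde X Y Z)
          (tensor_over_map X (Y \<otimes>\<^sup>A Z) X (Y \<otimes>\<^sub>K Z) (idm X) (incl Y Z)))"

definition gamma_r ::
  "('a, 'k, 'x) bimodule \<Rightarrow> ('a, 'k, 'y) bimodule \<Rightarrow> ('a, 'k, 'z) bimodule
    \<Rightarrow> ('k, ('k, 'x, 'y) tensor, 'z) tensor \<Rightarrow> ('k, 'x, ('k, 'y, 'z) tensor) tensor" where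
  "gamma_r X Y Z =
     (THE h. h \<in> bimod_hom ((X \<otimes>\<^sup>A Y) \<otimes>\<^sub>K Z) (X \<otimes>\<^sup>A (Y \<otimes>\<^sub>K Z)) \<and>
        comp_on ((X \<otimes>\<^sup>A Y) \<otimes>\<^sub>K Z) (incl X (Y \<otimes>\<^sub>K Z)) h =
        comp_on ((X \<otimes>\<^sup>A Y) \<otimes>\<^sub>K Z) (assoc_vect X Y Z)
          (tensor_map K (X \<otimes>\<^sup>A Y) Z (X \<otimes>\<^sub>K Y) Z (incl X Y) (idm Z)))"

definition partial_r ::
  "('a, 'k, 'x) bimodule \<Rightarrow> ('a, 'k, 'y) bimodule \<Rightarrow> ('a, 'k, 'z) bimodule
    \<Rightarrow> ('k, ('k, 'x, 'y) tensor, 'z) tensor set \<Rightarrow> ('k, 'x, ('k, 'y, 'z) tensor set) tensor" where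
  "partial_r X Y Z =
     (THE h. h \<in> bimod_hom ((X \<otimes>\<^sup>A Y) \<otimes>\<^sub>A Z) (X \<otimes>\<^sup>A (Y \<otimes>\<^sub>A Z)) \<and>
        comp_on ((X \<otimes>\<^sup>A Y) \<otimes>\<^sub>K Z) h (proj (X \<otimes>\<^sup>A Y) Z) =
        comp_on ((X \<otimes>\<^sup>A Y) \<otimes>\<^sub>K Z)
          (cotensor_map X (Y \<otimes>\<^sub>K Z) X (Y \<otimes>\<^sub>A Z) (idm X) (proj Y Z)) (gamma_r X Y Z))"

definition gamma_r_tilde ::
  "('a, 'k, 'x) bimodule \<Rightarrow> ('a, 'k, 'y) bimodule \<Rightarrow> ('a, 'k, 'z) bimodule
    \<Rightarrow> ('k, ('k, 'x, 'y) tensor, 'z) tensor set \<Rightarrow> ('k, 'x, ('k, 'y, 'z) tensor set) tensor" where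
  "gamma_r_tilde X Y Z =
     (THE h. h \<in> bimod_hom ((X \<otimes>\<^sub>K Y) \<otimes>\<^sub>A Z) (X \<otimes>\<^sub>K (Y \<otimes>\<^sub>A Z)) \<and>
        comp_on ((X \<otimes>\<^sub>K Y) \<otimes>\<^sub>K Z) h (proj (X \<otimes>\<^sub>K Y) Z) =
        comp_on ((X \<otimes>\<^sub>K Y) \<otimes>\<^sub>K Z)
          (tensor_map K X (Y \<otimes>\<^sub>K Z) X (Y \<otimes>\<^sub>A Z) (idm X) (proj Y Z)) (assoc_vect X Y Z))"

definition partial_r_tilde ::
  "('a, 'k, 'x) bimodule \<Rightarrow> ('a, 'k, 'y) bimodule \<Rightarrow> ('a, 'k, 'z) bimodule
    \<Rightarrow> ('k, ('k, 'x, 'y) tensor, 'z) tensor set \<Rightarrow> ('k, 'x, ('k, 'y, 'z) tensor set) tensor" where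
  "partial_r_tilde X Y Z =
     (THE h. h \<in> bimod_hom ((X \<otimes>\<^sup>A Y) \<otimes>\<^sub>A Z) (X \<otimes>\<^sup>A (Y \<otimes>\<^sub>A Z)) \<and>
        comp_on ((X \<otimes>\<^sup>A Y) \<otimes>\<^sub>A Z) (incl X (Y \<otimes>\<^sub>A Z)) h =
        comp_on ((X \<otimes>\<^sup>A Y) \<otimes>\<^sub>A Z) (gamma_r_tilde X Y Z)
          (tensor_over_map (X \<otimes>\<^sup>A Y) Z (X \<otimes>\<^sub>K Y) Z (incl X Y) (idm Z)))"

end

end

theory Submission
  imports Defs
begin

text \<open>
  On a class \<open>[x \<otimes> t]\<close> with \<open>t \<in> Y \<otimes>\<^sup>A Z\<close>, each of the three maps \<open>X \<otimes>\<^sub>A (Y \<otimes>\<^sup>A Z) \<rightarrow> (X \<otimes>\<^sub>A Y) \<otimes>\<^sup>A Z\<close>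
  takes the value \<open>(y \<mapsto> [x \<otimes> y]) \<otimes> id\<close> at \<open>t\<close>, and such classes span the domain.  For the two maps
  \<open>\<partial>\<^sup>l\<close> this is read off their defining squares by evaluating both sides on pure tensors.  The lax
  structure sends \<open>[x \<otimes> f]\<close> to \<open>\<zeta> \<mapsto> [x \<otimes> f \<zeta>]\<close>; since contraction with \<open>\<zeta> \<in> Z\<^sup>*\<close> commutes with
  \<open>(y \<mapsto> [x \<otimes> y]) \<otimes> id\<close>, the same value results once the identification
  \<open>W \<otimes>\<^sup>A Z \<rightarrow> Hom(Z\<^sup>*, W)\<close> is known to be injective, which a dual basis of \<open>Z\<close> shows.  The maps
  \<open>\<partial>\<^sup>r\<close> are treated symmetrically.
\<close>

text \<open>Each map of the statement is a definite description of an extensional function, so no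
  value can be computed before existence and uniqueness are settled. The defining squares compare
  restrictions of linear maps on a tensor product, and two such restrictions agree exactly when they
  agree on pure tensors or their classes. Every description thereby becomes a prescription of values
  on generators, which the universal property turns into a unique map. The obstacle is
  \<open>Y \<otimes>\<^sup>A Z\<close>, whose elements need not be sums of pure tensors lying in it:
  a formula on pure tensors cannot be checked inside this subspace. The second factor is therefore
  kept as one variable \<open>t\<close>, and every identity in \<open>t\<close> is proved for linear
  maps on the whole of \<open>Y \<otimes>\<^sub>K Z\<close> before it is specialised. For the lax
  structure the same device is applied to the contraction with a functional, a map on
  \<open>Y \<otimes>\<^sub>K Z\<close> whose values, for \<open>t\<close> in the subspace, are those
  of the identification with the Hom space.\<close>

lemma (in abelian_group) minus_eq_zero_iff:
  "\<lbrakk>x \<in> carrier G; y \<in> carrier G\<rbrakk> \<Longrightarrow> x \<ominus> y = \<zero> \<longleftrightarrow> x = y"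
  by (metis a_inv_closed a_minus_def minus_equality minus_minus r_neg)

text \<open>Linearity as a condition on the values over the carrier alone. Such maps compose as
  plain functions, which keeps \<open>restrict\<close> out of the arguments; extensionality returns
  through \<open>linear_maps_iff\<close> when a definite description has to be met.\<close>

definition lin ::
  "('k, 'c) ring_scheme \<Rightarrow> ('k, 'x, 'm) module_scheme \<Rightarrow> ('k, 'y, 'n) module_scheme \<Rightarrow> ('x \<Rightarrow> 'y) \<Rightarrow> bool" where
  "lin K M N f \<longleftrightarrow> f \<in> carrier M \<rightarrow> carrier N \<and>
     (\<forall>x\<in>carrier M. \<forall>y\<in>carrier M. f (x \<oplus>\<^bsub>M\<^esub> y) = f x \<oplus>\<^bsub>N\<^esub> f y) \<and>
     (\<forall>c\<in>carrier K. \<forall>x\<in>carrier M. f (c \<odot>\<^bsub>M\<^esub> x) = c \<odot>\<^bsub>N\<^esub> f x)"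

lemma linI:
  assumes "\<And>x. x \<in> carrier M \<Longrightarrow> f x \<in> carrier N"
    and "\<And>x y. \<lbrakk>x \<in> carrier M; y \<in> carrier M\<rbrakk> \<Longrightarrow> f (x \<oplus>\<^bsub>M\<^esub> y) = f x \<oplus>\<^bsub>N\<^esub> f y"
    and "\<And>c x. \<lbrakk>c \<in> carrier K; x \<in> carrier M\<rbrakk> \<Longrightarrow> f (c \<odot>\<^bsub>M\<^esub> x) = c \<odot>\<^bsub>N\<^esub> f x"
  shows "lin K M N f"
  using assms by (auto simp: lin_def)

lemma lin_closed: "\<lbrakk>lin K M N f; x \<in> carrier M\<rbrakk> \<Longrightarrow> f x \<in> carrier N"
  and lin_add: "\<lbrakk>lin K M N f; x \<in> carrier M; y \<in> carrier M\<rbrakk> \<Longrightarrow> f (x \<oplus>\<^bsub>M\<^esub> y) = f x \<oplus>\<^bsub>N\<^esub> f y"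
  and lin_smult: "\<lbrakk>lin K M N f; c \<in> carrier K; x \<in> carrier M\<rbrakk> \<Longrightarrow> f (c \<odot>\<^bsub>M\<^esub> x) = c \<odot>\<^bsub>N\<^esub> f x"
  by (auto simp: lin_def)

lemma linear_maps_iff: "f \<in> linear_maps K M N \<longleftrightarrow> lin K M N f \<and> f \<in> extensional (carrier M)"
  by (auto simp: linear_maps_def lin_def PiE_def)

lemma lin_ident: "lin K M M (\<lambda>x. x)"
  by (simp add: lin_def)

lemma lin_comp: "\<lbrakk>lin K M N f; lin K N P g\<rbrakk> \<Longrightarrow> lin K M P (\<lambda>x. g (f x))"
  by (rule linI) (simp_all add: lin_closed lin_add lin_smult)

lemma lin_cong:
  assumes "module K M" and eq: "\<And>x. x \<in> carrier M \<Longrightarrow> f x = g x"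
  shows "lin K M N f \<longleftrightarrow> lin K M N g"
proof -
  interpret M: module K M by fact
  show ?thesis using eq by (auto simp: lin_def Pi_iff)
qed

lemma lin_restrict: "module K M \<Longrightarrow> lin K M N (restrict f (carrier M)) \<longleftrightarrow> lin K M N f"
  by (rule lin_cong) auto

lemma lin_idm: "module K M \<Longrightarrow> lin K M M (idm M)"
  by (simp add: lin_restrict lin_ident)

lemma lin_const_zero:
  assumes "module K M" "module K N" shows "lin K M N (\<lambda>x. \<zero>\<^bsub>N\<^esub>)"
proof -
  interpret M: module K M by fact
  interpret N: module K N by fact
  show ?thesis by (rule linI) auto
qed

lemma lin_plus:
  assumes "module K N" "lin K M N f" "lin K M N g"
  shows "lin K M N (\<lambda>x. f x \<oplus>\<^bsub>N\<^esub> g x)"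
proof -
  interpret N: module K N by fact
  show ?thesis using assms
    by (intro linI) (simp_all add: lin_closed lin_add lin_smult N.smult_r_distr N.a_ac)
qed

lemma lin_scale:
  assumes "module K N" "lin K M N f" "c \<in> carrier K"
  shows "lin K M N (\<lambda>x. c \<odot>\<^bsub>N\<^esub> f x)"
proof -
  interpret N: module K N by fact
  show ?thesis using assms
    by (intro linI)
      (simp_all add: lin_closed lin_add lin_smult N.smult_r_distr N.smult_assoc1 [symmetric] N.m_comm)
qed

context
  fixes K M N f
  assumes M: "module K M" and N: "module K N" and f: "lin K M N f"
begin

interpretation M: module K M by (rule M)
interpretation N: module K N by (rule N)

lemma lin_zero: "f \<zero>\<^bsub>M\<^esub> = \<zero>\<^bsub>N\<^esub>"
  using lin_smult [OF f, of "\<zero>\<^bsub>K\<^esub>" "\<zero>\<^bsub>M\<^esub>"] lin_closed [OF f, of "\<zero>\<^bsub>M\<^esub>"] by simp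

lemma lin_neg: "x \<in> carrier M \<Longrightarrow> f (\<ominus>\<^bsub>M\<^esub> x) = \<ominus>\<^bsub>N\<^esub> f x"
  using lin_add [OF f, of "\<ominus>\<^bsub>M\<^esub> x" x] lin_zero
  by (simp add: M.l_neg lin_closed [OF f] N.minus_equality)

lemma lin_minus: "\<lbrakk>x \<in> carrier M; y \<in> carrier M\<rbrakk> \<Longrightarrow> f (x \<ominus>\<^bsub>M\<^esub> y) = f x \<ominus>\<^bsub>N\<^esub> f y"
  by (simp add: a_minus_def lin_neg lin_add [OF f])

lemma lin_finsum:
  "\<lbrakk>finite I; g \<in> I \<rightarrow> carrier M\<rbrakk> \<Longrightarrow> f (finsum M g I) = (\<Oplus>\<^bsub>N\<^esub>i\<in>I. f (g i))"
proof (induction I rule: finite_induct)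
  case empty
  then show ?case by (simp add: lin_zero)
next
  case (insert i I)
  then have "(\<lambda>i. f (g i)) \<in> insert i I \<rightarrow> carrier N" by (auto intro: lin_closed [OF f])
  with insert show ?case by (simp add: lin_add [OF f] Pi_iff)
qed

end

text \<open>The uniqueness arguments rest on this: if two linear maps agree on a set, they agree on
  a submodule containing it, hence on its span.\<close>

lemma lin_equalizer:
  assumes "module K M" "module K N" "lin K M N f" "lin K M N g"
  shows "submodule {x \<in> carrier M. f x = g x} K M"
proof -
  interpret M: module K M by fact
  show ?thesis
    by (rule M.submoduleI) (use assms in \<open>auto simp: lin_add lin_smult lin_neg lin_zero\<close>)
qed

text \<open>Serves to show that an operator preserves a submodule of relations: the preimage is
  again a submodule, so it suffices that it contains the generators.\<close>

lemma submodule_vimage: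
  assumes M: "module K M" and M': "module K M'" and N: "submodule N K M'" and f: "lin K M M' f"
  shows "submodule {x \<in> carrier M. f x \<in> N} K M"
proof -
  interpret M: module K M by (rule M)
  interpret M': module K M' by (rule M')
  have "\<zero>\<^bsub>M'\<^esub> \<in> N"
    using subgroup.one_closed [OF submodule.axioms(1) [OF N]] by simp
  then show ?thesis
    by (intro M.submoduleI)
      (use M'.submoduleE [OF N] in \<open>auto simp: lin_zero [OF M M' f] lin_neg [OF M M' f] lin_add [OF f] lin_smult [OF f]\<close>)
qed

text \<open>The module axioms are identities plus the existence of negatives, and both pass along a
  surjection respecting the operations. With \<open>q\<close> a coset map this yields quotients;
  with \<open>q\<close> the identity it copies a structure to another record.\<close>

lemma module_surj_image:
  assumes "module K M" and surj: "q ` carrier M = carrier N"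
    and add: "\<And>x y. \<lbrakk>x \<in> carrier M; y \<in> carrier M\<rbrakk> \<Longrightarrow> q x \<oplus>\<^bsub>N\<^esub> q y = q (x \<oplus>\<^bsub>M\<^esub> y)"
    and smult: "\<And>c x. \<lbrakk>c \<in> carrier K; x \<in> carrier M\<rbrakk> \<Longrightarrow> c \<odot>\<^bsub>N\<^esub> q x = q (c \<odot>\<^bsub>M\<^esub> x)"
    and zero: "\<zero>\<^bsub>N\<^esub> = q \<zero>\<^bsub>M\<^esub>"
  shows "module K N"
proof -
  interpret M: module K M by fact
  have lift: "\<exists>x\<in>carrier M. y = q x" if "y \<in> carrier N" for y
    using that surj by auto
  have q: "q x \<in> carrier N" if "x \<in> carrier M" for x
    using that surj by auto
  show ?thesis
  proof (rule moduleI)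
    show "cring K" by (rule M.is_cring)
    show "abelian_group N"
    proof (rule abelian_groupI)
      fix x assume "x \<in> carrier N"
      then obtain x' where x': "x' \<in> carrier M" "x = q x'" using lift by blast
      then show "\<exists>y\<in>carrier N. y \<oplus>\<^bsub>N\<^esub> x = \<zero>\<^bsub>N\<^esub>"
        by (intro bexI [of _ "q (\<ominus>\<^bsub>M\<^esub> x')"]) (simp_all add: add zero M.l_neg q)
      show "\<zero>\<^bsub>N\<^esub> \<oplus>\<^bsub>N\<^esub> x = x" using x' by (simp add: zero add)
    next
      fix x y assume "x \<in> carrier N" "y \<in> carrier N"
      then obtain x' y' where "x' \<in> carrier M" "x = q x'" "y' \<in> carrier M" "y = q y'"
        using lift by blast
      then show "x \<oplus>\<^bsub>N\<^esub> y \<in> carrier N" "x \<oplus>\<^bsub>N\<^esub> y = y \<oplus>\<^bsub>N\<^esub> x"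
        by (simp_all add: add q M.a_comm)
    next
      fix x y z assume "x \<in> carrier N" "y \<in> carrier N" "z \<in> carrier N"
      then obtain x' y' z' where "x' \<in> carrier M" "x = q x'" "y' \<in> carrier M" "y = q y'"
          "z' \<in> carrier M" "z = q z'"
        using lift by meson
      then show "x \<oplus>\<^bsub>N\<^esub> y \<oplus>\<^bsub>N\<^esub> z = x \<oplus>\<^bsub>N\<^esub> (y \<oplus>\<^bsub>N\<^esub> z)"
        by (simp add: add M.a_assoc)
    qed (simp add: zero q)
  next
    fix a b x assume "a \<in> carrier K" "b \<in> carrier K" "x \<in> carrier N"
    moreover obtain x' where "x' \<in> carrier M" "x = q x'" using lift calculation(3) by blast
    ultimately show "(a \<oplus>\<^bsub>K\<^esub> b) \<odot>\<^bsub>N\<^esub> x = a \<odot>\<^bsub>N\<^esub> x \<oplus>\<^bsub>N\<^esub> b \<odot>\<^bsub>N\<^esub> x"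
      "(a \<otimes>\<^bsub>K\<^esub> b) \<odot>\<^bsub>N\<^esub> x = a \<odot>\<^bsub>N\<^esub> (b \<odot>\<^bsub>N\<^esub> x)" "a \<odot>\<^bsub>N\<^esub> x \<in> carrier N"
      by (simp_all add: add smult q M.smult_l_distr M.smult_assoc1)
  next
    fix a x y assume "a \<in> carrier K" "x \<in> carrier N" "y \<in> carrier N"
    moreover obtain x' y' where "x' \<in> carrier M" "x = q x'" "y' \<in> carrier M" "y = q y'"
      using lift calculation(2,3) by blast
    ultimately show "a \<odot>\<^bsub>N\<^esub> (x \<oplus>\<^bsub>N\<^esub> y) = a \<odot>\<^bsub>N\<^esub> x \<oplus>\<^bsub>N\<^esub> a \<odot>\<^bsub>N\<^esub> y"
      by (simp add: add smult M.smult_r_distr)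
  next
    fix x assume "x \<in> carrier N"
    then obtain x' where "x' \<in> carrier M" "x = q x'" using lift by blast
    then show "\<one>\<^bsub>K\<^esub> \<odot>\<^bsub>N\<^esub> x = x" by (simp add: smult)
  qed
qed

lemma lin_span_submodule:
  assumes "module K M" "S \<subseteq> carrier M"
  shows "submodule (lin_span K M S) K M"
proof -
  interpret M: module K M by fact
  \<comment> \<open>The carrier is one of the submodules in the intersection.\<close>
  have "lin_span K M S \<subseteq> carrier M"
    using assms M.carrier_is_submodule by (auto simp: lin_span_def)
  then show ?thesis
  proof (rule M.submoduleI)
    have "\<zero>\<^bsub>M\<^esub> \<in> N" if "submodule N K M" for N
      using subgroup.one_closed [OF submodule.axioms(1) [OF that]] by simp
    then show "\<zero>\<^bsub>M\<^esub> \<in> lin_span K M S" by (simp add: lin_span_def)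
  qed (simp_all add: lin_span_def M.submoduleE)
qed

lemma lin_span_superset: "S \<subseteq> lin_span K M S"
  by (auto simp: lin_span_def)

lemma lin_span_least: "\<lbrakk>submodule N K M; S \<subseteq> N\<rbrakk> \<Longrightarrow> lin_span K M S \<subseteq> N"
  by (auto simp: lin_span_def)

lemma lin_span_ext:
  assumes "module K M" "module K N" "lin K M N f" "lin K M N g"
    and "S \<subseteq> carrier M" "\<And>x. x \<in> S \<Longrightarrow> f x = g x" "x \<in> lin_span K M S"
  shows "f x = g x"
  using lin_span_least [OF lin_equalizer [OF assms(1-4)], of S] assms(5-7) by auto

section \<open>Quotients\<close>

context
  fixes K :: "('k, 'c) ring_scheme" and M :: "('k, 'x, 'm) module_scheme" and N
  assumes M: "module K M" and N: "submodule N K M"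
begin

interpretation M: module K M by (rule M)
interpretation N: abelian_subgroup N M
  by (rule abelian_subgroupI3 [OF additive_subgroup.intro [OF submodule.axioms(1) [OF N]]]) unfold_locales

lemma coset_eq_iff:
  assumes "x \<in> carrier M" "y \<in> carrier M"
  shows "N +>\<^bsub>M\<^esub> x = N +>\<^bsub>M\<^esub> y \<longleftrightarrow> x \<ominus>\<^bsub>M\<^esub> y \<in> N"
proof -
  have "N +>\<^bsub>M\<^esub> x = N +>\<^bsub>M\<^esub> y \<longleftrightarrow> x \<in> N +>\<^bsub>M\<^esub> y"
    using N.a_repr_independence' N.a_repr_independenceD assms by metis
  then show ?thesis using N.a_rcos_module [OF assms(2,1)] by (simp add: a_minus_def)
qed

lemma coset_self: "x \<in> carrier M \<Longrightarrow> x \<in> N +>\<^bsub>M\<^esub> x"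
  by (rule N.a_rcos_self)

lemma coset_eq_of_mem: "\<lbrakk>x \<in> carrier M; y \<in> N +>\<^bsub>M\<^esub> x\<rbrakk> \<Longrightarrow> N +>\<^bsub>M\<^esub> y = N +>\<^bsub>M\<^esub> x"
  using N.a_repr_independence' by metis

text \<open>\<open>coset_map\<close> is a union over all representatives of the coset; since
  \<open>f\<close> preserves \<open>N\<close>, the cosets united all coincide.\<close>

lemma coset_map_coset:
  assumes f: "lin K M M f" and stable: "\<And>y. y \<in> N \<Longrightarrow> f y \<in> N" and x: "x \<in> carrier M"
  shows "coset_map M N f (N +>\<^bsub>M\<^esub> x) = N +>\<^bsub>M\<^esub> f x"
proof -
  have "N +>\<^bsub>M\<^esub> f y = N +>\<^bsub>M\<^esub> f x" if "y \<in> N +>\<^bsub>M\<^esub> x" for y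
  proof -
    have y: "y \<in> carrier M" using that x by (rule N.a_elemrcos_carrier [rotated])
    have "y \<ominus>\<^bsub>M\<^esub> x \<in> N"
      using coset_eq_iff [OF y x] coset_eq_of_mem [OF x that] by blast
    then have "f (y \<ominus>\<^bsub>M\<^esub> x) \<in> N" by (rule stable)
    then show ?thesis
      using x y by (simp add: coset_eq_iff lin_closed [OF f] lin_minus [OF M M f])
  qed
  \<comment> \<open>A union of equal sets is that set only over an inhabited index set.\<close>
  moreover have "N +>\<^bsub>M\<^esub> x \<noteq> {}"
    using coset_self [OF x] by blast
  ultimately show ?thesis
    unfolding coset_map_def by (intro SUP_eq_const)
qed

lemma factor_carrier: "carrier (factor_module M N) = (\<lambda>x. N +>\<^bsub>M\<^esub> x) ` carrier M"
  by (auto simp: factor_module_def A_RCOSETS_def')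

lemma factor_add:
  "\<lbrakk>x \<in> carrier M; y \<in> carrier M\<rbrakk> \<Longrightarrow>
    (N +>\<^bsub>M\<^esub> x) \<oplus>\<^bsub>factor_module M N\<^esub> (N +>\<^bsub>M\<^esub> y) = N +>\<^bsub>M\<^esub> (x \<oplus>\<^bsub>M\<^esub> y)"
  by (simp add: factor_module_def N.a_rcos_sum)

lemma factor_smult:
  assumes "c \<in> carrier K" "x \<in> carrier M"
  shows "c \<odot>\<^bsub>factor_module M N\<^esub> (N +>\<^bsub>M\<^esub> x) = N +>\<^bsub>M\<^esub> (c \<odot>\<^bsub>M\<^esub> x)"
proof -
  have "lin K M M (\<lambda>x. c \<odot>\<^bsub>M\<^esub> x)" by (rule lin_scale [OF M lin_ident assms(1)])
  then show ?thesis
    using assms submodule.smult_closed [OF N] by (simp add: factor_module_def coset_map_coset)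
qed

lemma factor_module_module: "module K (factor_module M N)"
proof (rule module_surj_image [OF M, where q = "\<lambda>x. N +>\<^bsub>M\<^esub> x"])
  show "\<zero>\<^bsub>factor_module M N\<^esub> = N +>\<^bsub>M\<^esub> \<zero>\<^bsub>M\<^esub>"
    using N.a_subset by (simp add: factor_module_def)
qed (simp_all add: factor_carrier factor_add factor_smult)

lemma lin_coset: "lin K M (factor_module M N) (\<lambda>x. N +>\<^bsub>M\<^esub> x)"
  by (rule linI) (simp_all add: factor_carrier factor_add factor_smult)

lemma factor_lift:
  assumes W: "module K W" and f: "lin K M W f" and ker: "\<And>x. x \<in> N \<Longrightarrow> f x = \<zero>\<^bsub>W\<^esub>"
  shows "\<exists>h\<in>linear_maps K (factor_module M N) W. \<forall>x\<in>carrier M. h (N +>\<^bsub>M\<^esub> x) = f x"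
proof -
  interpret W: module K W by (rule W)
  \<comment> \<open>The value on a coset is read off a chosen representative, and the kernel
    condition makes the choice immaterial. The restriction to the carrier makes \<open>h\<close>
    extensional.\<close>
  define h where "h = (\<lambda>C\<in>carrier (factor_module M N). f (SOME x. x \<in> carrier M \<and> C = N +>\<^bsub>M\<^esub> x))"
  have h: "h (N +>\<^bsub>M\<^esub> x) = f x" if x: "x \<in> carrier M" for x
  proof -
    define y where "y = (SOME y. y \<in> carrier M \<and> N +>\<^bsub>M\<^esub> x = N +>\<^bsub>M\<^esub> y)"
    have y: "y \<in> carrier M \<and> N +>\<^bsub>M\<^esub> x = N +>\<^bsub>M\<^esub> y"
      unfolding y_def by (rule someI [of _ x]) (simp add: x)
    then have "f (x \<ominus>\<^bsub>M\<^esub> y) = \<zero>\<^bsub>W\<^esub>"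
      using ker coset_eq_iff [OF x] by blast
    then have "f x \<ominus>\<^bsub>W\<^esub> f y = \<zero>\<^bsub>W\<^esub>"
      using x y by (simp add: lin_minus [OF M W f])
    then have "f x = f y"
      using x y by (metis W.minus_eq_zero_iff lin_closed [OF f])
    then show ?thesis using x by (simp add: h_def factor_carrier y_def)
  qed
  have "lin K (factor_module M N) W h"
    by (rule linI)
      (auto simp: factor_carrier factor_add factor_smult h lin_closed [OF f] lin_add [OF f] lin_smult [OF f])
  then show ?thesis
    using h by (auto simp: linear_maps_iff h_def intro!: bexI [of _ h])
qed

end

section \<open>Free modules\<close>

context
  fixes K :: "('k, 'c) ring_scheme" (structure) and S :: "'s set"
  assumes K: "cring K"
begin

interpretation K: cring K by (rule K)

lemma free_module_module: "module K (free_module K S)"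
proof -
  have fin_add: "finite {s \<in> S. f s \<oplus> g s \<noteq> \<zero>}"
    if "finite {s \<in> S. f s \<noteq> \<zero>}" "finite {s \<in> S. g s \<noteq> \<zero>}" for f g :: "'s \<Rightarrow> 'k"
    by (rule finite_subset [OF _ finite_UnI [OF that]]) auto
  have fin_smult: "finite {s \<in> S. c \<otimes> f s \<noteq> \<zero>}"
    if "finite {s \<in> S. f s \<noteq> \<zero>}" "c \<in> carrier K" for f :: "'s \<Rightarrow> 'k" and c
    by (rule finite_subset [OF _ that(1)]) (auto simp: that(2))
  show ?thesis
  proof (rule moduleI)
    show "cring K" by (rule K)
    show "abelian_group (free_module K S)"
    proof (rule abelian_groupI)
      fix f assume f: "f \<in> carrier (free_module K S)"
      define g where "g = (\<lambda>s\<in>S. \<ominus> f s)"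
      have "g \<in> carrier (free_module K S)"
        using f by (auto simp: free_module_def g_def PiE_iff elim!: finite_subset [rotated])
      moreover have "g \<oplus>\<^bsub>free_module K S\<^esub> f = \<zero>\<^bsub>free_module K S\<^esub>"
        using f by (auto simp: free_module_def g_def PiE_iff K.l_neg intro!: restrict_ext)
      ultimately show "\<exists>g\<in>carrier (free_module K S). g \<oplus>\<^bsub>free_module K S\<^esub> f = \<zero>\<^bsub>free_module K S\<^esub>"
        by blast
    next
      fix f g assume "f \<in> carrier (free_module K S)" "g \<in> carrier (free_module K S)"
      then show "f \<oplus>\<^bsub>free_module K S\<^esub> g \<in> carrier (free_module K S)"
        using fin_add [of f g] by (auto simp: free_module_def PiE_iff cong: conj_cong)
    qed (auto simp: free_module_def PiE_iff K.a_ac fun_eq_iff extensional_def)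
  next
    fix c f assume "c \<in> carrier K" "f \<in> carrier (free_module K S)"
    then show "c \<odot>\<^bsub>free_module K S\<^esub> f \<in> carrier (free_module K S)"
      using fin_smult [of f c] by (auto simp: free_module_def PiE_iff cong: conj_cong)
  qed (auto simp: free_module_def PiE_iff fun_eq_iff extensional_def K.l_distr K.r_distr K.m_assoc)
qed

lemma free_gen_closed: "s \<in> S \<Longrightarrow> free_gen K S s \<in> carrier (free_module K S)"
  by (auto simp: free_module_def free_gen_def intro: finite_subset [of _ "{s}"])

lemma lin_span_free_gen: "lin_span K (free_module K S) (free_gen K S ` S) = carrier (free_module K S)"
proof -
  interpret F: module K "free_module K S" by (rule free_module_module)
  have gens: "free_gen K S ` S \<subseteq> carrier (free_module K S)" by (auto intro: free_gen_closed)
  have sub: "submodule (lin_span K (free_module K S) (free_gen K S ` S)) K (free_module K S)"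
    by (rule lin_span_submodule [OF free_module_module gens])
  \<comment> \<open>The induction runs over a finite set \<open>T\<close> containing the support
    rather than over the support, so that after erasing one value it is enough to have the support
    inside the smaller set.\<close>
  have "f \<in> lin_span K (free_module K S) (free_gen K S ` S)"
    if "finite T" "f \<in> carrier (free_module K S)" "{s \<in> S. f s \<noteq> \<zero>} \<subseteq> T" for T f
    using that
  proof (induction T arbitrary: f rule: finite_induct)
    case empty
    then have "f = \<zero>\<^bsub>free_module K S\<^esub>"
      by (auto simp: free_module_def fun_eq_iff PiE_iff extensional_def)
    \<comment> \<open>The zero function is the scalar zero times any element of the span, which is
      nonempty.\<close>
    then show ?case using F.submoduleE(2,4) [OF sub] F.smult_l_null F.submoduleE(1) [OF sub]
      by (metis K.zero_closed ex_in_conv subsetD)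
  next
    case (insert t T)
    show ?case
    proof (cases "t \<in> S")
      case True
      \<comment> \<open>\<open>g\<close> is \<open>f\<close> with its value at \<open>t\<close>
        erased; the missing part is \<open>f t\<close> times the generator at
        \<open>t\<close>.\<close>
      define g where "g = (\<lambda>s\<in>S. if s = t then \<zero> else f s)"
      have g: "g \<in> carrier (free_module K S)"
        using insert.prems(1) by (auto simp: free_module_def g_def PiE_iff elim!: finite_subset [rotated])
      have ft: "f t \<in> carrier K"
        using insert.prems(1) True by (auto simp: free_module_def)
      have "g \<in> lin_span K (free_module K S) (free_gen K S ` S)"
        by (rule insert.IH [OF g]) (use insert.prems(2) in \<open>auto simp: g_def split: if_splits\<close>)
      moreover have "f t \<odot>\<^bsub>free_module K S\<^esub> free_gen K S t \<in> lin_span K (free_module K S) (free_gen K S ` S)"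
        using True ft lin_span_superset [of "free_gen K S ` S"] by (intro F.submoduleE(4) [OF sub]) auto
      moreover have "f = g \<oplus>\<^bsub>free_module K S\<^esub> (f t \<odot>\<^bsub>free_module K S\<^esub> free_gen K S t)"
        using insert.prems(1) ft
        by (auto simp: free_module_def free_gen_def g_def fun_eq_iff PiE_iff extensional_def)
      ultimately show ?thesis using F.submoduleE(5) [OF sub] by metis
    next
      case False
      with insert.prems show ?thesis by (intro insert.IH) auto
    qed
  qed
  then have "carrier (free_module K S) \<subseteq> lin_span K (free_module K S) (free_gen K S ` S)"
    by (auto simp: free_module_def)
  then show ?thesis
    using F.submoduleE(1) [OF sub] by blast
qed

lemma free_ext:
  assumes "module K W" "lin K (free_module K S) W f" "lin K (free_module K S) W g"
    and "\<And>s. s \<in> S \<Longrightarrow> f (free_gen K S s) = g (free_gen K S s)" "u \<in> carrier (free_module K S)"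
  shows "f u = g u"
proof (rule lin_span_ext [OF free_module_module assms(1-3)])
  show "free_gen K S ` S \<subseteq> carrier (free_module K S)" by (auto intro: free_gen_closed)
qed (use assms(4,5) in \<open>auto simp: lin_span_free_gen\<close>)

lemma free_lift:
  assumes W: "module K W" and b: "\<And>s. s \<in> S \<Longrightarrow> b s \<in> carrier W"
  shows "\<exists>h. lin K (free_module K S) W h \<and> (\<forall>s\<in>S. h (free_gen K S s) = b s)"
proof -
  interpret W: module K W by (rule W)
  define h where "h f = (\<Oplus>\<^bsub>W\<^esub>s\<in>{s \<in> S. f s \<noteq> \<zero>}. f s \<odot>\<^bsub>W\<^esub> b s)" for f
  \<comment> \<open>The sum over the support may be extended to any larger finite subset of
    \<open>S\<close>. The supports of two functions and of their sum differ, so additivity needs a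
    common index set.\<close>
  have h: "h f = (\<Oplus>\<^bsub>W\<^esub>s\<in>T. f s \<odot>\<^bsub>W\<^esub> b s)"
    if "f \<in> S \<rightarrow> carrier K" "finite T" "T \<subseteq> S" "{s \<in> S. f s \<noteq> \<zero>} \<subseteq> T" for f T
    unfolding h_def by (rule W.add.finprod_mono_neutral_cong_left) (use that b in \<open>auto simp: Pi_iff\<close>)
  have "lin K (free_module K S) W h"
  proof (rule linI)
    fix f assume "f \<in> carrier (free_module K S)"
    then show "h f \<in> carrier W" unfolding h_def
      by (intro W.finsum_closed) (auto simp: free_module_def PiE_iff b)
  next
    fix f g assume fg: "f \<in> carrier (free_module K S)" "g \<in> carrier (free_module K S)"
    define T where "T = {s \<in> S. f s \<noteq> \<zero>} \<union> {s \<in> S. g s \<noteq> \<zero>}"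
    have T: "finite T" "T \<subseteq> S" using fg by (auto simp: T_def free_module_def)
    have car: "\<And>s. s \<in> S \<Longrightarrow> f s \<in> carrier K" "\<And>s. s \<in> S \<Longrightarrow> g s \<in> carrier K"
      using fg by (auto simp: free_module_def)
    have "h (f \<oplus>\<^bsub>free_module K S\<^esub> g) = (\<Oplus>\<^bsub>W\<^esub>s\<in>T. (f \<oplus>\<^bsub>free_module K S\<^esub> g) s \<odot>\<^bsub>W\<^esub> b s)"
      by (rule h) (use T car in \<open>auto simp: free_module_def T_def\<close>)
    also have "\<dots> = (\<Oplus>\<^bsub>W\<^esub>s\<in>T. f s \<odot>\<^bsub>W\<^esub> b s \<oplus>\<^bsub>W\<^esub> g s \<odot>\<^bsub>W\<^esub> b s)"
      using T car b
      by (intro W.finsum_cong') (auto simp: free_module_def W.smult_l_distr Pi_iff subset_iff)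
    also have "\<dots> = (\<Oplus>\<^bsub>W\<^esub>s\<in>T. f s \<odot>\<^bsub>W\<^esub> b s) \<oplus>\<^bsub>W\<^esub> (\<Oplus>\<^bsub>W\<^esub>s\<in>T. g s \<odot>\<^bsub>W\<^esub> b s)"
      by (rule W.finsum_addf) (use T car b in auto)
    also have "(\<Oplus>\<^bsub>W\<^esub>s\<in>T. f s \<odot>\<^bsub>W\<^esub> b s) = h f"
      by (rule h [symmetric]) (use T car in \<open>auto simp: T_def\<close>)
    also have "(\<Oplus>\<^bsub>W\<^esub>s\<in>T. g s \<odot>\<^bsub>W\<^esub> b s) = h g"
      by (rule h [symmetric]) (use T car in \<open>auto simp: T_def\<close>)
    finally show "h (f \<oplus>\<^bsub>free_module K S\<^esub> g) = h f \<oplus>\<^bsub>W\<^esub> h g" .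
  next
    fix c f assume c: "c \<in> carrier K" and f: "f \<in> carrier (free_module K S)"
    define T where "T = {s \<in> S. f s \<noteq> \<zero>}"
    have T: "finite T" "T \<subseteq> S" using f by (auto simp: T_def free_module_def)
    have car: "\<And>s. s \<in> S \<Longrightarrow> f s \<in> carrier K"
      using f by (auto simp: free_module_def)
    have "h (c \<odot>\<^bsub>free_module K S\<^esub> f) = (\<Oplus>\<^bsub>W\<^esub>s\<in>T. (c \<odot>\<^bsub>free_module K S\<^esub> f) s \<odot>\<^bsub>W\<^esub> b s)"
      by (rule h) (use T car c in \<open>auto simp: free_module_def T_def\<close>)
    also have "\<dots> = (\<Oplus>\<^bsub>W\<^esub>s\<in>T. c \<odot>\<^bsub>W\<^esub> (f s \<odot>\<^bsub>W\<^esub> b s))"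
      using T car b c
      by (intro W.finsum_cong') (auto simp: free_module_def W.smult_assoc1 Pi_iff subset_iff)
    also have "\<dots> = c \<odot>\<^bsub>W\<^esub> h f"
      unfolding h_def T_def [symmetric]
      by (rule W.finsum_smult_ldistr [symmetric]) (use T car b c in auto)
    finally show "h (c \<odot>\<^bsub>free_module K S\<^esub> f) = c \<odot>\<^bsub>W\<^esub> h f" .
  qed
  moreover have "h (free_gen K S s) = b s" if "s \<in> S" for s
  proof -
    have "h (free_gen K S s) = (\<Oplus>\<^bsub>W\<^esub>t\<in>{s}. free_gen K S s t \<odot>\<^bsub>W\<^esub> b t)"
      by (rule h) (use that in \<open>auto simp: free_gen_def\<close>)
    then show ?thesis using that b by (simp add: free_gen_def)
  qed
  ultimately show ?thesis by blast
qed

end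

section \<open>Tensor products over the field\<close>

definition bilin ::
  "('k, 'c) ring_scheme \<Rightarrow> ('k, 'x, 'm) module_scheme \<Rightarrow> ('k, 'y, 'n) module_scheme
    \<Rightarrow> ('k, 'w, 'o) module_scheme \<Rightarrow> ('x \<Rightarrow> 'y \<Rightarrow> 'w) \<Rightarrow> bool" where
  "bilin K X Y W b \<longleftrightarrow>
     (\<forall>x\<in>carrier X. lin K Y W (b x)) \<and> (\<forall>y\<in>carrier Y. lin K X W (\<lambda>x. b x y))"

lemma bilinD:
  "\<lbrakk>bilin K X Y W b; x \<in> carrier X\<rbrakk> \<Longrightarrow> lin K Y W (b x)"
  "\<lbrakk>bilin K X Y W b; y \<in> carrier Y\<rbrakk> \<Longrightarrow> lin K X W (\<lambda>x. b x y)"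
  by (auto simp: bilin_def)

lemma bilinI:
  "\<lbrakk>\<And>x. x \<in> carrier X \<Longrightarrow> lin K Y W (b x); \<And>y. y \<in> carrier Y \<Longrightarrow> lin K X W (\<lambda>x. b x y)\<rbrakk>
    \<Longrightarrow> bilin K X Y W b"
  by (auto simp: bilin_def)

context
  fixes K :: "('k, 'c) ring_scheme"
    and X :: "('k, 'x, 'm) module_scheme" and Y :: "('k, 'y, 'n) module_scheme"
  assumes X: "module K X" and Y: "module K Y"
begin

interpretation X: module K X by (rule X)
interpretation Y: module K Y by (rule Y)

abbreviation (input) free_pairs where
  "free_pairs \<equiv> free_module K (carrier X \<times> carrier Y)"

abbreviation (input) pair_gen where
  "pair_gen x y \<equiv> free_gen K (carrier X \<times> carrier Y) (x, y)"

interpretation F: module K free_pairs by (rule free_module_module) (rule X.is_cring)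

lemma pair_gen_closed: "\<lbrakk>x \<in> carrier X; y \<in> carrier Y\<rbrakk> \<Longrightarrow> pair_gen x y \<in> carrier free_pairs"
  by (intro free_gen_closed X.is_cring) auto

lemma bilinearity_rels_submodule: "submodule (bilinearity_rels K X Y) K free_pairs"
  unfolding bilinearity_rels_def Let_def
  by (rule lin_span_submodule [OF F.module_axioms]) (auto intro!: pair_gen_closed F.minus_closed F.a_closed F.smult_closed)

lemma bilinearity_rels_mem:
  "\<lbrakk>x \<in> carrier X; x' \<in> carrier X; y \<in> carrier Y\<rbrakk> \<Longrightarrow>
    pair_gen (x \<oplus>\<^bsub>X\<^esub> x') y \<ominus>\<^bsub>free_pairs\<^esub> (pair_gen x y \<oplus>\<^bsub>free_pairs\<^esub> pair_gen x' y) \<in> bilinearity_rels K X Y"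
  "\<lbrakk>x \<in> carrier X; y \<in> carrier Y; y' \<in> carrier Y\<rbrakk> \<Longrightarrow>
    pair_gen x (y \<oplus>\<^bsub>Y\<^esub> y') \<ominus>\<^bsub>free_pairs\<^esub> (pair_gen x y \<oplus>\<^bsub>free_pairs\<^esub> pair_gen x y') \<in> bilinearity_rels K X Y"
  "\<lbrakk>c \<in> carrier K; x \<in> carrier X; y \<in> carrier Y\<rbrakk> \<Longrightarrow>
    pair_gen (c \<odot>\<^bsub>X\<^esub> x) y \<ominus>\<^bsub>free_pairs\<^esub> (c \<odot>\<^bsub>free_pairs\<^esub> pair_gen x y) \<in> bilinearity_rels K X Y"
  "\<lbrakk>c \<in> carrier K; x \<in> carrier X; y \<in> carrier Y\<rbrakk> \<Longrightarrow>
    pair_gen x (c \<odot>\<^bsub>Y\<^esub> y) \<ominus>\<^bsub>free_pairs\<^esub> (c \<odot>\<^bsub>free_pairs\<^esub> pair_gen x y) \<in> bilinearity_rels K X Y"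
  unfolding bilinearity_rels_def Let_def
  by (rule subsetD [OF lin_span_superset], blast)+

lemma tensor_module_module: "module K (tensor_module K X Y)"
  unfolding tensor_module_def
  by (rule factor_module_module [OF F.module_axioms bilinearity_rels_submodule])

text \<open>Each law is an equality of two cosets, that is, membership of a difference in the
  relations; these differences are the chosen generators.\<close>

lemma pure_tensor_bilin: "bilin K X Y (tensor_module K X Y) (pure_tensor K X Y)"
proof -
  note FM = F.module_axioms bilinearity_rels_submodule
  have "pure_tensor K X Y x y \<in> carrier (tensor_module K X Y)"
    if "x \<in> carrier X" "y \<in> carrier Y" for x y
    using that by (simp add: tensor_module_def pure_tensor_def factor_carrier [OF FM] pair_gen_closed)
  then show ?thesis
    by (intro bilinI linI)
      (simp_all add: tensor_module_def pure_tensor_def factor_add [OF FM] factor_smult [OF FM]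
        pair_gen_closed coset_eq_iff [OF FM] bilinearity_rels_mem)
qed

text \<open>Composed with the quotient map, both become linear maps on the free module, whose
  generators go to the pure tensors.\<close>

lemma tensor_ext:
  assumes W: "module K W" and f: "lin K (tensor_module K X Y) W f" and g: "lin K (tensor_module K X Y) W g"
    and eq: "\<And>x y. \<lbrakk>x \<in> carrier X; y \<in> carrier Y\<rbrakk> \<Longrightarrow> f (pure_tensor K X Y x y) = g (pure_tensor K X Y x y)"
    and t: "t \<in> carrier (tensor_module K X Y)"
  shows "f t = g t"
proof -
  let ?q = "\<lambda>u. bilinearity_rels K X Y +>\<^bsub>free_pairs\<^esub> u"
  note FM = F.module_axioms bilinearity_rels_submodule
  obtain u where u: "u \<in> carrier free_pairs" "t = ?q u"
    using t by (auto simp: tensor_module_def factor_carrier [OF FM])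
  have q: "lin K free_pairs (tensor_module K X Y) ?q"
    unfolding tensor_module_def by (rule lin_coset [OF FM])
  have "f (?q u) = g (?q u)"
    by (rule free_ext [OF X.is_cring W lin_comp [OF q f] lin_comp [OF q g] _ u(1)])
      (auto simp: eq pure_tensor_def [symmetric])
  then show ?thesis using u by simp
qed

lemma tensor_lift:
  assumes W: "module K W" and b: "bilin K X Y W b"
  shows "\<exists>h\<in>linear_maps K (tensor_module K X Y) W.
    \<forall>x\<in>carrier X. \<forall>y\<in>carrier Y. h (pure_tensor K X Y x y) = b x y"
proof -
  interpret W: module K W by (rule W)
  note FM = F.module_axioms bilinearity_rels_submodule
  have bc: "b x y \<in> carrier W" if "x \<in> carrier X" "y \<in> carrier Y" for x y
    using lin_closed bilinD(1) [OF b] that by metis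
  then obtain f where f: "lin K free_pairs W f"
    and fb: "\<And>x y. \<lbrakk>x \<in> carrier X; y \<in> carrier Y\<rbrakk> \<Longrightarrow> f (pair_gen x y) = b x y"
    using free_lift [OF X.is_cring W, of "carrier X \<times> carrier Y" "\<lambda>(x, y). b x y"] by force
  \<comment> \<open>The linear extension \<open>f\<close> is compared with the zero map. On a
    generator of the relations the equality is one of the bilinearity laws of
    \<open>b\<close>.\<close>
  have "f u = \<zero>\<^bsub>W\<^esub>" if "u \<in> bilinearity_rels K X Y" for u
  proof (rule lin_span_ext [OF F.module_axioms W f lin_const_zero [OF F.module_axioms W] _ _
        that [unfolded bilinearity_rels_def Let_def]])
  qed (use b in \<open>auto simp: lin_minus [OF F.module_axioms W f] lin_add [OF f] lin_smult [OF f] fb bc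
      pair_gen_closed W.minus_eq_zero_iff lin_add [OF bilinD(1)] lin_add [OF bilinD(2)]
      lin_smult [OF bilinD(1)] lin_smult [OF bilinD(2)]\<close>)
  from factor_lift [OF FM W f this] obtain h where "h \<in> linear_maps K (tensor_module K X Y) W"
    "\<And>u. u \<in> carrier free_pairs \<Longrightarrow> h (bilinearity_rels K X Y +>\<^bsub>free_pairs\<^esub> u) = f u"
    by (auto simp: tensor_module_def)
  then show ?thesis
    by (intro bexI [of _ h]) (auto simp: pure_tensor_def pair_gen_closed fb)
qed

end

section \<open>Dual bases\<close>

lemma lin_finsum_fun:
  assumes M: "module K M" and N: "module K N" and "finite I" and f: "\<And>i. i \<in> I \<Longrightarrow> lin K M N (f i)"
  shows "lin K M N (\<lambda>x. \<Oplus>\<^bsub>N\<^esub>i\<in>I. f i x)"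
  using \<open>finite I\<close> f
proof (induction I rule: finite_induct)
  case empty
  interpret N: module K N by (rule N)
  show ?case by (simp add: lin_const_zero [OF M N])
next
  case (insert i I)
  interpret N: module K N by (rule N)
  have "lin K M N (\<lambda>x. f i x \<oplus>\<^bsub>N\<^esub> (\<Oplus>\<^bsub>N\<^esub>i\<in>I. f i x))"
    using insert by (intro lin_plus [OF N]) auto
  moreover have "(\<Oplus>\<^bsub>N\<^esub>i\<in>insert i I. f i x) = f i x \<oplus>\<^bsub>N\<^esub> (\<Oplus>\<^bsub>N\<^esub>i\<in>I. f i x)" if "x \<in> carrier M" for x
    using insert that by (intro N.finsum_insert) (auto intro: lin_closed)
  ultimately show ?case
    by (subst lin_cong [OF M]) auto
qed

lemma submodule_finsum:
  assumes M: "module K M" and H: "submodule H K M" and "finite I" "\<And>i. i \<in> I \<Longrightarrow> f i \<in> H"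
  shows "finsum M f I \<in> H"
  using assms(3,4)
proof (induction I rule: finite_induct)
  case empty
  interpret M: module K M by (rule M)
  show ?case using subgroup.one_closed [OF submodule.axioms(1) [OF H]] by simp
next
  case (insert i I)
  interpret M: module K M by (rule M)
  have "finsum M f (insert i I) = f i \<oplus>\<^bsub>M\<^esub> finsum M f I"
    using insert M.submoduleE(1) [OF H] by (intro M.finsum_insert) auto
  then show ?case using insert M.submoduleE(5) [OF H] by simp
qed

context
  fixes K :: "'k ring" and V :: "('k, 'v, 'm) module_scheme" and B
  assumes V: "module K V" and B: "finite B" "B \<subseteq> carrier V"
begin

interpretation V: module K V by (rule V)

abbreviation (input) lincomb where "lincomb c \<equiv> (\<Oplus>\<^bsub>V\<^esub>b\<in>B. c b \<odot>\<^bsub>V\<^esub> b)"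

lemma lincomb_closed: "c \<in> B \<rightarrow> carrier K \<Longrightarrow> lincomb c \<in> carrier V"
  using B by (intro V.finsum_closed) auto

lemma lincomb_add:
  "\<lbrakk>c \<in> B \<rightarrow> carrier K; d \<in> B \<rightarrow> carrier K\<rbrakk> \<Longrightarrow> lincomb (\<lambda>b. c b \<oplus>\<^bsub>K\<^esub> d b) = lincomb c \<oplus>\<^bsub>V\<^esub> lincomb d"
proof -
  assume cd: "c \<in> B \<rightarrow> carrier K" "d \<in> B \<rightarrow> carrier K"
  then have "lincomb (\<lambda>b. c b \<oplus>\<^bsub>K\<^esub> d b) = (\<Oplus>\<^bsub>V\<^esub>b\<in>B. c b \<odot>\<^bsub>V\<^esub> b \<oplus>\<^bsub>V\<^esub> d b \<odot>\<^bsub>V\<^esub> b)"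
    using B by (intro V.finsum_cong') (auto simp: V.smult_l_distr Pi_iff subset_iff)
  also have "\<dots> = lincomb c \<oplus>\<^bsub>V\<^esub> lincomb d"
    using B cd by (intro V.finsum_addf) auto
  finally show ?thesis .
qed

lemma lincomb_smult:
  "\<lbrakk>e \<in> carrier K; c \<in> B \<rightarrow> carrier K\<rbrakk> \<Longrightarrow> lincomb (\<lambda>b. e \<otimes>\<^bsub>K\<^esub> c b) = e \<odot>\<^bsub>V\<^esub> lincomb c"
  using B by (subst V.finsum_smult_ldistr) (auto intro!: V.finsum_cong' simp: V.smult_assoc1 Pi_iff subset_iff)

text \<open>The span is an intersection of submodules, so its elements acquire coordinates as soon
  as the combinations are recognised as one of the submodules intersected.\<close>

lemma lin_span_lincomb: "lin_span K V B \<subseteq> {lincomb c |c. c \<in> B \<rightarrow> carrier K}"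
proof (rule lin_span_least)
  have "lincomb (\<lambda>b. \<zero>\<^bsub>K\<^esub>) = (\<Oplus>\<^bsub>V\<^esub>b\<in>B. \<zero>\<^bsub>V\<^esub>)"
    using B by (intro V.finsum_cong') auto
  then have zero: "lincomb (\<lambda>b. \<zero>\<^bsub>K\<^esub>) = \<zero>\<^bsub>V\<^esub>"
    by simp
  show "submodule {lincomb c |c. c \<in> B \<rightarrow> carrier K} K V"
  proof (rule V.submoduleI)
    show "\<ominus>\<^bsub>V\<^esub> v \<in> {lincomb c |c. c \<in> B \<rightarrow> carrier K}" if "v \<in> {lincomb c |c. c \<in> B \<rightarrow> carrier K}" for v
    proof -
      obtain c where c: "v = lincomb c" "c \<in> B \<rightarrow> carrier K" using \<open>v \<in> _\<close> by blast
      then have "\<ominus>\<^bsub>V\<^esub> v = lincomb (\<lambda>b. (\<ominus>\<^bsub>K\<^esub> \<one>\<^bsub>K\<^esub>) \<otimes>\<^bsub>K\<^esub> c b)"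
        by (subst lincomb_smult) (simp_all add: V.smult_l_minus lincomb_closed)
      then show ?thesis
        using c(2) by (intro CollectI exI [of _ "\<lambda>b. (\<ominus>\<^bsub>K\<^esub> \<one>\<^bsub>K\<^esub>) \<otimes>\<^bsub>K\<^esub> c b"] conjI) auto
    qed
  next
    fix u v assume "u \<in> {lincomb c |c. c \<in> B \<rightarrow> carrier K}" "v \<in> {lincomb c |c. c \<in> B \<rightarrow> carrier K}"
    then obtain c d where "u = lincomb c" "c \<in> B \<rightarrow> carrier K" "v = lincomb d" "d \<in> B \<rightarrow> carrier K" by blast
    then show "u \<oplus>\<^bsub>V\<^esub> v \<in> {lincomb c |c. c \<in> B \<rightarrow> carrier K}"
      by (intro CollectI exI [of _ "\<lambda>b. c b \<oplus>\<^bsub>K\<^esub> d b"] conjI) (auto simp: lincomb_add)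
  next
    fix e v assume "e \<in> carrier K" "v \<in> {lincomb c |c. c \<in> B \<rightarrow> carrier K}"
    then obtain c where "e \<in> carrier K" "v = lincomb c" "c \<in> B \<rightarrow> carrier K" by blast
    then show "e \<odot>\<^bsub>V\<^esub> v \<in> {lincomb c |c. c \<in> B \<rightarrow> carrier K}"
      by (intro CollectI exI [of _ "\<lambda>b. e \<otimes>\<^bsub>K\<^esub> c b"] conjI) (auto simp: lincomb_smult)
  next
    show "\<zero>\<^bsub>V\<^esub> \<in> {lincomb c |c. c \<in> B \<rightarrow> carrier K}"
      using zero by (intro CollectI exI [of _ "\<lambda>b. \<zero>\<^bsub>K\<^esub>"] conjI) auto
  qed (auto intro: lincomb_closed)
  show "B \<subseteq> {lincomb c |c. c \<in> B \<rightarrow> carrier K}"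
  proof
    fix b assume b: "b \<in> B"
    have "lincomb (\<lambda>b'. if b = b' then \<one>\<^bsub>K\<^esub> else \<zero>\<^bsub>K\<^esub>) = (\<Oplus>\<^bsub>V\<^esub>b'\<in>B. if b = b' then b' else \<zero>\<^bsub>V\<^esub>)"
      using B by (intro V.finsum_cong') auto
    also have "\<dots> = b"
      using B b by (intro V.add.finprod_singleton) auto
    finally show "b \<in> {lincomb c |c. c \<in> B \<rightarrow> carrier K}"
      by (intro CollectI exI [of _ "\<lambda>b'. if b = b' then \<one>\<^bsub>K\<^esub> else \<zero>\<^bsub>K\<^esub>"] conjI) auto
  qed
qed

end

text \<open>A spanning set of least cardinality is independent, so coordinates with respect to it
  are unique. Uniqueness makes the coordinate functions linear, and these functions form the dual
  family.\<close>

lemma finite_dim_dual_basis: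
  assumes K: "field K" and V: "module K V" and fd: "finite_dim K V"
  shows "\<exists>B \<beta>. finite B \<and> B \<subseteq> carrier V \<and> (\<forall>b\<in>B. \<beta> b \<in> linear_maps K V (ground_module K)) \<and>
    (\<forall>v\<in>carrier V. (\<Oplus>\<^bsub>V\<^esub>b\<in>B. \<beta> b v \<odot>\<^bsub>V\<^esub> b) = v)"
proof -
  interpret K: field K by (rule K)
  interpret V: module K V by (rule V)
  let ?spans = "\<lambda>B. finite B \<and> B \<subseteq> carrier V \<and> lin_span K V B = carrier V"
  obtain B0 where "?spans B0" using fd by (auto simp: finite_dim_def)
  then obtain B where B: "finite B" "B \<subseteq> carrier V" "lin_span K V B = carrier V"
    and min: "\<And>B'. ?spans B' \<Longrightarrow> card B \<le> card B'"
    using ex_has_least_nat [of ?spans B0 card] by blast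
  let ?L = "\<lambda>c. \<Oplus>\<^bsub>V\<^esub>b\<in>B. c b \<odot>\<^bsub>V\<^esub> b"
  \<comment> \<open>If \<open>c b\<close> were nonzero, dividing the relation by it would put
    \<open>b\<close> into the span of the remaining vectors, which would then be a smaller spanning
    set.\<close>
  have indep: "c b = \<zero>\<^bsub>K\<^esub>" if c: "c \<in> B \<rightarrow> carrier K" and 0: "?L c = \<zero>\<^bsub>V\<^esub>" and b: "b \<in> B" for c b
  proof (rule ccontr)
    assume nz: "c b \<noteq> \<zero>\<^bsub>K\<^esub>"
    define B' where "B' = B - {b}"
    have B': "finite B'" "B' \<subseteq> carrier V" "b \<notin> B'" "insert b B' = B" using B b by (auto simp: B'_def)
    note sub = lin_span_submodule [OF V B'(2)]
    define s where "s = (\<Oplus>\<^bsub>V\<^esub>b\<in>B'. c b \<odot>\<^bsub>V\<^esub> b)"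
    have cb: "c b \<in> carrier K" and bV: "b \<in> carrier V" using c b B by auto
    have s: "s \<in> lin_span K V B'"
      unfolding s_def
    proof (rule submodule_finsum [OF V sub B'(1)])
      fix i assume "i \<in> B'"
      then show "c i \<odot>\<^bsub>V\<^esub> i \<in> lin_span K V B'"
        using c lin_span_superset [of B' K V] by (intro V.submoduleE(4) [OF sub]) (auto simp: B'_def)
    qed
    then have sV: "s \<in> carrier V" using V.submoduleE(1) [OF sub] by blast
    have "?L c = c b \<odot>\<^bsub>V\<^esub> b \<oplus>\<^bsub>V\<^esub> s"
      unfolding s_def B'(4) [symmetric] using B' c cb bV by (intro V.finsum_insert) (auto simp: B'_def)
    then have "c b \<odot>\<^bsub>V\<^esub> b = \<ominus>\<^bsub>V\<^esub> s"
      using 0 cb bV sV by (simp add: V.minus_equality)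
    then have "inv\<^bsub>K\<^esub> (c b) \<odot>\<^bsub>V\<^esub> (c b \<odot>\<^bsub>V\<^esub> b) \<in> lin_span K V B'"
      using s cb nz by (simp add: K.field_Units V.submoduleE(3,4) [OF sub])
    then have "b \<in> lin_span K V B'"
      using cb nz bV by (simp add: K.field_Units V.smult_assoc1 [symmetric])
    then have "B \<subseteq> lin_span K V B'"
      using lin_span_superset [of B'] by (auto simp: B'(4) [symmetric])
    then have "lin_span K V B' = carrier V"
      using lin_span_least [OF sub] B(3) V.submoduleE(1) [OF sub] by blast
    then have "card B \<le> card B'"
      using B' by (intro min) auto
    then show False using card_Diff1_less [OF B(1) b] by (simp add: B'_def)
  qed
  have inj: "c b = d b" if c: "c \<in> B \<rightarrow> carrier K" and d: "d \<in> B \<rightarrow> carrier K" and eq: "?L c = ?L d" and b: "b \<in> B" for c d b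
  proof -
    \<comment> \<open>The negative of \<open>d\<close>, written as a scalar multiple so that
      \<open>lincomb_smult\<close> applies; independence is then used for the difference of the two
      coefficient families.\<close>
    define d' where "d' = (\<lambda>b. (\<ominus>\<^bsub>K\<^esub> \<one>\<^bsub>K\<^esub>) \<otimes>\<^bsub>K\<^esub> d b)"
    have d': "d' \<in> B \<rightarrow> carrier K" using d by (auto simp: d'_def)
    have "?L (\<lambda>b. c b \<oplus>\<^bsub>K\<^esub> d' b) = ?L c \<oplus>\<^bsub>V\<^esub> ?L d'"
      by (rule lincomb_add [OF V B(1,2) c d'])
    also have "?L d' = \<ominus>\<^bsub>V\<^esub> ?L d"
      unfolding d'_def using lincomb_smult [OF V B(1,2) _ d, of "\<ominus>\<^bsub>K\<^esub> \<one>\<^bsub>K\<^esub>"] lincomb_closed [OF V B(1,2) d]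
      by (simp add: V.smult_l_minus)
    finally have "?L (\<lambda>b. c b \<oplus>\<^bsub>K\<^esub> d' b) = \<zero>\<^bsub>V\<^esub>"
      using eq lincomb_closed [OF V B(1,2) d] by (simp add: V.r_neg)
    then have "c b \<oplus>\<^bsub>K\<^esub> d' b = \<zero>\<^bsub>K\<^esub>"
      using c d' b by (intro indep) auto
    moreover have cb: "c b \<in> carrier K" "d b \<in> carrier K" using b c d by auto
    moreover have "d' b = \<ominus>\<^bsub>K\<^esub> d b" using K.l_minus [OF K.one_closed cb(2)] cb(2) by (simp add: d'_def)
    ultimately show ?thesis using K.minus_eq_zero_iff [of "c b" "d b"] by (simp add: a_minus_def)
  qed
  have "\<exists>c. c \<in> B \<rightarrow> carrier K \<and> ?L c = v" if "v \<in> carrier V" for v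
    using lin_span_lincomb [OF V B(1,2)] that B(3) by blast
  \<comment> \<open>So far an arbitrary choice of coordinates. Its linearity follows from
    \<open>inj\<close>, because the sum of the coordinates of two vectors represents the same vector
    as the coordinates of their sum.\<close>
  then obtain C where C: "\<And>v. v \<in> carrier V \<Longrightarrow> C v \<in> B \<rightarrow> carrier K" and LC: "\<And>v. v \<in> carrier V \<Longrightarrow> ?L (C v) = v"
    by metis
  define \<beta> where "\<beta> b = (\<lambda>v\<in>carrier V. C v b)" for b
  have gsel: "carrier (ground_module K) = carrier K" "\<And>x y. x \<oplus>\<^bsub>ground_module K\<^esub> y = x \<oplus>\<^bsub>K\<^esub> y"
    "\<And>x y. x \<odot>\<^bsub>ground_module K\<^esub> y = x \<otimes>\<^bsub>K\<^esub> y"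
    by (simp_all add: ground_module_def ring.defs module.defs)
  have "\<beta> b \<in> linear_maps K V (ground_module K)" if b: "b \<in> B" for b
    unfolding linear_maps_iff
  proof (intro conjI linI)
    show "\<beta> b v \<in> carrier (ground_module K)" if "v \<in> carrier V" for v
      using C [OF that] b that by (auto simp: \<beta>_def gsel)
    fix u v assume u: "u \<in> carrier V" and v: "v \<in> carrier V"
    have "C (u \<oplus>\<^bsub>V\<^esub> v) b = C u b \<oplus>\<^bsub>K\<^esub> C v b"
      using inj [of "C (u \<oplus>\<^bsub>V\<^esub> v)" "\<lambda>b. C u b \<oplus>\<^bsub>K\<^esub> C v b", OF C _ _ b] u v C [OF u] C [OF v]
      by (auto simp: lincomb_add [OF V B(1,2)] LC)
    then show "\<beta> b (u \<oplus>\<^bsub>V\<^esub> v) = \<beta> b u \<oplus>\<^bsub>ground_module K\<^esub> \<beta> b v"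
      using u v by (simp add: \<beta>_def gsel)
  next
    fix e v assume e: "e \<in> carrier K" and v: "v \<in> carrier V"
    have "C (e \<odot>\<^bsub>V\<^esub> v) b = e \<otimes>\<^bsub>K\<^esub> C v b"
      using inj [of "C (e \<odot>\<^bsub>V\<^esub> v)" "\<lambda>b. e \<otimes>\<^bsub>K\<^esub> C v b", OF C _ _ b] e v C [OF v]
      by (auto simp: lincomb_smult [OF V B(1,2)] LC)
    then show "\<beta> b (e \<odot>\<^bsub>V\<^esub> v) = e \<odot>\<^bsub>ground_module K\<^esub> \<beta> b v"
      using e v by (simp add: \<beta>_def gsel)
  qed (simp add: \<beta>_def)
  moreover have "(\<Oplus>\<^bsub>V\<^esub>b\<in>B. \<beta> b v \<odot>\<^bsub>V\<^esub> b) = v" if "v \<in> carrier V" for v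
    using that LC by (simp add: \<beta>_def)
  ultimately show ?thesis using B by blast
qed

section \<open>Weak bimodules\<close>

text \<open>
  \<open>A\<close> enters only as an index set for two commuting families of linear operators, a structure that
  every tensor product and Hom space below inherits.
\<close>

locale weak_bimodule =
  fixes K :: "'k ring" and A :: "('k, 'a) module" and M :: "('a, 'k, 'x) bimodule"
  assumes is_module: "module K M"
    and lin_lact: "a \<in> carrier A \<Longrightarrow> lin K M M (lact M a)"
    and lin_ract: "a \<in> carrier A \<Longrightarrow> lin K M M (\<lambda>x. ract M x a)"
    and lact_ract: "\<lbrakk>a \<in> carrier A; b \<in> carrier A; x \<in> carrier M\<rbrakk>
      \<Longrightarrow> ract M (lact M a x) b = lact M a (ract M x b)"

lemma fd_bimodule_weak: "fd_bimodule K A M \<Longrightarrow> weak_bimodule K A M"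
  by (rule weak_bimodule.intro)
    (auto intro!: linI simp: fd_bimodule.is_module fd_bimodule.lact_closed fd_bimodule.ract_closed
      fd_bimodule.lact_add fd_bimodule.ract_add fd_bimodule.lact_smult fd_bimodule.ract_smult
      fd_bimodule.lact_ract)

text \<open>Tensor products, Hom spaces and duals are module records extended by two actions; only
  the fields compared here enter the module axioms.\<close>

lemma module_cong:
  assumes "module K M" "carrier N = carrier M" "\<zero>\<^bsub>N\<^esub> = \<zero>\<^bsub>M\<^esub>"
    "\<And>x y. x \<oplus>\<^bsub>N\<^esub> y = x \<oplus>\<^bsub>M\<^esub> y" "\<And>c x. c \<odot>\<^bsub>N\<^esub> x = c \<odot>\<^bsub>M\<^esub> x"
  shows "module K N"
  by (rule module_surj_image [OF assms(1), where q = "\<lambda>x. x"]) (simp_all add: assms(2-))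

lemma lin_cong_structure:
  assumes "carrier M' = carrier M" "\<And>x y. x \<oplus>\<^bsub>M'\<^esub> y = x \<oplus>\<^bsub>M\<^esub> y" "\<And>c x. c \<odot>\<^bsub>M'\<^esub> x = c \<odot>\<^bsub>M\<^esub> x"
    and "carrier N' = carrier N" "\<And>x y. x \<oplus>\<^bsub>N'\<^esub> y = x \<oplus>\<^bsub>N\<^esub> y" "\<And>c x. c \<odot>\<^bsub>N'\<^esub> x = c \<odot>\<^bsub>N\<^esub> x"
  shows "lin K M' N' f \<longleftrightarrow> lin K M N f"
  by (simp add: lin_def assms)

lemma bilin_comp:
  assumes "bilin K X' Y' W b" "lin K X X' f" "lin K Y Y' g"
  shows "bilin K X Y W (\<lambda>x y. b (f x) (g y))"
  using assms(2,3) lin_closed [OF assms(2)] lin_closed [OF assms(3)]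
  by (intro bilinI) (auto intro: lin_comp bilinD [OF assms(1)] lin_comp [of K Y Y' g W "b (f _)"]
    lin_comp [of K X X' f W "\<lambda>x. b x (g _)"])

lemma bilin_post:
  assumes "bilin K X Y W b" "lin K W V h"
  shows "bilin K X Y V (\<lambda>x y. h (b x y))"
  by (rule bilinI) (blast intro: lin_comp [OF bilinD(1) [OF assms(1)] assms(2)],
    blast intro: lin_comp [OF bilinD(2) [OF assms(1)] assms(2)])

lemma bilin_closed: "\<lbrakk>bilin K X Y W b; x \<in> carrier X; y \<in> carrier Y\<rbrakk> \<Longrightarrow> b x y \<in> carrier W"
  by (rule lin_closed [OF bilinD(1)])

lemma tensor_maps_eqI:
  assumes "module K X" "module K Y" "module K W"
    and h: "h \<in> linear_maps K (tensor_module K X Y) W" and h': "h' \<in> linear_maps K (tensor_module K X Y) W"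
    and eq: "\<And>x y. \<lbrakk>x \<in> carrier X; y \<in> carrier Y\<rbrakk> \<Longrightarrow> h (pure_tensor K X Y x y) = h' (pure_tensor K X Y x y)"
  shows "h = h'"
proof (rule extensionalityI)
  show "h \<in> extensional (carrier (tensor_module K X Y))" "h' \<in> extensional (carrier (tensor_module K X Y))"
    using h h' by (simp_all add: linear_maps_iff)
  show "h t = h' t" if "t \<in> carrier (tensor_module K X Y)" for t
    by (rule tensor_ext [OF assms(1-3), where f = h and g = h']) (use assms(4-) that in \<open>simp_all add: linear_maps_iff\<close>)
qed

context
  fixes K :: "'k ring"
begin

context
  fixes X :: "('k, 'x, 'm) module_scheme" and Y :: "('k, 'y, 'n) module_scheme"
    and X' :: "('k, 'x2, 'm2) module_scheme" and Y' :: "('k, 'y2, 'n2) module_scheme" and f g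
  assumes M: "module K X" "module K Y" "module K X'" "module K Y'"
    and f: "lin K X X' f" and g: "lin K Y Y' g"
begin

text \<open>Evaluates the definite description: the values prescribed on pure tensors are bilinear
  because \<open>f\<close> and \<open>g\<close> are linear, and a linear map is determined by
  them.\<close>

lemma tensor_map_aux:
  "tensor_map K X Y X' Y' f g \<in> linear_maps K (tensor_module K X Y) (tensor_module K X' Y') \<and>
    (\<forall>x\<in>carrier X. \<forall>y\<in>carrier Y.
      tensor_map K X Y X' Y' f g (pure_tensor K X Y x y) = pure_tensor K X' Y' (f x) (g y))"
  (is "?P (tensor_map K X Y X' Y' f g)")
  unfolding tensor_map_def
proof (rule theI' [where P = ?P])
  note T' = tensor_module_module [OF M(3,4)]
  have "\<exists>h. ?P h"
    using tensor_lift [OF M(1,2) T' bilin_comp [OF pure_tensor_bilin [OF M(3,4)] f g]] by blast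
  then show "\<exists>!h. ?P h"
    by (blast intro: tensor_maps_eqI [OF M(1,2) T'])
qed

end

end

text \<open>The analogue of \<open>lin\<close> for bimodule maps, again without
  extensionality.\<close>

definition bhom ::
  "'k ring \<Rightarrow> ('k, 'a) module \<Rightarrow> ('a, 'k, 'x) bimodule \<Rightarrow> ('a, 'k, 'y) bimodule \<Rightarrow> ('x \<Rightarrow> 'y) \<Rightarrow> bool" where
  "bhom K A M N f \<longleftrightarrow> lin K M N f \<and> (\<forall>a\<in>carrier A. \<forall>x\<in>carrier M.
     f (lact M a x) = lact N a (f x) \<and> f (ract M x a) = ract N (f x) a)"

lemma bimod_hom_iff: "f \<in> bimod_hom K A M N \<longleftrightarrow> bhom K A M N f \<and> f \<in> extensional (carrier M)"
  by (auto simp: bimod_hom_def bhom_def linear_maps_iff)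

text \<open>Fixes \<open>K\<close> and \<open>A\<close> once more, solely to restore the infix
  notation: outside the context of their definitions the constants take both as explicit
  arguments.\<close>

locale bimodule_tensors =
  fixes K :: "'k ring" and A :: "('k, 'a) module"
begin

abbreviation tensor_field' (infixr "\<otimes>\<^sub>K" 70) where "X \<otimes>\<^sub>K Y \<equiv> tensor_field K X Y"
abbreviation tensor_over' (infixr "\<otimes>\<^sub>A" 70) where "X \<otimes>\<^sub>A Y \<equiv> tensor_over K A X Y"
abbreviation cotensor' (infixr "\<otimes>\<^sup>A" 70) where "X \<otimes>\<^sup>A Y \<equiv> cotensor K A X Y"
abbreviation "wb \<equiv> weak_bimodule K A"
abbreviation "pt \<equiv> pure_tensor K"
abbreviation "cl \<equiv> tensor_class K A"
abbreviation "bh \<equiv> bhom K A"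

lemma bhomD:
  assumes "bh M N f"
  shows "lin K M N f"
    and "\<lbrakk>a \<in> carrier A; x \<in> carrier M\<rbrakk> \<Longrightarrow> f (lact M a x) = lact N a (f x)"
    and "\<lbrakk>a \<in> carrier A; x \<in> carrier M\<rbrakk> \<Longrightarrow> f (ract M x a) = ract N (f x) a"
  using assms by (auto simp: bhom_def)

lemma bhomI:
  assumes "lin K M N f"
    and "\<And>a x. \<lbrakk>a \<in> carrier A; x \<in> carrier M\<rbrakk> \<Longrightarrow> f (lact M a x) = lact N a (f x)"
    and "\<And>a x. \<lbrakk>a \<in> carrier A; x \<in> carrier M\<rbrakk> \<Longrightarrow> f (ract M x a) = ract N (f x) a"
  shows "bh M N f"
  using assms by (auto simp: bhom_def)

lemma wbD:
  assumes "wb M"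
  shows "module K M" "a \<in> carrier A \<Longrightarrow> lin K M M (lact M a)"
    "a \<in> carrier A \<Longrightarrow> lin K M M (\<lambda>x. ract M x a)"
    "\<lbrakk>a \<in> carrier A; x \<in> carrier M\<rbrakk> \<Longrightarrow> lact M a x \<in> carrier M"
    "\<lbrakk>a \<in> carrier A; x \<in> carrier M\<rbrakk> \<Longrightarrow> ract M x a \<in> carrier M"
    "\<lbrakk>a \<in> carrier A; b \<in> carrier A; x \<in> carrier M\<rbrakk> \<Longrightarrow> ract M (lact M a x) b = lact M a (ract M x b)"
proof -
  interpret weak_bimodule K A M by (rule assms)
  show "module K M" by (rule is_module)
  show "\<lbrakk>a \<in> carrier A; x \<in> carrier M\<rbrakk> \<Longrightarrow> lact M a x \<in> carrier M" by (rule lin_closed [OF lin_lact])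
  show "\<lbrakk>a \<in> carrier A; x \<in> carrier M\<rbrakk> \<Longrightarrow> ract M x a \<in> carrier M" by (rule lin_closed [OF lin_ract])
qed (fact weak_bimodule.lin_lact [OF assms] weak_bimodule.lin_ract [OF assms] weak_bimodule.lact_ract [OF assms])+

lemma bhom_idm: "wb M \<Longrightarrow> bh M M (idm M)"
  by (rule bhomI) (simp_all add: wbD lin_idm)

section \<open>Tensor products of weak bimodules over \<open>K\<close> and over
  \<open>A\<close>\<close>

lemma tensor_field_sel:
  "carrier (X \<otimes>\<^sub>K Y) = carrier (tensor_module K X Y)"
  "\<zero>\<^bsub>X \<otimes>\<^sub>K Y\<^esub> = \<zero>\<^bsub>tensor_module K X Y\<^esub>"
  "s \<oplus>\<^bsub>X \<otimes>\<^sub>K Y\<^esub> t = s \<oplus>\<^bsub>tensor_module K X Y\<^esub> t"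
  "c \<odot>\<^bsub>X \<otimes>\<^sub>K Y\<^esub> t = c \<odot>\<^bsub>tensor_module K X Y\<^esub> t"
  "lact (X \<otimes>\<^sub>K Y) a = tensor_map K X Y X Y (lact X a) (idm Y)"
  "ract (X \<otimes>\<^sub>K Y) t a = tensor_map K X Y X Y (idm X) (\<lambda>y. ract Y y a) t"
  by (simp_all add: tensor_field_def module.defs bimodule.defs)

lemma lin_tensor_field:
  "lin K (X \<otimes>\<^sub>K Y) W f \<longleftrightarrow> lin K (tensor_module K X Y) W f"
  "lin K W (X \<otimes>\<^sub>K Y) g \<longleftrightarrow> lin K W (tensor_module K X Y) g"
  by (rule lin_cong_structure; simp add: tensor_field_sel)+

lemma linear_maps_tensor_field:
  "linear_maps K (X \<otimes>\<^sub>K Y) W = linear_maps K (tensor_module K X Y) W"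
  by (auto simp: linear_maps_iff lin_tensor_field tensor_field_sel)

lemma tensor_field_module: "\<lbrakk>module K X; module K Y\<rbrakk> \<Longrightarrow> module K (X \<otimes>\<^sub>K Y)"
  by (rule module_cong [OF tensor_module_module]) (simp_all add: tensor_field_sel)

lemma pt_bilin: "\<lbrakk>module K X; module K Y\<rbrakk> \<Longrightarrow> bilin K X Y (X \<otimes>\<^sub>K Y) (pt X Y)"
  using pure_tensor_bilin [of K X Y] by (simp add: bilin_def lin_tensor_field)

lemma pt_closed: "\<lbrakk>module K X; module K Y; x \<in> carrier X; y \<in> carrier Y\<rbrakk> \<Longrightarrow> pt X Y x y \<in> carrier (X \<otimes>\<^sub>K Y)"
  by (rule bilin_closed [OF pt_bilin])

lemma tensor_field_ext:
  assumes "module K X" "module K Y" "module K W" "lin K (X \<otimes>\<^sub>K Y) W f" "lin K (X \<otimes>\<^sub>K Y) W g"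
    and "\<And>x y. \<lbrakk>x \<in> carrier X; y \<in> carrier Y\<rbrakk> \<Longrightarrow> f (pt X Y x y) = g (pt X Y x y)"
    and "t \<in> carrier (X \<otimes>\<^sub>K Y)"
  shows "f t = g t"
  by (rule tensor_ext [where f = f and g = g]) (use assms in \<open>simp_all add: lin_tensor_field tensor_field_sel\<close>)

lemma tensor_field_lift:
  assumes "module K X" "module K Y" "module K W" "bilin K X Y W b"
  shows "\<exists>h. h \<in> linear_maps K (X \<otimes>\<^sub>K Y) W \<and> lin K (X \<otimes>\<^sub>K Y) W h \<and>
    (\<forall>x\<in>carrier X. \<forall>y\<in>carrier Y. h (pt X Y x y) = b x y)"
  using tensor_lift [OF assms] by (auto simp: linear_maps_tensor_field linear_maps_iff lin_tensor_field)

lemma tensor_map_lin: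
  assumes "module K X" "module K Y" "module K X'" "module K Y'" "lin K X X' f" "lin K Y Y' g"
  shows "lin K (X \<otimes>\<^sub>K Y) (X' \<otimes>\<^sub>K Y') (tensor_map K X Y X' Y' f g)"
  using tensor_map_aux [OF assms] by (simp add: linear_maps_iff lin_tensor_field)

lemma tensor_map_pure:
  assumes "module K X" "module K Y" "module K X'" "module K Y'" "lin K X X' f" "lin K Y Y' g"
    and "x \<in> carrier X" "y \<in> carrier Y"
  shows "tensor_map K X Y X' Y' f g (pt X Y x y) = pt X' Y' (f x) (g y)"
  using tensor_map_aux [OF assms(1-6)] assms(7,8) by simp

lemma cotensor_sel:
  "\<zero>\<^bsub>X \<otimes>\<^sup>A Y\<^esub> = \<zero>\<^bsub>X \<otimes>\<^sub>K Y\<^esub>"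
  "s \<oplus>\<^bsub>X \<otimes>\<^sup>A Y\<^esub> t = s \<oplus>\<^bsub>X \<otimes>\<^sub>K Y\<^esub> t"
  "c \<odot>\<^bsub>X \<otimes>\<^sup>A Y\<^esub> t = c \<odot>\<^bsub>X \<otimes>\<^sub>K Y\<^esub> t"
  "lact (X \<otimes>\<^sup>A Y) a t = lact (X \<otimes>\<^sub>K Y) a t"
  "ract (X \<otimes>\<^sup>A Y) t a = ract (X \<otimes>\<^sub>K Y) t a"
  by (simp_all add: cotensor_def)

lemma cotensor_iff:
  "t \<in> carrier (X \<otimes>\<^sup>A Y) \<longleftrightarrow> t \<in> carrier (X \<otimes>\<^sub>K Y) \<and> (\<forall>a\<in>carrier A.
     tensor_map K X Y X Y (\<lambda>x. ract X x a) (idm Y) t = tensor_map K X Y X Y (idm X) (lact Y a) t)"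
  by (simp add: cotensor_def)

lemma cotensor_subset: "t \<in> carrier (X \<otimes>\<^sup>A Y) \<Longrightarrow> t \<in> carrier (X \<otimes>\<^sub>K Y)"
  by (simp add: cotensor_iff)

context
  fixes X :: "('a, 'k, 'x) bimodule" and Y :: "('a, 'k, 'y) bimodule"
  assumes X: "wb X" and Y: "wb Y"
begin

private lemmas XY = wbD(1) [OF X] wbD(1) [OF Y]

lemma lact_pt:
  "\<lbrakk>a \<in> carrier A; x \<in> carrier X; y \<in> carrier Y\<rbrakk> \<Longrightarrow> lact (X \<otimes>\<^sub>K Y) a (pt X Y x y) = pt X Y (lact X a x) y"
  by (simp add: tensor_field_sel tensor_map_pure XY wbD(2) [OF X] lin_idm)

lemma ract_pt:
  "\<lbrakk>a \<in> carrier A; x \<in> carrier X; y \<in> carrier Y\<rbrakk> \<Longrightarrow> ract (X \<otimes>\<^sub>K Y) (pt X Y x y) a = pt X Y x (ract Y y a)"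
  by (simp add: tensor_field_sel tensor_map_pure XY wbD(3) [OF Y] lin_idm)

text \<open>The outer actions move different factors, so they commute on pure tensors and hence
  everywhere.\<close>

lemma wb_tensor_field: "wb (X \<otimes>\<^sub>K Y)"
proof (rule weak_bimodule.intro)
  note XYm = tensor_field_module [OF XY]
  show "module K (X \<otimes>\<^sub>K Y)" by (rule XYm)
  show l: "lin K (X \<otimes>\<^sub>K Y) (X \<otimes>\<^sub>K Y) (lact (X \<otimes>\<^sub>K Y) a)" if "a \<in> carrier A" for a
    using that by (simp add: tensor_field_sel tensor_map_lin XY wbD(2) [OF X] lin_idm)
  show r: "lin K (X \<otimes>\<^sub>K Y) (X \<otimes>\<^sub>K Y) (\<lambda>t. ract (X \<otimes>\<^sub>K Y) t a)" if "a \<in> carrier A" for a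
    using that by (simp add: tensor_field_sel tensor_map_lin XY wbD(3) [OF Y] lin_idm)
  fix a b t assume a: "a \<in> carrier A" and b: "b \<in> carrier A" and t: "t \<in> carrier (X \<otimes>\<^sub>K Y)"
  show "ract (X \<otimes>\<^sub>K Y) (lact (X \<otimes>\<^sub>K Y) a t) b = lact (X \<otimes>\<^sub>K Y) a (ract (X \<otimes>\<^sub>K Y) t b)"
    by (rule tensor_field_ext [OF XY XYm lin_comp [OF l r] lin_comp [OF r l] _ t])
      (simp_all add: a b lact_pt ract_pt wbD(4) [OF X] wbD(5) [OF Y])
qed

private lemmas T = wb_tensor_field wbD(1) [OF wb_tensor_field]

interpretation T: module K "X \<otimes>\<^sub>K Y" by (rule T(2))

lemma balance_rels_submodule: "submodule (balance_rels K A X Y) K (X \<otimes>\<^sub>K Y)"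
  unfolding balance_rels_def
  by (rule lin_span_submodule [OF T(2)])
    (auto intro!: T.minus_closed pt_closed XY wbD(4) [OF Y] wbD(5) [OF X])

lemma balance_rels_mem:
  "\<lbrakk>x \<in> carrier X; a \<in> carrier A; y \<in> carrier Y\<rbrakk> \<Longrightarrow>
    pt X Y (ract X x a) y \<ominus>\<^bsub>X \<otimes>\<^sub>K Y\<^esub> pt X Y x (lact Y a y) \<in> balance_rels K A X Y"
  unfolding balance_rels_def by (rule subsetD [OF lin_span_superset]) blast

lemma balance_rels_least:
  assumes N: "submodule N K (X \<otimes>\<^sub>K Y)"
    and mem: "\<And>x a y. \<lbrakk>x \<in> carrier X; a \<in> carrier A; y \<in> carrier Y\<rbrakk> \<Longrightarrow>
      pt X Y (ract X x a) y \<ominus>\<^bsub>X \<otimes>\<^sub>K Y\<^esub> pt X Y x (lact Y a y) \<in> N"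
  shows "balance_rels K A X Y \<subseteq> N"
  unfolding balance_rels_def by (rule lin_span_least [OF N]) (auto intro: mem)

text \<open>Since the two actions on \<open>X\<close> commute, the outer left action carries the
  generator for \<open>x\<close> to the generator for the translate of \<open>x\<close>. This
  stability lets the action descend to the quotient.\<close>

lemma balance_rels_lact:
  assumes a: "a \<in> carrier A" and t: "t \<in> balance_rels K A X Y"
  shows "lact (X \<otimes>\<^sub>K Y) a t \<in> balance_rels K A X Y"
proof -
  note l = wbD(2) [OF T(1) a]
  have "balance_rels K A X Y \<subseteq> {t \<in> carrier (X \<otimes>\<^sub>K Y). lact (X \<otimes>\<^sub>K Y) a t \<in> balance_rels K A X Y}"
    by (rule balance_rels_least [OF submodule_vimage [OF T(2,2) balance_rels_submodule l]])
      (simp add: a pt_closed XY wbD(4) [OF X] wbD(5) [OF X] wbD(4) [OF Y] lin_minus [OF T(2) T(2) l]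
        lact_pt balance_rels_mem wbD(6) [OF X, symmetric])
  then show ?thesis using t by blast
qed

text \<open>Here it is the commutation of the two actions on \<open>Y\<close> that carries
  generators to generators.\<close>

lemma balance_rels_ract:
  assumes a: "a \<in> carrier A" and t: "t \<in> balance_rels K A X Y"
  shows "ract (X \<otimes>\<^sub>K Y) t a \<in> balance_rels K A X Y"
proof -
  note r = wbD(3) [OF T(1) a]
  have "balance_rels K A X Y \<subseteq> {t \<in> carrier (X \<otimes>\<^sub>K Y). ract (X \<otimes>\<^sub>K Y) t a \<in> balance_rels K A X Y}"
    by (rule balance_rels_least [OF submodule_vimage [OF T(2,2) balance_rels_submodule r]])
      (simp add: a pt_closed XY wbD(4) [OF Y] wbD(5) [OF X] wbD(5) [OF Y] lin_minus [OF T(2) T(2) r]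
        ract_pt balance_rels_mem wbD(6) [OF Y])
  then show ?thesis using t by blast
qed

lemma tensor_over_sel:
  "carrier (X \<otimes>\<^sub>A Y) = carrier (factor_module (X \<otimes>\<^sub>K Y) (balance_rels K A X Y))"
  "\<zero>\<^bsub>X \<otimes>\<^sub>A Y\<^esub> = \<zero>\<^bsub>factor_module (X \<otimes>\<^sub>K Y) (balance_rels K A X Y)\<^esub>"
  "s \<oplus>\<^bsub>X \<otimes>\<^sub>A Y\<^esub> t = s \<oplus>\<^bsub>factor_module (X \<otimes>\<^sub>K Y) (balance_rels K A X Y)\<^esub> t"
  "c \<odot>\<^bsub>X \<otimes>\<^sub>A Y\<^esub> t = c \<odot>\<^bsub>factor_module (X \<otimes>\<^sub>K Y) (balance_rels K A X Y)\<^esub> t"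
  "lact (X \<otimes>\<^sub>A Y) a = coset_map (X \<otimes>\<^sub>K Y) (balance_rels K A X Y) (lact (X \<otimes>\<^sub>K Y) a)"
  "ract (X \<otimes>\<^sub>A Y) t a = coset_map (X \<otimes>\<^sub>K Y) (balance_rels K A X Y) (\<lambda>t. ract (X \<otimes>\<^sub>K Y) t a) t"
  by (simp_all add: tensor_over_def module.defs bimodule.defs)

private lemmas F = T(2) balance_rels_submodule

lemma tensor_over_module: "module K (X \<otimes>\<^sub>A Y)"
  by (rule module_cong [OF factor_module_module [OF F]]) (simp_all add: tensor_over_sel)

lemma proj_lin: "lin K (X \<otimes>\<^sub>K Y) (X \<otimes>\<^sub>A Y) (proj K A X Y)"
proof -
  have "lin K (X \<otimes>\<^sub>K Y) (X \<otimes>\<^sub>A Y) (\<lambda>t. balance_rels K A X Y +>\<^bsub>X \<otimes>\<^sub>K Y\<^esub> t)"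
    using lin_coset [OF F]
    by (subst lin_cong_structure [where M = "X \<otimes>\<^sub>K Y" and N = "factor_module (X \<otimes>\<^sub>K Y) (balance_rels K A X Y)"])
      (simp_all add: tensor_over_sel)
  then show ?thesis by (simp add: proj_def lin_restrict T)
qed

lemma proj_surj: "proj K A X Y ` carrier (X \<otimes>\<^sub>K Y) = carrier (X \<otimes>\<^sub>A Y)"
  by (simp add: proj_def tensor_over_sel factor_carrier [OF F])

lemma lact_proj:
  "\<lbrakk>a \<in> carrier A; t \<in> carrier (X \<otimes>\<^sub>K Y)\<rbrakk> \<Longrightarrow> lact (X \<otimes>\<^sub>A Y) a (proj K A X Y t) = proj K A X Y (lact (X \<otimes>\<^sub>K Y) a t)"
  by (simp add: proj_def tensor_over_sel coset_map_coset [OF F wbD(2) [OF T(1)]] balance_rels_lact wbD(4) [OF T(1)])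

lemma ract_proj:
  "\<lbrakk>a \<in> carrier A; t \<in> carrier (X \<otimes>\<^sub>K Y)\<rbrakk> \<Longrightarrow> ract (X \<otimes>\<^sub>A Y) (proj K A X Y t) a = proj K A X Y (ract (X \<otimes>\<^sub>K Y) t a)"
  by (simp add: proj_def tensor_over_sel coset_map_coset [OF F wbD(3) [OF T(1)]] balance_rels_ract wbD(5) [OF T(1)])

lemma wb_tensor_over: "wb (X \<otimes>\<^sub>A Y)"
proof (rule weak_bimodule.intro)
  show "module K (X \<otimes>\<^sub>A Y)" by (rule tensor_over_module)
  fix a assume a: "a \<in> carrier A"
  have car: "\<And>s. s \<in> carrier (X \<otimes>\<^sub>A Y) \<Longrightarrow> \<exists>t\<in>carrier (X \<otimes>\<^sub>K Y). s = proj K A X Y t"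
    using proj_surj by blast
  note proj_simps = lin_closed [OF proj_lin] lin_add [OF proj_lin, symmetric] lin_smult [OF proj_lin, symmetric]
    lact_proj ract_proj a
  show "lin K (X \<otimes>\<^sub>A Y) (X \<otimes>\<^sub>A Y) (lact (X \<otimes>\<^sub>A Y) a)"
    by (rule linI) (auto dest!: car simp: proj_simps wbD(4) [OF T(1)]
      lin_add [OF wbD(2) [OF T(1)]] lin_smult [OF wbD(2) [OF T(1)]])
  show "lin K (X \<otimes>\<^sub>A Y) (X \<otimes>\<^sub>A Y) (\<lambda>t. ract (X \<otimes>\<^sub>A Y) t a)"
    by (rule linI) (auto dest!: car simp: proj_simps wbD(5) [OF T(1)]
      lin_add [OF wbD(3) [OF T(1)]] lin_smult [OF wbD(3) [OF T(1)]])
  fix b s assume "b \<in> carrier A" "s \<in> carrier (X \<otimes>\<^sub>A Y)"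
  then show "ract (X \<otimes>\<^sub>A Y) (lact (X \<otimes>\<^sub>A Y) a s) b = lact (X \<otimes>\<^sub>A Y) a (ract (X \<otimes>\<^sub>A Y) s b)"
    using a by (auto dest!: car simp: lact_proj ract_proj wbD(4,5,6) [OF T(1)])
qed

lemma cl_bilin: "bilin K X Y (X \<otimes>\<^sub>A Y) (cl X Y)"
  unfolding tensor_class_def by (rule bilin_post [OF pt_bilin [OF XY] proj_lin])

lemma cl_closed: "\<lbrakk>x \<in> carrier X; y \<in> carrier Y\<rbrakk> \<Longrightarrow> cl X Y x y \<in> carrier (X \<otimes>\<^sub>A Y)"
  by (rule bilin_closed [OF cl_bilin])

lemma cl_balanced:
  "\<lbrakk>x \<in> carrier X; a \<in> carrier A; y \<in> carrier Y\<rbrakk> \<Longrightarrow> cl X Y (ract X x a) y = cl X Y x (lact Y a y)"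
  by (simp add: tensor_class_def proj_def pt_closed XY wbD(5) [OF X] wbD(4) [OF Y] coset_eq_iff [OF F]
    balance_rels_mem)

lemma lact_cl:
  "\<lbrakk>a \<in> carrier A; x \<in> carrier X; y \<in> carrier Y\<rbrakk> \<Longrightarrow> lact (X \<otimes>\<^sub>A Y) a (cl X Y x y) = cl X Y (lact X a x) y"
  by (simp add: tensor_class_def lact_proj pt_closed XY lact_pt)

lemma ract_cl:
  "\<lbrakk>a \<in> carrier A; x \<in> carrier X; y \<in> carrier Y\<rbrakk> \<Longrightarrow> ract (X \<otimes>\<^sub>A Y) (cl X Y x y) a = cl X Y x (ract Y y a)"
  by (simp add: tensor_class_def ract_proj pt_closed XY ract_pt)

lemma tensor_over_ext:
  assumes W: "module K W" and f: "lin K (X \<otimes>\<^sub>A Y) W f" and g: "lin K (X \<otimes>\<^sub>A Y) W g"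
    and eq: "\<And>x y. \<lbrakk>x \<in> carrier X; y \<in> carrier Y\<rbrakk> \<Longrightarrow> f (cl X Y x y) = g (cl X Y x y)"
    and s: "s \<in> carrier (X \<otimes>\<^sub>A Y)"
  shows "f s = g s"
proof -
  obtain t where t: "t \<in> carrier (X \<otimes>\<^sub>K Y)" "s = proj K A X Y t"
    using s proj_surj by blast
  have "f (proj K A X Y t) = g (proj K A X Y t)"
    by (rule tensor_field_ext [OF XY W lin_comp [OF proj_lin f] lin_comp [OF proj_lin g] _ t(1)])
      (simp add: eq tensor_class_def [symmetric])
  then show ?thesis using t by simp
qed

text \<open>The bilinear map extends to \<open>X \<otimes>\<^sub>K Y\<close>. Its zero set is a
  submodule, and balancedness puts the generators of the relations into it, so the extension
  factors.\<close>

lemma tensor_over_lift: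
  assumes W: "module K W" and b: "bilin K X Y W b"
    and bal: "\<And>x a y. \<lbrakk>x \<in> carrier X; a \<in> carrier A; y \<in> carrier Y\<rbrakk> \<Longrightarrow> b (ract X x a) y = b x (lact Y a y)"
  shows "\<exists>h. h \<in> linear_maps K (X \<otimes>\<^sub>A Y) W \<and> lin K (X \<otimes>\<^sub>A Y) W h \<and>
    (\<forall>x\<in>carrier X. \<forall>y\<in>carrier Y. h (cl X Y x y) = b x y)"
proof -
  interpret W: module K W by (rule W)
  obtain f where f: "lin K (X \<otimes>\<^sub>K Y) W f"
    and fb: "\<forall>x\<in>carrier X. \<forall>y\<in>carrier Y. f (pt X Y x y) = b x y"
    using tensor_field_lift [OF XY W b] by blast
  have "balance_rels K A X Y \<subseteq> {t \<in> carrier (X \<otimes>\<^sub>K Y). f t = \<zero>\<^bsub>W\<^esub>}"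
    by (rule balance_rels_least [OF lin_equalizer [OF T(2) W f lin_const_zero [OF T(2) W]]])
      (simp add: pt_closed XY wbD(5) [OF X] wbD(4) [OF Y] lin_minus [OF T(2) W f] fb bal
        W.minus_eq_zero_iff bilin_closed [OF b])
  then have "\<And>t. t \<in> balance_rels K A X Y \<Longrightarrow> f t = \<zero>\<^bsub>W\<^esub>" by blast
  from factor_lift [OF F W f this] obtain h
    where h: "h \<in> linear_maps K (factor_module (X \<otimes>\<^sub>K Y) (balance_rels K A X Y)) W"
      and hf: "\<And>t. t \<in> carrier (X \<otimes>\<^sub>K Y) \<Longrightarrow> h (balance_rels K A X Y +>\<^bsub>X \<otimes>\<^sub>K Y\<^esub> t) = f t"
    by blast
  have "lin K (X \<otimes>\<^sub>A Y) W h"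
    using h by (subst lin_cong_structure [where M = "factor_module (X \<otimes>\<^sub>K Y) (balance_rels K A X Y)" and N = W])
      (simp_all add: tensor_over_sel linear_maps_iff)
  moreover have "h \<in> extensional (carrier (X \<otimes>\<^sub>A Y))"
    using h by (simp add: tensor_over_sel linear_maps_iff)
  ultimately show ?thesis
    by (intro exI [of _ h]) (simp_all add: linear_maps_iff tensor_class_def proj_def pt_closed XY hf fb)
qed

text \<open>Compatibility with an action is an equality between two linear maps, acting before and
  acting after; the classes of pure tensors therefore decide it.\<close>

lemma tensor_over_homI:
  assumes W: "wb W" and h: "lin K (X \<otimes>\<^sub>A Y) W h"
    and l: "\<And>a x y. \<lbrakk>a \<in> carrier A; x \<in> carrier X; y \<in> carrier Y\<rbrakk> \<Longrightarrow>
      h (cl X Y (lact X a x) y) = lact W a (h (cl X Y x y))"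
    and r: "\<And>a x y. \<lbrakk>a \<in> carrier A; x \<in> carrier X; y \<in> carrier Y\<rbrakk> \<Longrightarrow>
      h (cl X Y x (ract Y y a)) = ract W (h (cl X Y x y)) a"
  shows "bh (X \<otimes>\<^sub>A Y) W h"
proof (rule bhomI [OF h])
  note O = wb_tensor_over
  fix a s assume a: "a \<in> carrier A" and s: "s \<in> carrier (X \<otimes>\<^sub>A Y)"
  show "h (lact (X \<otimes>\<^sub>A Y) a s) = lact W a (h s)"
    by (rule tensor_over_ext [OF wbD(1) [OF W] lin_comp [OF wbD(2) [OF O a] h] lin_comp [OF h wbD(2) [OF W a]] _ s])
      (simp add: a lact_cl l)
  show "h (ract (X \<otimes>\<^sub>A Y) s a) = ract W (h s) a"
    by (rule tensor_over_ext [OF wbD(1) [OF W] lin_comp [OF wbD(3) [OF O a] h] lin_comp [OF h wbD(3) [OF W a]] _ s])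
      (simp add: a ract_cl r)
qed

lemma tensor_field_homI:
  assumes W: "wb W" and h: "lin K (X \<otimes>\<^sub>K Y) W h"
    and l: "\<And>a x y. \<lbrakk>a \<in> carrier A; x \<in> carrier X; y \<in> carrier Y\<rbrakk> \<Longrightarrow>
      h (pt X Y (lact X a x) y) = lact W a (h (pt X Y x y))"
    and r: "\<And>a x y. \<lbrakk>a \<in> carrier A; x \<in> carrier X; y \<in> carrier Y\<rbrakk> \<Longrightarrow>
      h (pt X Y x (ract Y y a)) = ract W (h (pt X Y x y)) a"
  shows "bh (X \<otimes>\<^sub>K Y) W h"
proof (rule bhomI [OF h])
  fix a s assume a: "a \<in> carrier A" and s: "s \<in> carrier (X \<otimes>\<^sub>K Y)"
  show "h (lact (X \<otimes>\<^sub>K Y) a s) = lact W a (h s)"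
    by (rule tensor_field_ext [OF XY wbD(1) [OF W] lin_comp [OF wbD(2) [OF T(1) a] h] lin_comp [OF h wbD(2) [OF W a]] _ s])
      (simp add: a lact_pt l)
  show "h (ract (X \<otimes>\<^sub>K Y) s a) = ract W (h s) a"
    by (rule tensor_field_ext [OF XY wbD(1) [OF W] lin_comp [OF wbD(3) [OF T(1) a] h] lin_comp [OF h wbD(3) [OF W a]] _ s])
      (simp add: a ract_pt r)
qed

text \<open>This operator and the next are the inner actions, on the factors adjacent to the tensor
  sign. The subspace \<open>X \<otimes>\<^sup>A Y\<close> is their equalizer for all elements of
  \<open>A\<close> simultaneously.\<close>

lemma inner_ract_lin:
  "a \<in> carrier A \<Longrightarrow> lin K (X \<otimes>\<^sub>K Y) (X \<otimes>\<^sub>K Y) (tensor_map K X Y X Y (\<lambda>x. ract X x a) (idm Y))"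
  by (intro tensor_map_lin XY wbD(3) [OF X] lin_idm)

lemma inner_lact_lin:
  "a \<in> carrier A \<Longrightarrow> lin K (X \<otimes>\<^sub>K Y) (X \<otimes>\<^sub>K Y) (tensor_map K X Y X Y (idm X) (lact Y a))"
  by (intro tensor_map_lin XY wbD(2) [OF Y] lin_idm)

lemma inner_ract_pt:
  "\<lbrakk>a \<in> carrier A; x \<in> carrier X; y \<in> carrier Y\<rbrakk> \<Longrightarrow>
    tensor_map K X Y X Y (\<lambda>x. ract X x a) (idm Y) (pt X Y x y) = pt X Y (ract X x a) y"
  by (simp add: tensor_map_pure XY wbD(3) [OF X] lin_idm)

lemma inner_lact_pt:
  "\<lbrakk>a \<in> carrier A; x \<in> carrier X; y \<in> carrier Y\<rbrakk> \<Longrightarrow>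
    tensor_map K X Y X Y (idm X) (lact Y a) (pt X Y x y) = pt X Y x (lact Y a y)"
  by (simp add: tensor_map_pure XY wbD(2) [OF Y] lin_idm)

lemma cotensor_submodule: "submodule (carrier (X \<otimes>\<^sup>A Y)) K (X \<otimes>\<^sub>K Y)"
proof (rule T.submoduleI)
  note r = inner_ract_lin and l = inner_lact_lin
  show "\<zero>\<^bsub>X \<otimes>\<^sub>K Y\<^esub> \<in> carrier (X \<otimes>\<^sup>A Y)"
    by (simp add: cotensor_iff lin_zero [OF T(2) T(2) r] lin_zero [OF T(2) T(2) l])
  show "\<ominus>\<^bsub>X \<otimes>\<^sub>K Y\<^esub> s \<in> carrier (X \<otimes>\<^sup>A Y)" if "s \<in> carrier (X \<otimes>\<^sup>A Y)" for s
    using that by (simp add: cotensor_iff lin_neg [OF T(2) T(2) r] lin_neg [OF T(2) T(2) l])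
  show "s \<oplus>\<^bsub>X \<otimes>\<^sub>K Y\<^esub> t \<in> carrier (X \<otimes>\<^sup>A Y)" if "s \<in> carrier (X \<otimes>\<^sup>A Y)" "t \<in> carrier (X \<otimes>\<^sup>A Y)" for s t
    using that by (simp add: cotensor_iff lin_add [OF r] lin_add [OF l])
  show "c \<odot>\<^bsub>X \<otimes>\<^sub>K Y\<^esub> s \<in> carrier (X \<otimes>\<^sup>A Y)" if "c \<in> carrier K" "s \<in> carrier (X \<otimes>\<^sup>A Y)" for c s
    using that by (simp add: cotensor_iff lin_smult [OF r] lin_smult [OF l])
qed (auto simp: cotensor_iff)

end

text \<open>A commuting square of extensional maps unfolds to an equality of restrictions. The
  equivalence translates such a square into values on pure tensors, and both directions serve: one
  verifies a candidate, the other gives its uniqueness.\<close>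

lemma tensor_field_restrict_eq_iff:
  assumes "module K X" "module K Y" "module K W" "lin K (X \<otimes>\<^sub>K Y) W f" "lin K (X \<otimes>\<^sub>K Y) W g"
  shows "restrict f (carrier (X \<otimes>\<^sub>K Y)) = restrict g (carrier (X \<otimes>\<^sub>K Y)) \<longleftrightarrow>
    (\<forall>x\<in>carrier X. \<forall>y\<in>carrier Y. f (pt X Y x y) = g (pt X Y x y))"
proof
  assume eq: "restrict f (carrier (X \<otimes>\<^sub>K Y)) = restrict g (carrier (X \<otimes>\<^sub>K Y))"
  have "f t = g t" if "t \<in> carrier (X \<otimes>\<^sub>K Y)" for t
    using fun_cong [OF eq, of t] that by simp
  then show "\<forall>x\<in>carrier X. \<forall>y\<in>carrier Y. f (pt X Y x y) = g (pt X Y x y)"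
    using pt_closed [OF assms(1,2)] by simp
next
  assume eq: "\<forall>x\<in>carrier X. \<forall>y\<in>carrier Y. f (pt X Y x y) = g (pt X Y x y)"
  show "restrict f (carrier (X \<otimes>\<^sub>K Y)) = restrict g (carrier (X \<otimes>\<^sub>K Y))"
    by (rule restrict_ext, rule tensor_field_ext [OF assms]) (use eq in simp_all)
qed

lemma tensor_over_restrict_eq_iff:
  assumes "wb X" "wb Y" "module K W" "lin K (X \<otimes>\<^sub>A Y) W f" "lin K (X \<otimes>\<^sub>A Y) W g"
  shows "restrict f (carrier (X \<otimes>\<^sub>A Y)) = restrict g (carrier (X \<otimes>\<^sub>A Y)) \<longleftrightarrow>
    (\<forall>x\<in>carrier X. \<forall>y\<in>carrier Y. f (cl X Y x y) = g (cl X Y x y))"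
proof
  assume eq: "restrict f (carrier (X \<otimes>\<^sub>A Y)) = restrict g (carrier (X \<otimes>\<^sub>A Y))"
  have "f t = g t" if "t \<in> carrier (X \<otimes>\<^sub>A Y)" for t
    using fun_cong [OF eq, of t] that by simp
  then show "\<forall>x\<in>carrier X. \<forall>y\<in>carrier Y. f (cl X Y x y) = g (cl X Y x y)"
    using cl_closed [OF assms(1,2)] by simp
next
  assume eq: "\<forall>x\<in>carrier X. \<forall>y\<in>carrier Y. f (cl X Y x y) = g (cl X Y x y)"
  show "restrict f (carrier (X \<otimes>\<^sub>A Y)) = restrict g (carrier (X \<otimes>\<^sub>A Y))"
    by (rule restrict_ext, rule tensor_over_ext [OF assms]) (use eq in simp_all)
qed

lemma tensor_field_eqI:
  assumes "module K X" "module K Y" "module K W"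
    and "h \<in> linear_maps K (X \<otimes>\<^sub>K Y) W" "h' \<in> linear_maps K (X \<otimes>\<^sub>K Y) W"
    and "\<And>x y. \<lbrakk>x \<in> carrier X; y \<in> carrier Y\<rbrakk> \<Longrightarrow> h (pt X Y x y) = h' (pt X Y x y)"
  shows "h = h'"
  using tensor_maps_eqI [OF assms(1-3)] assms(4-6) unfolding linear_maps_tensor_field by blast

lemma linear_maps_ext:
  assumes "f \<in> linear_maps K M N" "g \<in> linear_maps K M N" "\<And>x. x \<in> carrier M \<Longrightarrow> f x = g x"
  shows "f = g"
  using assms by (intro extensionalityI [of f "carrier M"]) (auto simp: linear_maps_iff)

text \<open>Resolves definite descriptions in one stroke. \<open>Q\<close> stands for the defining
  condition, and for linear maps it must amount to prescribed bilinear values \<open>v\<close>;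
  existence and uniqueness then come from the universal property.\<close>

lemma the_tensor_field_map:
  assumes "module K X" "module K Y" "module K W" and v: "bilin K X Y W v"
    and Q: "\<And>h. \<lbrakk>h \<in> linear_maps K (X \<otimes>\<^sub>K Y) W; lin K (X \<otimes>\<^sub>K Y) W h\<rbrakk> \<Longrightarrow>
      Q h \<longleftrightarrow> (\<forall>x\<in>carrier X. \<forall>y\<in>carrier Y. h (pt X Y x y) = v x y)"
  shows "(THE h. h \<in> linear_maps K (X \<otimes>\<^sub>K Y) W \<and> Q h) \<in> linear_maps K (X \<otimes>\<^sub>K Y) W" (is ?A)
    and "\<forall>x\<in>carrier X. \<forall>y\<in>carrier Y. (THE h. h \<in> linear_maps K (X \<otimes>\<^sub>K Y) W \<and> Q h) (pt X Y x y) = v x y"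
proof -
  obtain h0 where h0: "h0 \<in> linear_maps K (X \<otimes>\<^sub>K Y) W" "lin K (X \<otimes>\<^sub>K Y) W h0"
    "\<forall>x\<in>carrier X. \<forall>y\<in>carrier Y. h0 (pt X Y x y) = v x y"
    using tensor_field_lift [OF assms(1-4)] by blast
  have "(THE h. h \<in> linear_maps K (X \<otimes>\<^sub>K Y) W \<and> Q h) = h0"
  proof (rule the_equality)
    show "h = h0" if "h \<in> linear_maps K (X \<otimes>\<^sub>K Y) W \<and> Q h" for h
      by (rule tensor_field_eqI [OF assms(1-3) _ h0(1)]) (use that h0(3) Q [of h] in \<open>simp_all add: linear_maps_iff\<close>)
  qed (use h0 Q in blast)
  with h0 show ?A
    "\<forall>x\<in>carrier X. \<forall>y\<in>carrier Y. (THE h. h \<in> linear_maps K (X \<otimes>\<^sub>K Y) W \<and> Q h) (pt X Y x y) = v x y"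
    by simp_all
qed

lemma bimod_hom_linear_maps: "h \<in> bimod_hom K A M N \<Longrightarrow> h \<in> linear_maps K M N"
  by (simp add: bimod_hom_def)

lemma bimod_hom_lin: "h \<in> bimod_hom K A M N \<Longrightarrow> lin K M N h"
  by (simp add: bimod_hom_iff bhom_def)

lemma bimod_hom_bh: "h \<in> bimod_hom K A M N \<Longrightarrow> bh M N h"
  by (simp add: bimod_hom_iff)

lemma bimod_hom_intro: "\<lbrakk>h \<in> linear_maps K M N; bh M N h\<rbrakk> \<Longrightarrow> h \<in> bimod_hom K A M N"
  by (simp add: bimod_hom_iff linear_maps_iff)

text \<open>Here the description ranges over bimodule maps, so the lift has to be shown to be one.
  That is the purpose of \<open>l\<close> and \<open>r\<close>, which state the compatibility for
  the prescribed values.\<close>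

lemma the_tensor_field_hom:
  assumes X: "wb X" and Y: "wb Y" and W: "wb W" and v: "bilin K X Y W v"
    and l: "\<And>a x y. \<lbrakk>a \<in> carrier A; x \<in> carrier X; y \<in> carrier Y\<rbrakk> \<Longrightarrow> v (lact X a x) y = lact W a (v x y)"
    and r: "\<And>a x y. \<lbrakk>a \<in> carrier A; x \<in> carrier X; y \<in> carrier Y\<rbrakk> \<Longrightarrow> v x (ract Y y a) = ract W (v x y) a"
    and Q: "\<And>h. \<lbrakk>h \<in> bimod_hom K A (X \<otimes>\<^sub>K Y) W; lin K (X \<otimes>\<^sub>K Y) W h\<rbrakk> \<Longrightarrow>
      Q h \<longleftrightarrow> (\<forall>x\<in>carrier X. \<forall>y\<in>carrier Y. h (pt X Y x y) = v x y)"
  shows "(THE h. h \<in> bimod_hom K A (X \<otimes>\<^sub>K Y) W \<and> Q h) \<in> bimod_hom K A (X \<otimes>\<^sub>K Y) W" (is ?A)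
    and "\<forall>x\<in>carrier X. \<forall>y\<in>carrier Y. (THE h. h \<in> bimod_hom K A (X \<otimes>\<^sub>K Y) W \<and> Q h) (pt X Y x y) = v x y"
proof -
  note M = wbD(1) [OF X] wbD(1) [OF Y] wbD(1) [OF W]
  obtain h0 where h0: "h0 \<in> linear_maps K (X \<otimes>\<^sub>K Y) W" "lin K (X \<otimes>\<^sub>K Y) W h0"
    "\<forall>x\<in>carrier X. \<forall>y\<in>carrier Y. h0 (pt X Y x y) = v x y"
    using tensor_field_lift [OF M v] by blast
  have h0b: "h0 \<in> bimod_hom K A (X \<otimes>\<^sub>K Y) W"
    by (rule bimod_hom_intro [OF h0(1) tensor_field_homI [OF X Y W h0(2)]])
      (simp_all add: h0(3) l r wbD(4) [OF X] wbD(5) [OF Y])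
  have "(THE h. h \<in> bimod_hom K A (X \<otimes>\<^sub>K Y) W \<and> Q h) = h0"
  proof (rule the_equality)
    show "h = h0" if "h \<in> bimod_hom K A (X \<otimes>\<^sub>K Y) W \<and> Q h" for h
      by (rule tensor_field_eqI [OF M bimod_hom_linear_maps h0(1)])
        (use that h0(3) Q [of h] bimod_hom_lin [of h] in \<open>simp_all\<close>)
  qed (use h0 h0b Q in blast)
  with h0 h0b show ?A
    "\<forall>x\<in>carrier X. \<forall>y\<in>carrier Y. (THE h. h \<in> bimod_hom K A (X \<otimes>\<^sub>K Y) W \<and> Q h) (pt X Y x y) = v x y"
    by simp_all
qed

lemma tensor_over_hom_eqI:
  assumes X: "wb X" and Y: "wb Y" and W: "wb W"
    and h: "h \<in> bimod_hom K A (X \<otimes>\<^sub>A Y) W" and h': "h' \<in> bimod_hom K A (X \<otimes>\<^sub>A Y) W"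
    and eq: "\<And>x y. \<lbrakk>x \<in> carrier X; y \<in> carrier Y\<rbrakk> \<Longrightarrow> h (cl X Y x y) = h' (cl X Y x y)"
  shows "h = h'"
proof (rule linear_maps_ext [OF bimod_hom_linear_maps [OF h] bimod_hom_linear_maps [OF h']])
  show "h s = h' s" if "s \<in> carrier (X \<otimes>\<^sub>A Y)" for s
    by (rule tensor_over_ext [OF X Y wbD(1) [OF W] bimod_hom_lin [OF h] bimod_hom_lin [OF h'] eq that])
qed

text \<open>The version over \<open>A\<close>: \<open>bal\<close> lets the prescribed values descend
  to the quotient. It evaluates the evaluations, the induced maps over \<open>A\<close> and the four
  comparison maps.\<close>

lemma the_tensor_over_hom:
  assumes X: "wb X" and Y: "wb Y" and W: "wb W" and v: "bilin K X Y W v"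
    and bal: "\<And>x a y. \<lbrakk>x \<in> carrier X; a \<in> carrier A; y \<in> carrier Y\<rbrakk> \<Longrightarrow> v (ract X x a) y = v x (lact Y a y)"
    and l: "\<And>a x y. \<lbrakk>a \<in> carrier A; x \<in> carrier X; y \<in> carrier Y\<rbrakk> \<Longrightarrow> v (lact X a x) y = lact W a (v x y)"
    and r: "\<And>a x y. \<lbrakk>a \<in> carrier A; x \<in> carrier X; y \<in> carrier Y\<rbrakk> \<Longrightarrow> v x (ract Y y a) = ract W (v x y) a"
    and Q: "\<And>h. \<lbrakk>h \<in> bimod_hom K A (X \<otimes>\<^sub>A Y) W; lin K (X \<otimes>\<^sub>A Y) W h\<rbrakk> \<Longrightarrow>
      Q h \<longleftrightarrow> (\<forall>x\<in>carrier X. \<forall>y\<in>carrier Y. h (cl X Y x y) = v x y)"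
  shows "(THE h. h \<in> bimod_hom K A (X \<otimes>\<^sub>A Y) W \<and> Q h) \<in> bimod_hom K A (X \<otimes>\<^sub>A Y) W" (is ?A)
    and "\<forall>x\<in>carrier X. \<forall>y\<in>carrier Y. (THE h. h \<in> bimod_hom K A (X \<otimes>\<^sub>A Y) W \<and> Q h) (cl X Y x y) = v x y"
proof -
  obtain h0 where h0: "h0 \<in> linear_maps K (X \<otimes>\<^sub>A Y) W" "lin K (X \<otimes>\<^sub>A Y) W h0"
    "\<forall>x\<in>carrier X. \<forall>y\<in>carrier Y. h0 (cl X Y x y) = v x y"
    using tensor_over_lift [OF X Y wbD(1) [OF W] v bal] by blast
  have h0b: "h0 \<in> bimod_hom K A (X \<otimes>\<^sub>A Y) W"
    by (rule bimod_hom_intro [OF h0(1) tensor_over_homI [OF X Y W h0(2)]])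
      (simp_all add: h0(3) l r wbD(4) [OF X] wbD(5) [OF Y])
  have "(THE h. h \<in> bimod_hom K A (X \<otimes>\<^sub>A Y) W \<and> Q h) = h0"
  proof (rule the_equality)
    fix h assume h: "h \<in> bimod_hom K A (X \<otimes>\<^sub>A Y) W \<and> Q h"
    note hl = bimod_hom_lin [OF conjunct1 [OF h]]
    show "h = h0"
      by (rule tensor_over_hom_eqI [OF X Y W conjunct1 [OF h] h0b]) (use Q [of h] h hl h0(3) in simp)
  qed (use h0 h0b Q in blast)
  with h0 h0b show ?A
    "\<forall>x\<in>carrier X. \<forall>y\<in>carrier Y. (THE h. h \<in> bimod_hom K A (X \<otimes>\<^sub>A Y) W \<and> Q h) (cl X Y x y) = v x y"
    by simp_all
qed

text \<open>Compatibility of \<open>f\<close> with the right action and of \<open>g\<close> with the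
  left one makes the values balanced. The two remaining compatibilities make the induced map respect
  the outer actions.\<close>

lemma tensor_over_map:
  assumes X: "wb X" and Y: "wb Y" and X': "wb X'" and Y': "wb Y'" and f: "bh X X' f" and g: "bh Y Y' g"
  shows "tensor_over_map K A X Y X' Y' f g \<in> bimod_hom K A (X \<otimes>\<^sub>A Y) (X' \<otimes>\<^sub>A Y')" (is ?A)
    and "\<lbrakk>x \<in> carrier X; y \<in> carrier Y\<rbrakk> \<Longrightarrow> tensor_over_map K A X Y X' Y' f g (cl X Y x y) = cl X' Y' (f x) (g y)"
    (is "_ \<Longrightarrow> _ \<Longrightarrow> ?B")
proof -
  note M = wbD(1) [OF X] wbD(1) [OF Y] wbD(1) [OF X'] wbD(1) [OF Y']
  note O' = wb_tensor_over [OF X' Y'] and lin = bhomD(1) [OF f] bhomD(1) [OF g]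
  note fc = lin_closed [OF lin(1)] and gc = lin_closed [OF lin(2)]
  have Q: "comp_on (X \<otimes>\<^sub>K Y) h (proj K A X Y) = comp_on (X \<otimes>\<^sub>K Y) (proj K A X' Y') (tensor_map K X Y X' Y' f g)
    \<longleftrightarrow> (\<forall>x\<in>carrier X. \<forall>y\<in>carrier Y. h (cl X Y x y) = cl X' Y' (f x) (g y))"
    if "lin K (X \<otimes>\<^sub>A Y) (X' \<otimes>\<^sub>A Y') h" for h
    unfolding compose_def
    by (subst tensor_field_restrict_eq_iff [OF M(1,2) wbD(1) [OF O'] lin_comp [OF proj_lin [OF X Y] that]
        lin_comp [OF tensor_map_lin [OF M lin] proj_lin [OF X' Y']]])
      (simp add: tensor_map_pure [OF M lin] tensor_class_def)
  note the = the_tensor_over_hom [OF X Y O' bilin_comp [OF cl_bilin [OF X' Y'] lin] _ _ _ Q,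
      folded tensor_over_map_def]
  show ?A
    by (rule the(1)) (simp_all add: bhomD [OF f] bhomD [OF g] fc gc lact_cl [OF X' Y'] ract_cl [OF X' Y'] cl_balanced [OF X' Y'])
  show ?B
    if "x \<in> carrier X" "y \<in> carrier Y"
    by (rule the(2) [rule_format, OF _ _ _ _ that])
      (simp_all add: bhomD [OF f] bhomD [OF g] fc gc lact_cl [OF X' Y'] ract_cl [OF X' Y'] cl_balanced [OF X' Y'])
qed

section \<open>Functoriality and the subspace on which the inner actions agree\<close>

lemma tensor_map_comp:
  fixes X :: "('a, 'k, 'x) bimodule" and Y :: "('a, 'k, 'y) bimodule"
    and X' :: "('a, 'k, 'x2) bimodule" and Y' :: "('a, 'k, 'y2) bimodule"
    and X'' :: "('a, 'k, 'x3) bimodule" and Y'' :: "('a, 'k, 'y3) bimodule"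
  assumes M: "module K X" "module K Y" "module K X'" "module K Y'" "module K X''" "module K Y''"
    and f: "lin K X X' f" and g: "lin K Y Y' g" and f': "lin K X' X'' f'" and g': "lin K Y' Y'' g'"
    and t: "t \<in> carrier (X \<otimes>\<^sub>K Y)"
  shows "tensor_map K X' Y' X'' Y'' f' g' (tensor_map K X Y X' Y' f g t) =
    tensor_map K X Y X'' Y'' (\<lambda>x. f' (f x)) (\<lambda>y. g' (g y)) t"
proof (rule tensor_field_ext [OF M(1,2) tensor_field_module [OF M(5,6)] _ _ _ t])
  show "lin K (X \<otimes>\<^sub>K Y) (X'' \<otimes>\<^sub>K Y'') (\<lambda>t. tensor_map K X' Y' X'' Y'' f' g' (tensor_map K X Y X' Y' f g t))"
    by (rule lin_comp [OF tensor_map_lin [OF M(1-4) f g] tensor_map_lin [OF M(3-6) f' g']])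
  show "lin K (X \<otimes>\<^sub>K Y) (X'' \<otimes>\<^sub>K Y'') (tensor_map K X Y X'' Y'' (\<lambda>x. f' (f x)) (\<lambda>y. g' (g y)))"
    by (rule tensor_map_lin [OF M(1,2,5,6) lin_comp [OF f f'] lin_comp [OF g g']])
qed (simp add: tensor_map_pure [OF M(1-4) f g] tensor_map_pure [OF M(3-6) f' g'] lin_closed [OF f] lin_closed [OF g]
    tensor_map_pure [OF M(1,2,5,6) lin_comp [OF f f'] lin_comp [OF g g']])

lemma tensor_map_cong:
  assumes "\<And>x. x \<in> carrier X \<Longrightarrow> f x = f' x" "\<And>y. y \<in> carrier Y \<Longrightarrow> g y = g' y"
  shows "tensor_map K X Y X' Y' f g = tensor_map K X Y X' Y' f' g'"
  unfolding tensor_map_def by (simp add: assms)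

text \<open>The inner actions are themselves tensor maps, so functoriality moves them past
  \<open>f\<close> and \<open>g\<close>. Only the inner compatibilities are assumed, because the
  lemma is applied to maps like \<open>y \<mapsto> [x \<otimes> y]\<close>, for which compatibility
  with the right action is available but not with the left.\<close>

lemma tensor_map_cotensor:
  assumes X: "wb X" and Y: "wb Y" and X': "wb X'" and Y': "wb Y'" and f: "lin K X X' f" and g: "lin K Y Y' g"
    and fr: "\<And>a x. \<lbrakk>a \<in> carrier A; x \<in> carrier X\<rbrakk> \<Longrightarrow> f (ract X x a) = ract X' (f x) a"
    and gl: "\<And>a y. \<lbrakk>a \<in> carrier A; y \<in> carrier Y\<rbrakk> \<Longrightarrow> g (lact Y a y) = lact Y' a (g y)"
    and t: "t \<in> carrier (X \<otimes>\<^sup>A Y)"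
  shows "tensor_map K X Y X' Y' f g t \<in> carrier (X' \<otimes>\<^sup>A Y')"
proof -
  note M = wbD(1) [OF X] wbD(1) [OF Y] and M' = wbD(1) [OF X'] wbD(1) [OF Y']
  have tK: "t \<in> carrier (X \<otimes>\<^sub>K Y)" using t by (rule cotensor_subset)
  have "tensor_map K X' Y' X' Y' (\<lambda>x. ract X' x a) (idm Y') (tensor_map K X Y X' Y' f g t) =
    tensor_map K X' Y' X' Y' (idm X') (lact Y' a) (tensor_map K X Y X' Y' f g t)" if a: "a \<in> carrier A" for a
  proof -
    have "tensor_map K X' Y' X' Y' (\<lambda>x. ract X' x a) (idm Y') (tensor_map K X Y X' Y' f g t) =
      tensor_map K X Y X' Y' f g (tensor_map K X Y X Y (\<lambda>x. ract X x a) (idm Y) t)"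
      by (simp add: tensor_map_comp [OF M M' M'] tensor_map_comp [OF M M M'] f g lin_idm M M' wbD(3) [OF X a]
        wbD(3) [OF X' a] tK; rule fun_cong [OF tensor_map_cong]; simp add: fr a lin_closed [OF g])
    also have "\<dots> = tensor_map K X Y X' Y' f g (tensor_map K X Y X Y (idm X) (lact Y a) t)"
      using t a by (simp add: cotensor_iff)
    also have "\<dots> = tensor_map K X' Y' X' Y' (idm X') (lact Y' a) (tensor_map K X Y X' Y' f g t)"
      by (simp add: tensor_map_comp [OF M M' M'] tensor_map_comp [OF M M M'] f g lin_idm M M' wbD(2) [OF Y a]
        wbD(2) [OF Y' a] tK; rule fun_cong [OF tensor_map_cong]; simp add: gl a lin_closed [OF f])
    finally show ?thesis .
  qed
  then show ?thesis
    by (simp add: cotensor_iff lin_closed [OF tensor_map_lin [OF M M' f g] tK])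
qed

context
  fixes X :: "('a, 'k, 'x) bimodule" and Y :: "('a, 'k, 'y) bimodule"
  assumes X: "wb X" and Y: "wb Y"
begin

lemma cotensor_module: "module K (X \<otimes>\<^sup>A Y)"
proof -
  have "(X \<otimes>\<^sub>K Y)\<lparr>carrier := carrier (X \<otimes>\<^sup>A Y)\<rparr> = X \<otimes>\<^sup>A Y"
    by (simp add: cotensor_def)
  then show ?thesis
    using submodule.submodule_is_module [OF cotensor_submodule [OF X Y] wbD(1) [OF wb_tensor_field [OF X Y]]]
    by simp
qed

lemma lin_from_cotensor: "lin K (X \<otimes>\<^sub>K Y) W f \<Longrightarrow> lin K (X \<otimes>\<^sup>A Y) W f"
  by (rule linI) (simp_all add: cotensor_sel lin_closed lin_add lin_smult cotensor_subset)

lemma lin_into_cotensor: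
  "\<lbrakk>lin K W (X \<otimes>\<^sub>K Y) f; \<And>w. w \<in> carrier W \<Longrightarrow> f w \<in> carrier (X \<otimes>\<^sup>A Y)\<rbrakk> \<Longrightarrow> lin K W (X \<otimes>\<^sup>A Y) f"
  by (rule linI) (auto simp: cotensor_sel lin_closed lin_add lin_smult)

lemma lin_cotensor_weaken: "lin K W (X \<otimes>\<^sup>A Y) f \<Longrightarrow> lin K W (X \<otimes>\<^sub>K Y) f"
  using lin_closed [of K W "X \<otimes>\<^sup>A Y" f] lin_add [of K W "X \<otimes>\<^sup>A Y" f] lin_smult [of K W "X \<otimes>\<^sup>A Y" f]
  by (intro linI) (auto simp: cotensor_sel intro: cotensor_subset)

text \<open>An outer action is a tensor map with one factor the identity. It preserves the subspace
  because on either bimodule the outer action commutes with the inner one.\<close>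

lemma wb_cotensor: "wb (X \<otimes>\<^sup>A Y)"
proof (rule weak_bimodule.intro)
  note T = wb_tensor_field [OF X Y]
  show "module K (X \<otimes>\<^sup>A Y)" by (rule cotensor_module)
  fix a assume a: "a \<in> carrier A"
  have "lact (X \<otimes>\<^sub>K Y) a t \<in> carrier (X \<otimes>\<^sup>A Y)" if "t \<in> carrier (X \<otimes>\<^sup>A Y)" for t
    unfolding tensor_field_sel
    by (rule tensor_map_cotensor [OF X Y X Y wbD(2) [OF X a] lin_idm [OF wbD(1) [OF Y]] _ _ that])
      (simp_all add: wbD(4) [OF Y] wbD(6) [OF X] a)
  then show "lin K (X \<otimes>\<^sup>A Y) (X \<otimes>\<^sup>A Y) (lact (X \<otimes>\<^sup>A Y) a)"
    unfolding cotensor_sel by (intro lin_into_cotensor lin_from_cotensor wbD(2) [OF T a])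
  have "ract (X \<otimes>\<^sub>K Y) t a \<in> carrier (X \<otimes>\<^sup>A Y)" if "t \<in> carrier (X \<otimes>\<^sup>A Y)" for t
    unfolding tensor_field_sel
    by (rule tensor_map_cotensor [OF X Y X Y lin_idm [OF wbD(1) [OF X]] wbD(3) [OF Y a] _ _ that])
      (simp_all add: wbD(5) [OF X] wbD(6) [OF Y] a)
  then show "lin K (X \<otimes>\<^sup>A Y) (X \<otimes>\<^sup>A Y) (\<lambda>t. ract (X \<otimes>\<^sup>A Y) t a)"
    unfolding cotensor_sel by (intro lin_into_cotensor lin_from_cotensor wbD(3) [OF T a])
  fix b t assume "b \<in> carrier A" "t \<in> carrier (X \<otimes>\<^sup>A Y)"
  then show "ract (X \<otimes>\<^sup>A Y) (lact (X \<otimes>\<^sup>A Y) a t) b = lact (X \<otimes>\<^sup>A Y) a (ract (X \<otimes>\<^sup>A Y) t b)"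
    using a by (simp add: cotensor_sel wbD(6) [OF T] cotensor_subset)
qed

lemma incl_bimod_hom: "incl K A X Y \<in> bimod_hom K A (X \<otimes>\<^sup>A Y) (X \<otimes>\<^sub>K Y)"
proof -
  have "lin K (X \<otimes>\<^sup>A Y) (X \<otimes>\<^sub>K Y) (incl K A X Y)"
    by (simp add: incl_def lin_restrict cotensor_module lin_from_cotensor lin_ident)
  then show ?thesis
    by (simp add: bimod_hom_iff bhom_def cotensor_sel) 
      (simp add: incl_def wbD(4,5) [OF wb_cotensor, unfolded cotensor_sel])
qed

lemma incl_apply: "t \<in> carrier (X \<otimes>\<^sup>A Y) \<Longrightarrow> incl K A X Y t = t"
  by (simp add: incl_def)

end

text \<open>The map \<open>b x \<otimes> id\<close>. With \<open>b\<close> the pure tensor it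
  describes the inverse associator; with \<open>b\<close> the tensor class it is the common value of
  the maps of left type.\<close>

definition tensor_left ::
  "('a, 'k, 'y) bimodule \<Rightarrow> ('a, 'k, 'z) bimodule \<Rightarrow> ('a, 'k, 'w) bimodule
    \<Rightarrow> ('x \<Rightarrow> 'y \<Rightarrow> 'w) \<Rightarrow> 'x \<Rightarrow> ('k, 'y, 'z) tensor \<Rightarrow> ('k, 'w, 'z) tensor" where
  "tensor_left Y Z W b x = tensor_map K Y Z W Z (b x) (idm Z)"

text \<open>The mirror image \<open>id \<otimes> b(-, z)\<close>, describing the associator itself
  and the maps of right type.\<close>

definition tensor_right ::
  "('a, 'k, 'x) bimodule \<Rightarrow> ('a, 'k, 'y) bimodule \<Rightarrow> ('a, 'k, 'w) bimodule
    \<Rightarrow> ('y \<Rightarrow> 'z \<Rightarrow> 'w) \<Rightarrow> ('k, 'x, 'y) tensor \<Rightarrow> 'z \<Rightarrow> ('k, 'x, 'w) tensor" where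
  "tensor_right X Y W b s z = tensor_map K X Y X W (idm X) (\<lambda>y. b y z) s"

context
  fixes X :: "('a, 'k, 'x) bimodule" and Y :: "('a, 'k, 'y) bimodule" and Z :: "('a, 'k, 'z) bimodule"
    and W :: "('a, 'k, 'w) bimodule"
  assumes M: "module K X" "module K Y" "module K Z" "module K W"
begin

lemma tensor_left_pt:
  assumes "bilin K X Y W b" "x \<in> carrier X" "y \<in> carrier Y" "z \<in> carrier Z"
  shows "tensor_left Y Z W b x (pt Y Z y z) = pt W Z (b x y) z"
  using assms by (simp add: tensor_left_def tensor_map_pure M bilinD lin_idm)

lemma tensor_right_pt:
  assumes "bilin K Y Z W b" "x \<in> carrier X" "y \<in> carrier Y" "z \<in> carrier Z"
  shows "tensor_right X Y W b (pt X Y x y) z = pt X W x (b y z)"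
  using assms by (simp add: tensor_right_def tensor_map_pure M bilinD lin_idm)

text \<open>Linearity in \<open>x\<close> is hidden behind the definite description of
  \<open>tensor_map\<close>. For fixed scalars and vectors, however, both sides of each law are
  linear in \<open>t\<close>, so pure tensors suffice.\<close>

lemma tensor_left_bilin:
  assumes b: "bilin K X Y W b"
  shows "bilin K X (Y \<otimes>\<^sub>K Z) (W \<otimes>\<^sub>K Z) (tensor_left Y Z W b)"
proof (rule bilinI)
  interpret X: module K X by (rule M)
  have l: "lin K (Y \<otimes>\<^sub>K Z) (W \<otimes>\<^sub>K Z) (tensor_left Y Z W b x)" if "x \<in> carrier X" for x
    unfolding tensor_left_def by (rule tensor_map_lin [OF M(2,3,4,3) bilinD(1) [OF b that] lin_idm [OF M(3)]])
  then show "lin K (Y \<otimes>\<^sub>K Z) (W \<otimes>\<^sub>K Z) (tensor_left Y Z W b x)" if "x \<in> carrier X" for x using that .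
  note WZ = tensor_field_module [OF M(4,3)] and pt = pt_bilin [OF M(4,3)]
  fix t assume t: "t \<in> carrier (Y \<otimes>\<^sub>K Z)"
  show "lin K X (W \<otimes>\<^sub>K Z) (\<lambda>x. tensor_left Y Z W b x t)"
  proof (rule linI)
    fix x x' assume x: "x \<in> carrier X" "x' \<in> carrier X"
    show "tensor_left Y Z W b (x \<oplus>\<^bsub>X\<^esub> x') t = tensor_left Y Z W b x t \<oplus>\<^bsub>W \<otimes>\<^sub>K Z\<^esub> tensor_left Y Z W b x' t"
      by (rule tensor_field_ext [OF M(2,3) WZ l lin_plus [OF WZ l l] _ t])
        (simp_all add: x tensor_left_pt [OF b] lin_add [OF bilinD(2) [OF b]] lin_add [OF bilinD(2) [OF pt]] bilin_closed [OF b])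
  next
    fix c x assume c: "c \<in> carrier K" and x: "x \<in> carrier X"
    show "tensor_left Y Z W b (c \<odot>\<^bsub>X\<^esub> x) t = c \<odot>\<^bsub>W \<otimes>\<^sub>K Z\<^esub> tensor_left Y Z W b x t"
      by (rule tensor_field_ext [OF M(2,3) WZ l lin_scale [OF WZ l] _ t])
        (simp_all add: x c tensor_left_pt [OF b] lin_smult [OF bilinD(2) [OF b]] lin_smult [OF bilinD(2) [OF pt]] bilin_closed [OF b])
  qed (rule lin_closed [OF l t])
qed

lemma tensor_right_bilin:
  assumes b: "bilin K Y Z W b"
  shows "bilin K (X \<otimes>\<^sub>K Y) Z (X \<otimes>\<^sub>K W) (tensor_right X Y W b)"
proof (rule bilinI)
  interpret Z: module K Z by (rule M)
  have l: "lin K (X \<otimes>\<^sub>K Y) (X \<otimes>\<^sub>K W) (\<lambda>s. tensor_right X Y W b s z)" if "z \<in> carrier Z" for z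
    unfolding tensor_right_def by (rule tensor_map_lin [OF M(1,2,1,4) lin_idm [OF M(1)] bilinD(2) [OF b that]])
  then show "lin K (X \<otimes>\<^sub>K Y) (X \<otimes>\<^sub>K W) (\<lambda>s. tensor_right X Y W b s z)" if "z \<in> carrier Z" for z using that .
  note XW = tensor_field_module [OF M(1,4)] and pt = pt_bilin [OF M(1,4)]
  fix s assume s: "s \<in> carrier (X \<otimes>\<^sub>K Y)"
  show "lin K Z (X \<otimes>\<^sub>K W) (tensor_right X Y W b s)"
  proof (rule linI)
    fix z z' assume z: "z \<in> carrier Z" "z' \<in> carrier Z"
    show "tensor_right X Y W b s (z \<oplus>\<^bsub>Z\<^esub> z') = tensor_right X Y W b s z \<oplus>\<^bsub>X \<otimes>\<^sub>K W\<^esub> tensor_right X Y W b s z'"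
      by (rule tensor_field_ext [OF M(1,2) XW l lin_plus [OF XW l l] _ s])
        (simp_all add: z tensor_right_pt [OF b] lin_add [OF bilinD(1) [OF b]] lin_add [OF bilinD(1) [OF pt]] bilin_closed [OF b])
  next
    fix c z assume c: "c \<in> carrier K" and z: "z \<in> carrier Z"
    show "tensor_right X Y W b s (c \<odot>\<^bsub>Z\<^esub> z) = c \<odot>\<^bsub>X \<otimes>\<^sub>K W\<^esub> tensor_right X Y W b s z"
      by (rule tensor_field_ext [OF M(1,2) XW l lin_scale [OF XW l] _ s])
        (simp_all add: z c tensor_right_pt [OF b] lin_smult [OF bilinD(1) [OF b]] lin_smult [OF bilinD(1) [OF pt]] bilin_closed [OF b])
  qed (rule lin_closed [OF l s])
qed

end

context
  fixes X :: "('a, 'k, 'x) bimodule" and Y :: "('a, 'k, 'y) bimodule" and Z :: "('a, 'k, 'z) bimodule"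
    and W :: "('a, 'k, 'w) bimodule" and b :: "'x \<Rightarrow> 'y \<Rightarrow> 'w"
  assumes X: "wb X" and Y: "wb Y" and Z: "wb Z" and W: "wb W" and b: "bilin K X Y W b"
begin

private lemmas Ml = wbD(1) [OF X] wbD(1) [OF Y] wbD(1) [OF Z] wbD(1) [OF W]

text \<open>With \<open>h\<close> the projection and \<open>b\<close> the pure tensor, composition
  with \<open>h\<close> turns the pure tensor into the tensor class. This is the passage from the
  inverse associator to the comparison maps.\<close>

lemma tensor_left_post:
  fixes W' :: "('a, 'k, 'w2) bimodule"
  assumes "module K W'" and h: "lin K W W' h" and x: "x \<in> carrier X" and t: "t \<in> carrier (Y \<otimes>\<^sub>K Z)"
  shows "tensor_map K W Z W' Z h (idm Z) (tensor_left Y Z W b x t) = tensor_left Y Z W' (\<lambda>x y. h (b x y)) x t"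
  unfolding tensor_left_def
  by (subst tensor_map_comp [OF Ml(2,3,4,3) assms(1) Ml(3) bilinD(1) [OF b x] lin_idm [OF Ml(3)] h lin_idm [OF Ml(3)] t])
    (rule fun_cong [OF tensor_map_cong]; simp)

text \<open>This and the next two identities lift the laws of \<open>b\<close> from elements of
  \<open>Y\<close> to whole tensors \<open>t\<close>. They supply the hypotheses of
  \<open>the_tensor_over_hom\<close> for the maps of left type.\<close>

lemma tensor_left_lact:
  assumes bl: "\<And>a x y. \<lbrakk>a \<in> carrier A; x \<in> carrier X; y \<in> carrier Y\<rbrakk> \<Longrightarrow> b (lact X a x) y = lact W a (b x y)"
    and a: "a \<in> carrier A" and x: "x \<in> carrier X" and t: "t \<in> carrier (Y \<otimes>\<^sub>K Z)"
  shows "tensor_left Y Z W b (lact X a x) t = lact (W \<otimes>\<^sub>K Z) a (tensor_left Y Z W b x t)"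
  unfolding tensor_left_def tensor_field_sel
  by (subst tensor_map_comp [OF Ml(2,3,4,3) Ml(4,3) bilinD(1) [OF b x] lin_idm [OF Ml(3)] wbD(2) [OF W a] lin_idm [OF Ml(3)] t])
    (rule fun_cong [OF tensor_map_cong]; simp add: bl a x)

lemma tensor_left_ract:
  assumes a: "a \<in> carrier A" and x: "x \<in> carrier X" and t: "t \<in> carrier (Y \<otimes>\<^sub>K Z)"
  shows "tensor_left Y Z W b x (ract (Y \<otimes>\<^sub>K Z) t a) = ract (W \<otimes>\<^sub>K Z) (tensor_left Y Z W b x t) a"
  unfolding tensor_left_def tensor_field_sel
  by (subst tensor_map_comp [OF Ml(2,3,4,3) Ml(4,3) bilinD(1) [OF b x] lin_idm [OF Ml(3)] lin_idm [OF Ml(4)] wbD(3) [OF Z a] t],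
      subst tensor_map_comp [OF Ml(2,3,2,3) Ml(4,3) lin_idm [OF Ml(2)] wbD(3) [OF Z a] bilinD(1) [OF b x] lin_idm [OF Ml(3)] t])
    (rule fun_cong [OF tensor_map_cong]; simp add: a x bilin_closed [OF b] wbD(5) [OF Z])

lemma tensor_left_balanced:
  assumes bal: "\<And>x a y. \<lbrakk>x \<in> carrier X; a \<in> carrier A; y \<in> carrier Y\<rbrakk> \<Longrightarrow> b (ract X x a) y = b x (lact Y a y)"
    and a: "a \<in> carrier A" and x: "x \<in> carrier X" and t: "t \<in> carrier (Y \<otimes>\<^sub>K Z)"
  shows "tensor_left Y Z W b (ract X x a) t = tensor_left Y Z W b x (lact (Y \<otimes>\<^sub>K Z) a t)"
  unfolding tensor_left_def tensor_field_sel
  by (subst tensor_map_comp [OF Ml(2,3,2,3) Ml(4,3) wbD(2) [OF Y a] lin_idm [OF Ml(3)] bilinD(1) [OF b x] lin_idm [OF Ml(3)] t])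
    (rule fun_cong [OF tensor_map_cong]; simp add: bal a x)

text \<open>The law \<open>br\<close> carries the inner right action on \<open>Y\<close> to the one
  on \<open>W\<close>; the inner left action on \<open>Z\<close> is left untouched.\<close>

lemma tensor_left_cotensor:
  assumes br: "\<And>a x y. \<lbrakk>a \<in> carrier A; x \<in> carrier X; y \<in> carrier Y\<rbrakk> \<Longrightarrow> b x (ract Y y a) = ract W (b x y) a"
    and x: "x \<in> carrier X" and t: "t \<in> carrier (Y \<otimes>\<^sup>A Z)"
  shows "tensor_left Y Z W b x t \<in> carrier (W \<otimes>\<^sup>A Z)"
  unfolding tensor_left_def
  by (rule tensor_map_cotensor [OF Y Z W Z bilinD(1) [OF b x] lin_idm [OF Ml(3)] _ _ t])
    (simp_all add: br x wbD(4) [OF Z])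

lemma tensor_left_bilin_cotensor:
  assumes br: "\<And>a x y. \<lbrakk>a \<in> carrier A; x \<in> carrier X; y \<in> carrier Y\<rbrakk> \<Longrightarrow> b x (ract Y y a) = ract W (b x y) a"
  shows "bilin K X (Y \<otimes>\<^sup>A Z) (W \<otimes>\<^sup>A Z) (tensor_left Y Z W b)"
proof (rule bilinI)
  note bb = bilinD [OF tensor_left_bilin [OF Ml b]]
  show "lin K (Y \<otimes>\<^sup>A Z) (W \<otimes>\<^sup>A Z) (tensor_left Y Z W b x)" if "x \<in> carrier X" for x
    by (rule lin_into_cotensor [OF W Z lin_from_cotensor [OF Y Z bb(1) [OF that]]])
      (rule tensor_left_cotensor [OF br that])
  show "lin K X (W \<otimes>\<^sup>A Z) (\<lambda>x. tensor_left Y Z W b x t)" if "t \<in> carrier (Y \<otimes>\<^sup>A Z)" for t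
    by (rule lin_into_cotensor [OF W Z bb(2) [OF cotensor_subset [OF that]]])
      (rule tensor_left_cotensor [OF br _ that])
qed

end

context
  fixes X :: "('a, 'k, 'x) bimodule" and Y :: "('a, 'k, 'y) bimodule" and Z :: "('a, 'k, 'z) bimodule"
    and W :: "('a, 'k, 'w) bimodule" and b :: "'y \<Rightarrow> 'z \<Rightarrow> 'w"
  assumes X: "wb X" and Y: "wb Y" and Z: "wb Z" and W: "wb W" and b: "bilin K Y Z W b"
begin

private lemmas Mr = wbD(1) [OF X] wbD(1) [OF Y] wbD(1) [OF Z] wbD(1) [OF W]

lemma tensor_right_post:
  fixes W' :: "('a, 'k, 'w2) bimodule"
  assumes "module K W'" and h: "lin K W W' h" and z: "z \<in> carrier Z" and s: "s \<in> carrier (X \<otimes>\<^sub>K Y)"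
  shows "tensor_map K X W X W' (idm X) h (tensor_right X Y W b s z) = tensor_right X Y W' (\<lambda>y z. h (b y z)) s z"
  unfolding tensor_right_def
  by (subst tensor_map_comp [OF Mr(1,2,1,4) Mr(1) assms(1) lin_idm [OF Mr(1)] bilinD(2) [OF b z] lin_idm [OF Mr(1)] h s])
    (rule fun_cong [OF tensor_map_cong]; simp)

lemma tensor_right_ract:
  assumes br: "\<And>a y z. \<lbrakk>a \<in> carrier A; y \<in> carrier Y; z \<in> carrier Z\<rbrakk> \<Longrightarrow> b y (ract Z z a) = ract W (b y z) a"
    and a: "a \<in> carrier A" and z: "z \<in> carrier Z" and s: "s \<in> carrier (X \<otimes>\<^sub>K Y)"
  shows "tensor_right X Y W b s (ract Z z a) = ract (X \<otimes>\<^sub>K W) (tensor_right X Y W b s z) a"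
  unfolding tensor_right_def tensor_field_sel
  by (subst tensor_map_comp [OF Mr(1,2,1,4) Mr(1,4) lin_idm [OF Mr(1)] bilinD(2) [OF b z] lin_idm [OF Mr(1)] wbD(3) [OF W a] s])
    (rule fun_cong [OF tensor_map_cong]; simp add: br a z)

lemma tensor_right_lact:
  assumes a: "a \<in> carrier A" and z: "z \<in> carrier Z" and s: "s \<in> carrier (X \<otimes>\<^sub>K Y)"
  shows "tensor_right X Y W b (lact (X \<otimes>\<^sub>K Y) a s) z = lact (X \<otimes>\<^sub>K W) a (tensor_right X Y W b s z)"
  unfolding tensor_right_def tensor_field_sel
  by (subst tensor_map_comp [OF Mr(1,2,1,4) Mr(1,4) lin_idm [OF Mr(1)] bilinD(2) [OF b z] wbD(2) [OF X a] lin_idm [OF Mr(4)] s],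
      subst tensor_map_comp [OF Mr(1,2,1,2) Mr(1,4) wbD(2) [OF X a] lin_idm [OF Mr(2)] lin_idm [OF Mr(1)] bilinD(2) [OF b z] s])
    (rule fun_cong [OF tensor_map_cong]; simp add: a z bilin_closed [OF b] wbD(4) [OF X])

lemma tensor_right_balanced:
  assumes bal: "\<And>y a z. \<lbrakk>y \<in> carrier Y; a \<in> carrier A; z \<in> carrier Z\<rbrakk> \<Longrightarrow> b (ract Y y a) z = b y (lact Z a z)"
    and a: "a \<in> carrier A" and z: "z \<in> carrier Z" and s: "s \<in> carrier (X \<otimes>\<^sub>K Y)"
  shows "tensor_right X Y W b (ract (X \<otimes>\<^sub>K Y) s a) z = tensor_right X Y W b s (lact Z a z)"
  unfolding tensor_right_def tensor_field_sel
  by (subst tensor_map_comp [OF Mr(1,2,1,2) Mr(1,4) lin_idm [OF Mr(1)] wbD(3) [OF Y a] lin_idm [OF Mr(1)] bilinD(2) [OF b z] s])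
    (rule fun_cong [OF tensor_map_cong]; simp add: bal a z)

lemma tensor_right_cotensor:
  assumes bl: "\<And>a y z. \<lbrakk>a \<in> carrier A; y \<in> carrier Y; z \<in> carrier Z\<rbrakk> \<Longrightarrow> b (lact Y a y) z = lact W a (b y z)"
    and z: "z \<in> carrier Z" and s: "s \<in> carrier (X \<otimes>\<^sup>A Y)"
  shows "tensor_right X Y W b s z \<in> carrier (X \<otimes>\<^sup>A W)"
  unfolding tensor_right_def
  by (rule tensor_map_cotensor [OF X Y X W lin_idm [OF Mr(1)] bilinD(2) [OF b z] _ _ s])
    (simp_all add: bl z wbD(5) [OF X])

lemma tensor_right_bilin_cotensor:
  assumes bl: "\<And>a y z. \<lbrakk>a \<in> carrier A; y \<in> carrier Y; z \<in> carrier Z\<rbrakk> \<Longrightarrow> b (lact Y a y) z = lact W a (b y z)"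
  shows "bilin K (X \<otimes>\<^sup>A Y) Z (X \<otimes>\<^sup>A W) (tensor_right X Y W b)"
proof (rule bilinI)
  note bb = bilinD [OF tensor_right_bilin [OF Mr b]]
  show "lin K (X \<otimes>\<^sup>A Y) (X \<otimes>\<^sup>A W) (\<lambda>s. tensor_right X Y W b s z)" if "z \<in> carrier Z" for z
    by (rule lin_into_cotensor [OF X W lin_from_cotensor [OF X Y bb(2) [OF that]]])
      (rule tensor_right_cotensor [OF bl that])
  show "lin K Z (X \<otimes>\<^sup>A W) (tensor_right X Y W b s)" if "s \<in> carrier (X \<otimes>\<^sup>A Y)" for s
    by (rule lin_into_cotensor [OF X W bb(1) [OF cotensor_subset [OF that]]])
      (rule tensor_right_cotensor [OF bl _ that])
qed

end

text \<open>\<open>inv_on\<close> is defined by choice and carries no visible linearity. Exhibiting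
  a linear two-sided inverse identifies it.\<close>

lemma inv_on_eq:
  assumes "lin K M N f" "lin K N M g" "\<And>x. x \<in> carrier M \<Longrightarrow> g (f x) = x" "\<And>y. y \<in> carrier N \<Longrightarrow> f (g y) = y"
  shows "inv_on M N f = restrict g (carrier N)"
proof (rule restrict_ext)
  fix y assume "y \<in> carrier N"
  then show "inv_into (carrier M) f y = g y"
    using assms by (intro inv_into_f_eq) (auto intro: inj_on_inverseI lin_closed)
qed

section \<open>The associator of vector spaces and its inverse\<close>

context
  fixes X :: "('a, 'k, 'x) bimodule" and Y :: "('a, 'k, 'y) bimodule" and Z :: "('a, 'k, 'z) bimodule"
  assumes X: "wb X" and Y: "wb Y" and Z: "wb Z"
begin

private lemmas Mt = wbD(1) [OF X] wbD(1) [OF Y] wbD(1) [OF Z]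
private lemmas XxY = wb_tensor_field [OF X Y] and YxZ = wb_tensor_field [OF Y Z]

text \<open>The first factor \<open>s\<close> is an arbitrary tensor, although the definition
  prescribes values for pure \<open>s\<close> only. This generality allows \<open>s\<close> to range
  over \<open>X \<otimes>\<^sup>A Y\<close> later.\<close>

lemma assoc_vect:
  shows "assoc_vect K X Y Z \<in> linear_maps K ((X \<otimes>\<^sub>K Y) \<otimes>\<^sub>K Z) (X \<otimes>\<^sub>K (Y \<otimes>\<^sub>K Z))" (is ?A)
    and "\<lbrakk>s \<in> carrier (X \<otimes>\<^sub>K Y); z \<in> carrier Z\<rbrakk> \<Longrightarrow>
      assoc_vect K X Y Z (pt (X \<otimes>\<^sub>K Y) Z s z) = tensor_right X Y (Y \<otimes>\<^sub>K Z) (pt Y Z) s z"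
    (is "_ \<Longrightarrow> _ \<Longrightarrow> ?B")
proof -
  note W = wbD(1) [OF wb_tensor_field [OF X YxZ]]
  note b = tensor_right_bilin [OF Mt wbD(1) [OF YxZ] pt_bilin [OF Mt(2,3)]]
  have "(\<forall>x\<in>carrier X. \<forall>y\<in>carrier Y. \<forall>z\<in>carrier Z.
      h (pt (X \<otimes>\<^sub>K Y) Z (pt X Y x y) z) = pt X (Y \<otimes>\<^sub>K Z) x (pt Y Z y z)) \<longleftrightarrow>
    (\<forall>s\<in>carrier (X \<otimes>\<^sub>K Y). \<forall>z\<in>carrier Z.
      h (pt (X \<otimes>\<^sub>K Y) Z s z) = tensor_right X Y (Y \<otimes>\<^sub>K Z) (pt Y Z) s z)" (is "?l \<longleftrightarrow> ?r")
    if "lin K ((X \<otimes>\<^sub>K Y) \<otimes>\<^sub>K Z) (X \<otimes>\<^sub>K (Y \<otimes>\<^sub>K Z)) h" for h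
  proof
    assume l: ?l
    show ?r
    proof (intro ballI)
      fix s z assume s: "s \<in> carrier (X \<otimes>\<^sub>K Y)" and z: "z \<in> carrier Z"
      show "h (pt (X \<otimes>\<^sub>K Y) Z s z) = tensor_right X Y (Y \<otimes>\<^sub>K Z) (pt Y Z) s z"
        \<comment> \<open>For fixed \<open>z\<close> both sides are linear in \<open>s\<close>, so
          the prescribed triple tensors suffice.\<close>
        by (rule tensor_field_ext [OF Mt(1,2) W lin_comp [OF bilinD(2) [OF pt_bilin [OF wbD(1) [OF XxY] Mt(3)] z] that]
              bilinD(2) [OF b z] _ s])
          (use l z in \<open>simp add: tensor_right_pt [OF Mt wbD(1) [OF YxZ] pt_bilin [OF Mt(2,3)]]\<close>)
    qed
  next
    assume ?r
    then show ?l
      by (simp add: tensor_right_pt [OF Mt wbD(1) [OF YxZ] pt_bilin [OF Mt(2,3)]] pt_closed Mt)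
  qed
  note the = the_tensor_field_map [OF wbD(1) [OF XxY] Mt(3) W b this, folded assoc_vect_def]
  show ?A
    by (rule the(1))
  show ?B
    if "s \<in> carrier (X \<otimes>\<^sub>K Y)" "z \<in> carrier Z"
    using the(2) that by blast
qed

text \<open>The inverse is built independently from the universal property for the other bracketing;
  checking that the composites are identities then identifies it with the inverse chosen in the
  definition.\<close>

lemma assoc_vect_inv:
  shows "lin K (X \<otimes>\<^sub>K (Y \<otimes>\<^sub>K Z)) ((X \<otimes>\<^sub>K Y) \<otimes>\<^sub>K Z) (assoc_vect_inv K X Y Z)" (is ?A)
    and "\<lbrakk>x \<in> carrier X; t \<in> carrier (Y \<otimes>\<^sub>K Z)\<rbrakk> \<Longrightarrow>
      assoc_vect_inv K X Y Z (pt X (Y \<otimes>\<^sub>K Z) x t) = tensor_left Y Z (X \<otimes>\<^sub>K Y) (pt X Y) x t"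
    (is "_ \<Longrightarrow> _ \<Longrightarrow> ?B")
proof -
  note D = wbD(1) [OF wb_tensor_field [OF X YxZ]] and C = wbD(1) [OF wb_tensor_field [OF XxY Z]]
  note pb = pt_bilin [OF Mt(1,2)] pt_bilin [OF Mt(2,3)]
  note b = tensor_left_bilin [OF Mt wbD(1) [OF XxY] pb(1)]
  note lp = tensor_left_pt [OF Mt wbD(1) [OF XxY] pb(1)] and rp = tensor_right_pt [OF Mt wbD(1) [OF YxZ] pb(2)]
  have f: "lin K ((X \<otimes>\<^sub>K Y) \<otimes>\<^sub>K Z) (X \<otimes>\<^sub>K (Y \<otimes>\<^sub>K Z)) (assoc_vect K X Y Z)"
    using assoc_vect(1) by (simp add: linear_maps_iff)
  obtain g where g: "lin K (X \<otimes>\<^sub>K (Y \<otimes>\<^sub>K Z)) ((X \<otimes>\<^sub>K Y) \<otimes>\<^sub>K Z) g"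
    and gp: "\<forall>x\<in>carrier X. \<forall>t\<in>carrier (Y \<otimes>\<^sub>K Z). g (pt X (Y \<otimes>\<^sub>K Z) x t) = tensor_left Y Z (X \<otimes>\<^sub>K Y) (pt X Y) x t"
    using tensor_field_lift [OF Mt(1) wbD(1) [OF YxZ] C b] by blast
  \<comment> \<open>Two layers of extension: first to pure tensors of an arbitrary \<open>s\<close>
    with \<open>z\<close>, then, inside, from pure \<open>s\<close> to all \<open>s\<close>.\<close>
  have gf: "g (assoc_vect K X Y Z u) = u" if u: "u \<in> carrier ((X \<otimes>\<^sub>K Y) \<otimes>\<^sub>K Z)" for u
  proof (rule tensor_field_ext [OF wbD(1) [OF XxY] Mt(3) C lin_comp [OF f g] lin_ident _ u])
    fix s z assume s: "s \<in> carrier (X \<otimes>\<^sub>K Y)" and z: "z \<in> carrier Z"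
    have "g (tensor_right X Y (Y \<otimes>\<^sub>K Z) (pt Y Z) s z) = pt (X \<otimes>\<^sub>K Y) Z s z"
      by (rule tensor_field_ext [OF Mt(1,2) C lin_comp [OF bilinD(2) [OF tensor_right_bilin [OF Mt wbD(1) [OF YxZ] pb(2)] z] g]
            bilinD(2) [OF pt_bilin [OF wbD(1) [OF XxY] Mt(3)] z] _ s])
        (simp add: rp gp lp z pt_closed Mt)
    then show "g (assoc_vect K X Y Z (pt (X \<otimes>\<^sub>K Y) Z s z)) = pt (X \<otimes>\<^sub>K Y) Z s z"
      by (simp add: assoc_vect(2) s z)
  qed
  have fg: "assoc_vect K X Y Z (g u) = u" if u: "u \<in> carrier (X \<otimes>\<^sub>K (Y \<otimes>\<^sub>K Z))" for u
  proof (rule tensor_field_ext [OF Mt(1) wbD(1) [OF YxZ] D lin_comp [OF g f] lin_ident _ u])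
    fix x t assume x: "x \<in> carrier X" and t: "t \<in> carrier (Y \<otimes>\<^sub>K Z)"
    have "assoc_vect K X Y Z (tensor_left Y Z (X \<otimes>\<^sub>K Y) (pt X Y) x t) = pt X (Y \<otimes>\<^sub>K Z) x t"
      by (rule tensor_field_ext [OF Mt(2,3) D lin_comp [OF bilinD(1) [OF b x] f]
            bilinD(1) [OF pt_bilin [OF Mt(1) wbD(1) [OF YxZ]] x] _ t])
        (simp add: rp lp x pt_closed Mt assoc_vect(2))
    then show "assoc_vect K X Y Z (g (pt X (Y \<otimes>\<^sub>K Z) x t)) = pt X (Y \<otimes>\<^sub>K Z) x t"
      by (simp add: gp x t)
  qed
  have eq: "assoc_vect_inv K X Y Z = restrict g (carrier (X \<otimes>\<^sub>K (Y \<otimes>\<^sub>K Z)))"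
    unfolding assoc_vect_inv_def by (rule inv_on_eq [OF f g gf fg])
  show ?A
    by (simp add: eq lin_restrict [OF D] g)
  show ?B
    if "x \<in> carrier X" "t \<in> carrier (Y \<otimes>\<^sub>K Z)"
    using that by (simp add: eq gp pt_closed Mt wbD(1) [OF YxZ])
qed

end

section \<open>The four maps on pure tensors\<close>

lemma proj_pt: "(\<lambda>x y. proj K A X Y (pt X Y x y)) = cl X Y"
  by (simp add: fun_eq_iff tensor_class_def)

context
  fixes X :: "('a, 'k, 'x) bimodule" and Y :: "('a, 'k, 'y) bimodule" and Z :: "('a, 'k, 'z) bimodule"
  assumes X: "wb X" and Y: "wb Y" and Z: "wb Z"
begin

private lemmas L = wbD(1) [OF X] wbD(1) [OF Y] wbD(1) [OF Z]
private lemmas XkY = wb_tensor_field [OF X Y] and YkZ = wb_tensor_field [OF Y Z]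
private lemmas XoY = wb_tensor_over [OF X Y] and YoZ = wb_tensor_over [OF Y Z]
private lemmas XcY = wb_cotensor [OF X Y] and YcZ = wb_cotensor [OF Y Z]
private lemmas ptXY = pt_bilin [OF L(1,2)] and ptYZ = pt_bilin [OF L(2,3)]
private lemmas clXY = cl_bilin [OF X Y] and clYZ = cl_bilin [OF Y Z]

text \<open>Although \<open>incl\<close> does not change elements, the tensor products with factor
  \<open>Y \<otimes>\<^sup>A Z\<close> and with factor \<open>Y \<otimes>\<^sub>K Z\<close> come
  from different free modules, so their pure tensors differ. The map
  \<open>id \<otimes> incl\<close> carries one to the other, where the inverse associator is known
  on any \<open>t\<close>.\<close>

lemma gamma_l:
  shows "gamma_l K A X Y Z \<in> bimod_hom K A (X \<otimes>\<^sub>K (Y \<otimes>\<^sup>A Z)) ((X \<otimes>\<^sub>K Y) \<otimes>\<^sup>A Z)" (is ?A)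
    and "\<lbrakk>x \<in> carrier X; t \<in> carrier (Y \<otimes>\<^sup>A Z)\<rbrakk> \<Longrightarrow>
      gamma_l K A X Y Z (pt X (Y \<otimes>\<^sup>A Z) x t) = tensor_left Y Z (X \<otimes>\<^sub>K Y) (pt X Y) x t"
    (is "_ \<Longrightarrow> _ \<Longrightarrow> ?B")
proof -
  note W = wb_cotensor [OF XkY Z] and D = wb_tensor_field [OF XkY Z]
  note pr = ract_pt [OF X Y, symmetric] and pl = lact_pt [OF X Y, symmetric]
  note v = tensor_left_bilin_cotensor [OF X Y Z XkY ptXY pr]
  note i = bimod_hom_lin [OF incl_bimod_hom [OF XkY Z]] and j = bimod_hom_lin [OF incl_bimod_hom [OF Y Z]]
  note tm = L(1) wbD(1) [OF YcZ] L(1) wbD(1) [OF YkZ] lin_idm [OF L(1)] j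
  have Q: "comp_on (X \<otimes>\<^sub>K (Y \<otimes>\<^sup>A Z)) (incl K A (X \<otimes>\<^sub>K Y) Z) h =
      comp_on (X \<otimes>\<^sub>K (Y \<otimes>\<^sup>A Z)) (assoc_vect_inv K X Y Z)
        (tensor_map K X (Y \<otimes>\<^sup>A Z) X (Y \<otimes>\<^sub>K Z) (idm X) (incl K A Y Z)) \<longleftrightarrow>
    (\<forall>x\<in>carrier X. \<forall>t\<in>carrier (Y \<otimes>\<^sup>A Z).
      h (pt X (Y \<otimes>\<^sup>A Z) x t) = tensor_left Y Z (X \<otimes>\<^sub>K Y) (pt X Y) x t)"
    if h: "lin K (X \<otimes>\<^sub>K (Y \<otimes>\<^sup>A Z)) ((X \<otimes>\<^sub>K Y) \<otimes>\<^sup>A Z) h" for h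
    unfolding compose_def
    by (subst tensor_field_restrict_eq_iff [OF L(1) wbD(1) [OF YcZ] wbD(1) [OF D] lin_comp [OF h i]
        lin_comp [OF tensor_map_lin [OF tm] assoc_vect_inv(1) [OF X Y Z]]])
      (simp add: tensor_map_pure [OF tm] incl_apply [OF Y Z] incl_apply [OF XkY Z] cotensor_subset
        assoc_vect_inv(2) [OF X Y Z] lin_closed [OF h] pt_closed L wbD(1) [OF YcZ])
  note the = the_tensor_field_hom [OF X YcZ W v _ _ Q, folded gamma_l_def]
  note eqs = tensor_left_lact [OF X Y Z XkY ptXY pl] tensor_left_ract [OF X Y Z XkY ptXY]
  show ?A
    by (rule the(1)) (simp_all add: cotensor_sel eqs cotensor_subset)
  show ?B
    if "x \<in> carrier X" "t \<in> carrier (Y \<otimes>\<^sup>A Z)"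
    by (rule the(2) [rule_format, rotated -2, OF that]) (simp_all add: cotensor_sel eqs cotensor_subset)
qed

text \<open>Following the inverse associator by the projection replaces the pure tensor by the
  tensor class in \<open>tensor_left\<close>. Balancedness of the class is what lets the result
  descend to \<open>X \<otimes>\<^sub>A (Y \<otimes>\<^sub>K Z)\<close>.\<close>

lemma gamma_l_tilde:
  shows "gamma_l_tilde K A X Y Z \<in> bimod_hom K A (X \<otimes>\<^sub>A (Y \<otimes>\<^sub>K Z)) ((X \<otimes>\<^sub>A Y) \<otimes>\<^sub>K Z)" (is ?A)
    and "\<lbrakk>x \<in> carrier X; t \<in> carrier (Y \<otimes>\<^sub>K Z)\<rbrakk> \<Longrightarrow>
      gamma_l_tilde K A X Y Z (cl X (Y \<otimes>\<^sub>K Z) x t) = tensor_left Y Z (X \<otimes>\<^sub>A Y) (cl X Y) x t"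
    (is "_ \<Longrightarrow> _ \<Longrightarrow> ?B")
proof -
  note W = wb_tensor_field [OF XoY Z]
  note v = tensor_left_bilin [OF L wbD(1) [OF XoY] clXY]
  note tm = wbD(1) [OF XkY] L(3) wbD(1) [OF XoY] L(3) proj_lin [OF X Y] lin_idm [OF L(3)]
  have Q: "comp_on (X \<otimes>\<^sub>K (Y \<otimes>\<^sub>K Z)) h (proj K A X (Y \<otimes>\<^sub>K Z)) =
      comp_on (X \<otimes>\<^sub>K (Y \<otimes>\<^sub>K Z))
        (tensor_map K (X \<otimes>\<^sub>K Y) Z (X \<otimes>\<^sub>A Y) Z (proj K A X Y) (idm Z)) (assoc_vect_inv K X Y Z) \<longleftrightarrow>
    (\<forall>x\<in>carrier X. \<forall>t\<in>carrier (Y \<otimes>\<^sub>K Z).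
      h (cl X (Y \<otimes>\<^sub>K Z) x t) = tensor_left Y Z (X \<otimes>\<^sub>A Y) (cl X Y) x t)"
    if h: "lin K (X \<otimes>\<^sub>A (Y \<otimes>\<^sub>K Z)) ((X \<otimes>\<^sub>A Y) \<otimes>\<^sub>K Z) h" for h
    unfolding compose_def
    by (subst tensor_field_restrict_eq_iff [OF L(1) wbD(1) [OF YkZ] wbD(1) [OF W]
        lin_comp [OF proj_lin [OF X YkZ] h]
        lin_comp [OF assoc_vect_inv(1) [OF X Y Z] tensor_map_lin [OF tm]]])
      (simp add: assoc_vect_inv(2) [OF X Y Z] tensor_class_def [symmetric] proj_pt
        tensor_left_post [OF X Y Z XkY ptXY wbD(1) [OF XoY] proj_lin [OF X Y]])
  note the = the_tensor_over_hom [OF X YkZ W v _ _ _ Q, folded gamma_l_tilde_def]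
  note eqs = tensor_left_lact [OF X Y Z XoY clXY lact_cl [OF X Y, symmetric]]
    tensor_left_ract [OF X Y Z XoY clXY] tensor_left_balanced [OF X Y Z XoY clXY cl_balanced [OF X Y]]
  show ?A
    by (rule the(1)) (simp_all add: eqs)
  show ?B
    if "x \<in> carrier X" "t \<in> carrier (Y \<otimes>\<^sub>K Z)"
    by (rule the(2) [rule_format, rotated -2, OF that]) (simp_all add: eqs)
qed

private lemmas left_eqs = tensor_left_lact [OF X Y Z XoY clXY lact_cl [OF X Y, symmetric]]
  tensor_left_ract [OF X Y Z XoY clXY] tensor_left_balanced [OF X Y Z XoY clXY cl_balanced [OF X Y]]

private lemmas left_bilin = tensor_left_bilin_cotensor [OF X Y Z XoY clXY ract_cl [OF X Y, symmetric]]

lemma partial_l: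
  shows "partial_l K A X Y Z \<in> bimod_hom K A (X \<otimes>\<^sub>A (Y \<otimes>\<^sup>A Z)) ((X \<otimes>\<^sub>A Y) \<otimes>\<^sup>A Z)" (is ?A)
    and "\<lbrakk>x \<in> carrier X; t \<in> carrier (Y \<otimes>\<^sup>A Z)\<rbrakk> \<Longrightarrow>
      partial_l K A X Y Z (cl X (Y \<otimes>\<^sup>A Z) x t) = tensor_left Y Z (X \<otimes>\<^sub>A Y) (cl X Y) x t"
    (is "_ \<Longrightarrow> _ \<Longrightarrow> ?B")
proof -
  note W = wb_cotensor [OF XoY Z] and D = wb_tensor_field [OF XoY Z]
  note tm = wbD(1) [OF XkY] L(3) wbD(1) [OF XoY] L(3) proj_lin [OF X Y] lin_idm [OF L(3)]
  \<comment> \<open>The induced map is regarded as landing in the ambient tensor product over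
    \<open>K\<close>; there the defining square can be tested on pure tensors.\<close>
  have cm: "lin K ((X \<otimes>\<^sub>K Y) \<otimes>\<^sup>A Z) ((X \<otimes>\<^sub>A Y) \<otimes>\<^sub>K Z)
      (cotensor_map K A (X \<otimes>\<^sub>K Y) Z (X \<otimes>\<^sub>A Y) Z (proj K A X Y) (idm Z))"
    by (simp add: cotensor_map_def lin_restrict cotensor_module [OF XkY Z]
      lin_from_cotensor [OF XkY Z] tensor_map_lin [OF tm])
  note g = bimod_hom_lin [OF gamma_l(1)]
  have Q: "comp_on (X \<otimes>\<^sub>K (Y \<otimes>\<^sup>A Z)) h (proj K A X (Y \<otimes>\<^sup>A Z)) =
      comp_on (X \<otimes>\<^sub>K (Y \<otimes>\<^sup>A Z))
        (cotensor_map K A (X \<otimes>\<^sub>K Y) Z (X \<otimes>\<^sub>A Y) Z (proj K A X Y) (idm Z)) (gamma_l K A X Y Z) \<longleftrightarrow>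
    (\<forall>x\<in>carrier X. \<forall>t\<in>carrier (Y \<otimes>\<^sup>A Z).
      h (cl X (Y \<otimes>\<^sup>A Z) x t) = tensor_left Y Z (X \<otimes>\<^sub>A Y) (cl X Y) x t)"
    if h: "lin K (X \<otimes>\<^sub>A (Y \<otimes>\<^sup>A Z)) ((X \<otimes>\<^sub>A Y) \<otimes>\<^sup>A Z) h" for h
    unfolding compose_def
    by (subst tensor_field_restrict_eq_iff [OF L(1) wbD(1) [OF YcZ] wbD(1) [OF D]
        lin_comp [OF proj_lin [OF X YcZ] lin_cotensor_weaken [OF XoY Z h]] lin_comp [OF g cm]])
      (simp add: gamma_l(2) cotensor_map_def tensor_left_cotensor [OF X Y Z XkY ptXY ract_pt [OF X Y, symmetric]]
        tensor_class_def [symmetric] proj_pt cotensor_subset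
        tensor_left_post [OF X Y Z XkY ptXY wbD(1) [OF XoY] proj_lin [OF X Y]])
  note the = the_tensor_over_hom [OF X YcZ W left_bilin _ _ _ Q, folded partial_l_def]
  show ?A
    by (rule the(1)) (simp_all add: left_eqs cotensor_sel cotensor_subset)
  show ?B
    if "x \<in> carrier X" "t \<in> carrier (Y \<otimes>\<^sup>A Z)"
    by (rule the(2) [rule_format, rotated -2, OF that]) (simp_all add: left_eqs cotensor_sel cotensor_subset)
qed

text \<open>The defining square now starts from a tensor product over \<open>A\<close>, so classes
  replace pure tensors in the test. The resulting values are those of
  \<open>partial_l\<close>.\<close>

lemma partial_l_tilde:
  shows "partial_l_tilde K A X Y Z \<in> bimod_hom K A (X \<otimes>\<^sub>A (Y \<otimes>\<^sup>A Z)) ((X \<otimes>\<^sub>A Y) \<otimes>\<^sup>A Z)" (is ?A)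
    and "\<lbrakk>x \<in> carrier X; t \<in> carrier (Y \<otimes>\<^sup>A Z)\<rbrakk> \<Longrightarrow>
      partial_l_tilde K A X Y Z (cl X (Y \<otimes>\<^sup>A Z) x t) = tensor_left Y Z (X \<otimes>\<^sub>A Y) (cl X Y) x t"
    (is "_ \<Longrightarrow> _ \<Longrightarrow> ?B")
proof -
  note W = wb_cotensor [OF XoY Z] and D = wb_tensor_field [OF XoY Z]
  note i = bimod_hom_lin [OF incl_bimod_hom [OF XoY Z]]
  note tom = tensor_over_map [OF X YcZ X YkZ bhom_idm [OF X] bimod_hom_bh [OF incl_bimod_hom [OF Y Z]]]
  have Q: "comp_on (X \<otimes>\<^sub>A (Y \<otimes>\<^sup>A Z)) (incl K A (X \<otimes>\<^sub>A Y) Z) h =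
      comp_on (X \<otimes>\<^sub>A (Y \<otimes>\<^sup>A Z)) (gamma_l_tilde K A X Y Z)
        (tensor_over_map K A X (Y \<otimes>\<^sup>A Z) X (Y \<otimes>\<^sub>K Z) (idm X) (incl K A Y Z)) \<longleftrightarrow>
    (\<forall>x\<in>carrier X. \<forall>t\<in>carrier (Y \<otimes>\<^sup>A Z).
      h (cl X (Y \<otimes>\<^sup>A Z) x t) = tensor_left Y Z (X \<otimes>\<^sub>A Y) (cl X Y) x t)"
    if h: "lin K (X \<otimes>\<^sub>A (Y \<otimes>\<^sup>A Z)) ((X \<otimes>\<^sub>A Y) \<otimes>\<^sup>A Z) h" for h
    unfolding compose_def
    by (subst tensor_over_restrict_eq_iff [OF X YcZ wbD(1) [OF D] lin_comp [OF h i]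
        lin_comp [OF bimod_hom_lin [OF tom(1)] bimod_hom_lin [OF gamma_l_tilde(1)]]])
      (simp add: tom(2) incl_apply [OF Y Z] incl_apply [OF XoY Z] cotensor_subset gamma_l_tilde(2)
        lin_closed [OF h] cl_closed [OF X YcZ])
  note the = the_tensor_over_hom [OF X YcZ W left_bilin _ _ _ Q, folded partial_l_tilde_def]
  show ?A
    by (rule the(1)) (simp_all add: left_eqs cotensor_sel cotensor_subset)
  show ?B
    if "x \<in> carrier X" "t \<in> carrier (Y \<otimes>\<^sup>A Z)"
    by (rule the(2) [rule_format, rotated -2, OF that]) (simp_all add: left_eqs cotensor_sel cotensor_subset)
qed

text \<open>Mirror image of \<open>gamma_l\<close> with the associator in place of its inverse; here
  the value of \<open>assoc_vect\<close> at an arbitrary first factor is used.\<close>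

lemma gamma_r:
  shows "gamma_r K A X Y Z \<in> bimod_hom K A ((X \<otimes>\<^sup>A Y) \<otimes>\<^sub>K Z) (X \<otimes>\<^sup>A (Y \<otimes>\<^sub>K Z))" (is ?A)
    and "\<lbrakk>s \<in> carrier (X \<otimes>\<^sup>A Y); z \<in> carrier Z\<rbrakk> \<Longrightarrow>
      gamma_r K A X Y Z (pt (X \<otimes>\<^sup>A Y) Z s z) = tensor_right X Y (Y \<otimes>\<^sub>K Z) (pt Y Z) s z"
    (is "_ \<Longrightarrow> _ \<Longrightarrow> ?B")
proof -
  note W = wb_cotensor [OF X YkZ] and D = wb_tensor_field [OF X YkZ]
  note pr = ract_pt [OF Y Z, symmetric] and pl = lact_pt [OF Y Z, symmetric]
  note v = tensor_right_bilin_cotensor [OF X Y Z YkZ ptYZ pl]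
  note i = bimod_hom_lin [OF incl_bimod_hom [OF X YkZ]] and j = bimod_hom_lin [OF incl_bimod_hom [OF X Y]]
  note tm = wbD(1) [OF XcY] L(3) wbD(1) [OF XkY] L(3) j lin_idm [OF L(3)]
  have al: "lin K ((X \<otimes>\<^sub>K Y) \<otimes>\<^sub>K Z) (X \<otimes>\<^sub>K (Y \<otimes>\<^sub>K Z)) (assoc_vect K X Y Z)"
    using assoc_vect(1) [OF X Y Z] by (simp add: linear_maps_iff)
  have Q: "comp_on ((X \<otimes>\<^sup>A Y) \<otimes>\<^sub>K Z) (incl K A X (Y \<otimes>\<^sub>K Z)) h =
      comp_on ((X \<otimes>\<^sup>A Y) \<otimes>\<^sub>K Z) (assoc_vect K X Y Z)
        (tensor_map K (X \<otimes>\<^sup>A Y) Z (X \<otimes>\<^sub>K Y) Z (incl K A X Y) (idm Z)) \<longleftrightarrow>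
    (\<forall>s\<in>carrier (X \<otimes>\<^sup>A Y). \<forall>z\<in>carrier Z.
      h (pt (X \<otimes>\<^sup>A Y) Z s z) = tensor_right X Y (Y \<otimes>\<^sub>K Z) (pt Y Z) s z)"
    if h: "lin K ((X \<otimes>\<^sup>A Y) \<otimes>\<^sub>K Z) (X \<otimes>\<^sup>A (Y \<otimes>\<^sub>K Z)) h" for h
    unfolding compose_def
    by (subst tensor_field_restrict_eq_iff [OF wbD(1) [OF XcY] L(3) wbD(1) [OF D] lin_comp [OF h i]
        lin_comp [OF tensor_map_lin [OF tm] al]])
      (simp add: tensor_map_pure [OF tm] incl_apply [OF X Y] incl_apply [OF X YkZ] cotensor_subset
        assoc_vect(2) [OF X Y Z] lin_closed [OF h] pt_closed L wbD(1) [OF XcY])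
  note the = the_tensor_field_hom [OF XcY Z W v _ _ Q, folded gamma_r_def]
  note eqs = tensor_right_ract [OF X Y Z YkZ ptYZ pr] tensor_right_lact [OF X Y Z YkZ ptYZ]
  show ?A
    by (rule the(1)) (simp_all add: cotensor_sel eqs cotensor_subset)
  show ?B
    if "s \<in> carrier (X \<otimes>\<^sup>A Y)" "z \<in> carrier Z"
    by (rule the(2) [rule_format, rotated -2, OF that]) (simp_all add: cotensor_sel eqs cotensor_subset)
qed

private lemmas right_eqs = tensor_right_ract [OF X Y Z YoZ clYZ ract_cl [OF Y Z, symmetric]]
  tensor_right_lact [OF X Y Z YoZ clYZ] tensor_right_balanced [OF X Y Z YoZ clYZ cl_balanced [OF Y Z]]

private lemmas right_bilin = tensor_right_bilin_cotensor [OF X Y Z YoZ clYZ lact_cl [OF Y Z, symmetric]]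

text \<open>The projection follows the associator, turning \<open>tensor_right\<close> for the pure
  tensor into \<open>tensor_right\<close> for the class, whose balancedness gives the descent in the
  first factor.\<close>

lemma gamma_r_tilde:
  shows "gamma_r_tilde K A X Y Z \<in> bimod_hom K A ((X \<otimes>\<^sub>K Y) \<otimes>\<^sub>A Z) (X \<otimes>\<^sub>K (Y \<otimes>\<^sub>A Z))" (is ?A)
    and "\<lbrakk>s \<in> carrier (X \<otimes>\<^sub>K Y); z \<in> carrier Z\<rbrakk> \<Longrightarrow>
      gamma_r_tilde K A X Y Z (cl (X \<otimes>\<^sub>K Y) Z s z) = tensor_right X Y (Y \<otimes>\<^sub>A Z) (cl Y Z) s z"
    (is "_ \<Longrightarrow> _ \<Longrightarrow> ?B")
proof -
  note W = wb_tensor_field [OF X YoZ]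
  note v = tensor_right_bilin [OF L wbD(1) [OF YoZ] clYZ]
  note tm = L(1) wbD(1) [OF YkZ] L(1) wbD(1) [OF YoZ] lin_idm [OF L(1)] proj_lin [OF Y Z]
  have al: "lin K ((X \<otimes>\<^sub>K Y) \<otimes>\<^sub>K Z) (X \<otimes>\<^sub>K (Y \<otimes>\<^sub>K Z)) (assoc_vect K X Y Z)"
    using assoc_vect(1) [OF X Y Z] by (simp add: linear_maps_iff)
  have Q: "comp_on ((X \<otimes>\<^sub>K Y) \<otimes>\<^sub>K Z) h (proj K A (X \<otimes>\<^sub>K Y) Z) =
      comp_on ((X \<otimes>\<^sub>K Y) \<otimes>\<^sub>K Z)
        (tensor_map K X (Y \<otimes>\<^sub>K Z) X (Y \<otimes>\<^sub>A Z) (idm X) (proj K A Y Z)) (assoc_vect K X Y Z) \<longleftrightarrow>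
    (\<forall>s\<in>carrier (X \<otimes>\<^sub>K Y). \<forall>z\<in>carrier Z.
      h (cl (X \<otimes>\<^sub>K Y) Z s z) = tensor_right X Y (Y \<otimes>\<^sub>A Z) (cl Y Z) s z)"
    if h: "lin K ((X \<otimes>\<^sub>K Y) \<otimes>\<^sub>A Z) (X \<otimes>\<^sub>K (Y \<otimes>\<^sub>A Z)) h" for h
    unfolding compose_def
    by (subst tensor_field_restrict_eq_iff [OF wbD(1) [OF XkY] L(3) wbD(1) [OF W]
        lin_comp [OF proj_lin [OF XkY Z] h] lin_comp [OF al tensor_map_lin [OF tm]]])
      (simp add: assoc_vect(2) [OF X Y Z] tensor_class_def [symmetric] proj_pt
        tensor_right_post [OF X Y Z YkZ ptYZ wbD(1) [OF YoZ] proj_lin [OF Y Z]])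
  note the = the_tensor_over_hom [OF XkY Z W v _ _ _ Q, folded gamma_r_tilde_def]
  show ?A
    by (rule the(1)) (simp_all add: right_eqs)
  show ?B
    if "s \<in> carrier (X \<otimes>\<^sub>K Y)" "z \<in> carrier Z"
    by (rule the(2) [rule_format, rotated -2, OF that]) (simp_all add: right_eqs)
qed

lemma partial_r:
  shows "partial_r K A X Y Z \<in> bimod_hom K A ((X \<otimes>\<^sup>A Y) \<otimes>\<^sub>A Z) (X \<otimes>\<^sup>A (Y \<otimes>\<^sub>A Z))" (is ?A)
    and "\<lbrakk>s \<in> carrier (X \<otimes>\<^sup>A Y); z \<in> carrier Z\<rbrakk> \<Longrightarrow>
      partial_r K A X Y Z (cl (X \<otimes>\<^sup>A Y) Z s z) = tensor_right X Y (Y \<otimes>\<^sub>A Z) (cl Y Z) s z"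
    (is "_ \<Longrightarrow> _ \<Longrightarrow> ?B")
proof -
  note W = wb_cotensor [OF X YoZ] and D = wb_tensor_field [OF X YoZ]
  note tm = L(1) wbD(1) [OF YkZ] L(1) wbD(1) [OF YoZ] lin_idm [OF L(1)] proj_lin [OF Y Z]
  \<comment> \<open>As on the left, the codomain is enlarged to the ambient tensor product so that
    the square becomes a comparison of linear maps.\<close>
  have cm: "lin K (X \<otimes>\<^sup>A (Y \<otimes>\<^sub>K Z)) (X \<otimes>\<^sub>K (Y \<otimes>\<^sub>A Z))
      (cotensor_map K A X (Y \<otimes>\<^sub>K Z) X (Y \<otimes>\<^sub>A Z) (idm X) (proj K A Y Z))"
    by (simp add: cotensor_map_def lin_restrict cotensor_module [OF X YkZ]
      lin_from_cotensor [OF X YkZ] tensor_map_lin [OF tm])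
  note g = bimod_hom_lin [OF gamma_r(1)]
  have Q: "comp_on ((X \<otimes>\<^sup>A Y) \<otimes>\<^sub>K Z) h (proj K A (X \<otimes>\<^sup>A Y) Z) =
      comp_on ((X \<otimes>\<^sup>A Y) \<otimes>\<^sub>K Z)
        (cotensor_map K A X (Y \<otimes>\<^sub>K Z) X (Y \<otimes>\<^sub>A Z) (idm X) (proj K A Y Z)) (gamma_r K A X Y Z) \<longleftrightarrow>
    (\<forall>s\<in>carrier (X \<otimes>\<^sup>A Y). \<forall>z\<in>carrier Z.
      h (cl (X \<otimes>\<^sup>A Y) Z s z) = tensor_right X Y (Y \<otimes>\<^sub>A Z) (cl Y Z) s z)"
    if h: "lin K ((X \<otimes>\<^sup>A Y) \<otimes>\<^sub>A Z) (X \<otimes>\<^sup>A (Y \<otimes>\<^sub>A Z)) h" for h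
    unfolding compose_def
    by (subst tensor_field_restrict_eq_iff [OF wbD(1) [OF XcY] L(3) wbD(1) [OF D]
        lin_comp [OF proj_lin [OF XcY Z] lin_cotensor_weaken [OF X YoZ h]] lin_comp [OF g cm]])
      (simp add: gamma_r(2) cotensor_map_def tensor_right_cotensor [OF X Y Z YkZ ptYZ lact_pt [OF Y Z, symmetric]]
        tensor_class_def [symmetric] proj_pt cotensor_subset
        tensor_right_post [OF X Y Z YkZ ptYZ wbD(1) [OF YoZ] proj_lin [OF Y Z]])
  note the = the_tensor_over_hom [OF XcY Z W right_bilin _ _ _ Q, folded partial_r_def]
  show ?A
    by (rule the(1)) (simp_all add: right_eqs cotensor_sel cotensor_subset)
  show ?B
    if "s \<in> carrier (X \<otimes>\<^sup>A Y)" "z \<in> carrier Z"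
    by (rule the(2) [rule_format, rotated -2, OF that]) (simp_all add: right_eqs cotensor_sel cotensor_subset)
qed

lemma partial_r_tilde:
  shows "partial_r_tilde K A X Y Z \<in> bimod_hom K A ((X \<otimes>\<^sup>A Y) \<otimes>\<^sub>A Z) (X \<otimes>\<^sup>A (Y \<otimes>\<^sub>A Z))" (is ?A)
    and "\<lbrakk>s \<in> carrier (X \<otimes>\<^sup>A Y); z \<in> carrier Z\<rbrakk> \<Longrightarrow>
      partial_r_tilde K A X Y Z (cl (X \<otimes>\<^sup>A Y) Z s z) = tensor_right X Y (Y \<otimes>\<^sub>A Z) (cl Y Z) s z"
    (is "_ \<Longrightarrow> _ \<Longrightarrow> ?B")
proof -
  note W = wb_cotensor [OF X YoZ] and D = wb_tensor_field [OF X YoZ]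
  note i = bimod_hom_lin [OF incl_bimod_hom [OF X YoZ]]
  note tom = tensor_over_map [OF XcY Z XkY Z bimod_hom_bh [OF incl_bimod_hom [OF X Y]] bhom_idm [OF Z]]
  have Q: "comp_on ((X \<otimes>\<^sup>A Y) \<otimes>\<^sub>A Z) (incl K A X (Y \<otimes>\<^sub>A Z)) h =
      comp_on ((X \<otimes>\<^sup>A Y) \<otimes>\<^sub>A Z) (gamma_r_tilde K A X Y Z)
        (tensor_over_map K A (X \<otimes>\<^sup>A Y) Z (X \<otimes>\<^sub>K Y) Z (incl K A X Y) (idm Z)) \<longleftrightarrow>
    (\<forall>s\<in>carrier (X \<otimes>\<^sup>A Y). \<forall>z\<in>carrier Z.
      h (cl (X \<otimes>\<^sup>A Y) Z s z) = tensor_right X Y (Y \<otimes>\<^sub>A Z) (cl Y Z) s z)"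
    if h: "lin K ((X \<otimes>\<^sup>A Y) \<otimes>\<^sub>A Z) (X \<otimes>\<^sup>A (Y \<otimes>\<^sub>A Z)) h" for h
    unfolding compose_def
    by (subst tensor_over_restrict_eq_iff [OF XcY Z wbD(1) [OF D] lin_comp [OF h i]
        lin_comp [OF bimod_hom_lin [OF tom(1)] bimod_hom_lin [OF gamma_r_tilde(1)]]])
      (simp add: tom(2) incl_apply [OF X Y] incl_apply [OF X YoZ] cotensor_subset gamma_r_tilde(2)
        lin_closed [OF h] cl_closed [OF XcY Z])
  note the = the_tensor_over_hom [OF XcY Z W right_bilin _ _ _ Q, folded partial_r_tilde_def]
  show ?A
    by (rule the(1)) (simp_all add: right_eqs cotensor_sel cotensor_subset)
  show ?B
    if "s \<in> carrier (X \<otimes>\<^sup>A Y)" "z \<in> carrier Z"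
    by (rule the(2) [rule_format, rotated -2, OF that]) (simp_all add: right_eqs cotensor_sel cotensor_subset)
qed

end

section \<open>Internal Homs and the lax structures\<close>

lemma lin_hom_sel:
  "carrier (lin_hom K M N) = linear_maps K M N"
  "\<zero>\<^bsub>lin_hom K M N\<^esub> = (\<lambda>x\<in>carrier M. \<zero>\<^bsub>N\<^esub>)"
  "f \<oplus>\<^bsub>lin_hom K M N\<^esub> g = (\<lambda>x\<in>carrier M. f x \<oplus>\<^bsub>N\<^esub> g x)"
  "c \<odot>\<^bsub>lin_hom K M N\<^esub> f = (\<lambda>x\<in>carrier M. c \<odot>\<^bsub>N\<^esub> f x)"
  by (simp_all add: lin_hom_def)

lemma linear_maps_closed: "\<lbrakk>f \<in> linear_maps K M N; x \<in> carrier M\<rbrakk> \<Longrightarrow> f x \<in> carrier N"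
  by (auto simp: linear_maps_iff lin_closed)

lemma restrict_linear_maps: "\<lbrakk>module K M; lin K M N f\<rbrakk> \<Longrightarrow> restrict f (carrier M) \<in> linear_maps K M N"
  by (simp add: linear_maps_iff lin_restrict)

lemma lin_hom_module:
  assumes M: "module K M" and N: "module K N"
  shows "module K (lin_hom K M N)"
proof -
  interpret M: module K M by (rule M)
  interpret N: module K N by (rule N)
  note c = linear_maps_closed
  have add: "f \<oplus>\<^bsub>lin_hom K M N\<^esub> g \<in> linear_maps K M N"
    if "f \<in> linear_maps K M N" "g \<in> linear_maps K M N" for f g
    using that by (simp add: lin_hom_sel linear_maps_iff lin_restrict M lin_plus N)
  have smult: "d \<odot>\<^bsub>lin_hom K M N\<^esub> f \<in> linear_maps K M N"
    if "d \<in> carrier K" "f \<in> linear_maps K M N" for d f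
    using that by (simp add: lin_hom_sel linear_maps_iff lin_restrict M lin_scale N)
  have zero: "\<zero>\<^bsub>lin_hom K M N\<^esub> \<in> linear_maps K M N"
    by (simp add: lin_hom_sel linear_maps_iff lin_restrict M lin_const_zero N)
  show ?thesis
  proof (rule moduleI)
    show "abelian_group (lin_hom K M N)"
    proof (rule abelian_groupI)
      fix f assume "f \<in> carrier (lin_hom K M N)"
      then have f: "f \<in> linear_maps K M N" by (simp add: lin_hom_sel)
      \<comment> \<open>The record of \<open>lin_hom\<close> carries no negation, so the additive
        inverse is exhibited as a scalar multiple.\<close>
      have "(\<ominus>\<^bsub>K\<^esub> \<one>\<^bsub>K\<^esub>) \<odot>\<^bsub>lin_hom K M N\<^esub> f \<oplus>\<^bsub>lin_hom K M N\<^esub> f = \<zero>\<^bsub>lin_hom K M N\<^esub>"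
        by (rule linear_maps_ext [of _ M N])
          (simp_all add: add smult zero f, simp add: lin_hom_sel c [OF f] N.smult_l_minus N.l_neg)
      then show "\<exists>g\<in>carrier (lin_hom K M N). g \<oplus>\<^bsub>lin_hom K M N\<^esub> f = \<zero>\<^bsub>lin_hom K M N\<^esub>"
        using smult [OF _ f] by (auto simp: lin_hom_sel(1) intro!: bexI [of _ "(\<ominus>\<^bsub>K\<^esub> \<one>\<^bsub>K\<^esub>) \<odot>\<^bsub>lin_hom K M N\<^esub> f"])
      show "\<zero>\<^bsub>lin_hom K M N\<^esub> \<oplus>\<^bsub>lin_hom K M N\<^esub> f = f"
        by (rule linear_maps_ext [of _ M N]) (simp_all add: add zero f, simp add: lin_hom_sel c [OF f])
    qed (use add zero in \<open>auto simp: lin_hom_sel c [of _ M N] N.a_ac intro!: restrict_ext\<close>)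
  next
    fix f assume "f \<in> carrier (lin_hom K M N)"
    then show "\<one>\<^bsub>K\<^esub> \<odot>\<^bsub>lin_hom K M N\<^esub> f = f"
      by (intro linear_maps_ext [of _ M N]) (simp_all add: lin_hom_sel smult [unfolded lin_hom_sel] c)
  qed (use smult in \<open>auto simp: lin_hom_sel c [of _ M N] M.is_cring N.smult_l_distr N.smult_r_distr N.smult_assoc1
      intro!: restrict_ext\<close>)
qed

text \<open>Closure under negation follows from closure under scalars, applied to minus one.\<close>

lemma submodule_closedI:
  assumes M: "module K M" and "H \<subseteq> carrier M" "\<zero>\<^bsub>M\<^esub> \<in> H"
    and "\<And>x y. \<lbrakk>x \<in> H; y \<in> H\<rbrakk> \<Longrightarrow> x \<oplus>\<^bsub>M\<^esub> y \<in> H"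
    and smult: "\<And>c x. \<lbrakk>c \<in> carrier K; x \<in> H\<rbrakk> \<Longrightarrow> c \<odot>\<^bsub>M\<^esub> x \<in> H"
  shows "submodule H K M"
proof -
  interpret M: module K M by (rule M)
  have "\<ominus>\<^bsub>M\<^esub> x \<in> H" if "x \<in> H" for x
    using smult [of "\<ominus>\<^bsub>K\<^esub> \<one>\<^bsub>K\<^esub>" x] that assms(2) by (auto simp: M.smult_l_minus subset_iff)
  then show ?thesis using assms by (intro M.submoduleI)
qed

lemma hom_r_sel:
  "carrier (hom_r K A Z Y) = {f \<in> linear_maps K Z Y. \<forall>a\<in>carrier A. \<forall>z\<in>carrier Z. f (ract Z z a) = ract Y (f z) a}"
  "\<zero>\<^bsub>hom_r K A Z Y\<^esub> = (\<lambda>z\<in>carrier Z. \<zero>\<^bsub>Y\<^esub>)"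
  "f \<oplus>\<^bsub>hom_r K A Z Y\<^esub> g = (\<lambda>z\<in>carrier Z. f z \<oplus>\<^bsub>Y\<^esub> g z)"
  "c \<odot>\<^bsub>hom_r K A Z Y\<^esub> f = (\<lambda>z\<in>carrier Z. c \<odot>\<^bsub>Y\<^esub> f z)"
  "lact (hom_r K A Z Y) a f = (\<lambda>z\<in>carrier Z. lact Y a (f z))"
  "ract (hom_r K A Z Y) f a = (\<lambda>z\<in>carrier Z. f (lact Z a z))"
  by (simp_all add: hom_r_def module.defs bimodule.defs lin_hom_def)

lemma hom_l_sel:
  "carrier (hom_l K A Z Y) = {f \<in> linear_maps K Z Y. \<forall>a\<in>carrier A. \<forall>z\<in>carrier Z. f (lact Z a z) = lact Y a (f z)}"
  "\<zero>\<^bsub>hom_l K A Z Y\<^esub> = (\<lambda>z\<in>carrier Z. \<zero>\<^bsub>Y\<^esub>)"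
  "f \<oplus>\<^bsub>hom_l K A Z Y\<^esub> g = (\<lambda>z\<in>carrier Z. f z \<oplus>\<^bsub>Y\<^esub> g z)"
  "c \<odot>\<^bsub>hom_l K A Z Y\<^esub> f = (\<lambda>z\<in>carrier Z. c \<odot>\<^bsub>Y\<^esub> f z)"
  "lact (hom_l K A Z Y) a f = (\<lambda>z\<in>carrier Z. f (ract Z z a))"
  "ract (hom_l K A Z Y) f a = (\<lambda>z\<in>carrier Z. ract Y (f z) a)"
  by (simp_all add: hom_l_def module.defs bimodule.defs lin_hom_def)

context
  fixes Z :: "('a, 'k, 'z) bimodule" and Y :: "('a, 'k, 'y) bimodule"
  assumes Z: "wb Z" and Y: "wb Y"
begin

private lemmas ZY = wbD(1) [OF Z] wbD(1) [OF Y]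

interpretation HZ: module K Z by (rule ZY)
interpretation HY: module K Y by (rule ZY)

text \<open>\<open>p\<close> and \<open>q\<close> stand for the action of \<open>a\<close> on
  \<open>Z\<close> and on \<open>Y\<close>, taken from the same side; the two choices of side give
  \<open>hom_r\<close> and \<open>hom_l\<close>.\<close>

lemma intertwiner_submodule:
  assumes p: "\<And>a z. \<lbrakk>a \<in> carrier A; z \<in> carrier Z\<rbrakk> \<Longrightarrow> p a z \<in> carrier Z"
    and q: "\<And>a. a \<in> carrier A \<Longrightarrow> lin K Y Y (q a)"
  shows "submodule {f \<in> linear_maps K Z Y. \<forall>a\<in>carrier A. \<forall>z\<in>carrier Z. f (p a z) = q a (f z)} K (lin_hom K Z Y)"
    (is "submodule ?H K ?L")
proof (rule submodule_closedI [OF lin_hom_module [OF ZY]])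
  interpret L: module K ?L by (rule lin_hom_module [OF ZY])
  show "\<zero>\<^bsub>?L\<^esub> \<in> ?H"
    using L.zero_closed lin_zero [OF ZY(2,2) q] by (auto simp: lin_hom_sel p)
  show "f \<oplus>\<^bsub>?L\<^esub> g \<in> ?H" if "f \<in> ?H" "g \<in> ?H" for f g
    using that L.a_closed [of f g] by (simp add: lin_hom_sel p linear_maps_closed [of _ Z Y] lin_add [OF q])
  show "c \<odot>\<^bsub>?L\<^esub> f \<in> ?H" if "c \<in> carrier K" "f \<in> ?H" for c f
    using that L.smult_closed [of c f] by (simp add: lin_hom_sel p linear_maps_closed [of _ Z Y] lin_smult [OF q])
qed (auto simp: lin_hom_sel)

private lemmas intertwiner_module =
  submodule.submodule_is_module [OF intertwiner_submodule lin_hom_module [OF ZY]]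

lemma hom_r_module: "module K (hom_r K A Z Y)"
  by (rule module_cong [OF intertwiner_module [of "\<lambda>a z. ract Z z a" "\<lambda>a y. ract Y y a"]])
    (simp_all add: wbD(3) [OF Y] wbD(5) [OF Z] hom_r_sel lin_hom_sel)

lemma hom_l_module: "module K (hom_l K A Z Y)"
  by (rule module_cong [OF intertwiner_module [of "lact Z" "lact Y"]])
    (simp_all add: wbD(2) [OF Y] wbD(4) [OF Z] hom_l_sel lin_hom_sel)

lemma hom_rD:
  assumes "f \<in> carrier (hom_r K A Z Y)"
  shows "lin K Z Y f" "f \<in> linear_maps K Z Y"
    "\<lbrakk>a \<in> carrier A; z \<in> carrier Z\<rbrakk> \<Longrightarrow> f (ract Z z a) = ract Y (f z) a"
    "z \<in> carrier Z \<Longrightarrow> f z \<in> carrier Y"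
  using assms by (auto simp: hom_r_sel linear_maps_iff lin_closed)

lemma hom_lD:
  assumes "f \<in> carrier (hom_l K A Z Y)"
  shows "lin K Z Y f" "f \<in> linear_maps K Z Y"
    "\<lbrakk>a \<in> carrier A; z \<in> carrier Z\<rbrakk> \<Longrightarrow> f (lact Z a z) = lact Y a (f z)"
    "z \<in> carrier Z \<Longrightarrow> f z \<in> carrier Y"
  using assms by (auto simp: hom_l_sel linear_maps_iff lin_closed)

lemma hom_rI:
  assumes "lin K Z Y f" "\<And>a z. \<lbrakk>a \<in> carrier A; z \<in> carrier Z\<rbrakk> \<Longrightarrow> f (ract Z z a) = ract Y (f z) a"
  shows "restrict f (carrier Z) \<in> carrier (hom_r K A Z Y)"
  using assms by (simp add: hom_r_sel restrict_linear_maps ZY wbD(5) [OF Z])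

lemma hom_lI:
  assumes "lin K Z Y f" "\<And>a z. \<lbrakk>a \<in> carrier A; z \<in> carrier Z\<rbrakk> \<Longrightarrow> f (lact Z a z) = lact Y a (f z)"
  shows "restrict f (carrier Z) \<in> carrier (hom_l K A Z Y)"
  using assms by (simp add: hom_l_sel restrict_linear_maps ZY wbD(4) [OF Z])

text \<open>Acting on values from the left preserves right linearity because the actions on
  \<open>Y\<close> commute; acting on arguments preserves it because those on \<open>Z\<close>
  commute.\<close>

lemma wb_hom_r: "wb (hom_r K A Z Y)"
proof (rule weak_bimodule.intro)
  show "module K (hom_r K A Z Y)" by (rule hom_r_module)
  fix a assume a: "a \<in> carrier A"
  show "lin K (hom_r K A Z Y) (hom_r K A Z Y) (lact (hom_r K A Z Y) a)"
  proof (rule linI)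
    fix f assume f: "f \<in> carrier (hom_r K A Z Y)"
    show "lact (hom_r K A Z Y) a f \<in> carrier (hom_r K A Z Y)"
      unfolding hom_r_sel(5) by (rule hom_rI) (simp_all add: lin_comp [OF hom_rD(1) [OF f] wbD(2) [OF Y a]]
        hom_rD [OF f] a wbD(6) [OF Y])
  qed (auto simp: hom_r_sel(3-) a dest: hom_rD(4) intro!: restrict_ext
      lin_add [OF wbD(2) [OF Y a]] lin_smult [OF wbD(2) [OF Y a]])
  show "lin K (hom_r K A Z Y) (hom_r K A Z Y) (\<lambda>f. ract (hom_r K A Z Y) f a)"
  proof (rule linI)
    fix f assume f: "f \<in> carrier (hom_r K A Z Y)"
    show "ract (hom_r K A Z Y) f a \<in> carrier (hom_r K A Z Y)"
      unfolding hom_r_sel(6) by (rule hom_rI) (simp_all add: lin_comp [OF wbD(2) [OF Z a] hom_rD(1) [OF f]]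
        hom_rD [OF f] a wbD(4) [OF Z] wbD(6) [OF Z, symmetric])
  qed (auto simp: hom_r_sel(3-) a wbD(4) [OF Z] intro!: restrict_ext)
  fix b f assume "b \<in> carrier A" "f \<in> carrier (hom_r K A Z Y)"
  then show "ract (hom_r K A Z Y) (lact (hom_r K A Z Y) a f) b = lact (hom_r K A Z Y) a (ract (hom_r K A Z Y) f b)"
    by (auto simp: hom_r_sel(5,6) wbD(4) [OF Z] intro!: restrict_ext)
qed

lemma wb_hom_l: "wb (hom_l K A Z Y)"
proof (rule weak_bimodule.intro)
  show "module K (hom_l K A Z Y)" by (rule hom_l_module)
  fix a assume a: "a \<in> carrier A"
  show "lin K (hom_l K A Z Y) (hom_l K A Z Y) (\<lambda>f. ract (hom_l K A Z Y) f a)"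
  proof (rule linI)
    fix f assume f: "f \<in> carrier (hom_l K A Z Y)"
    show "ract (hom_l K A Z Y) f a \<in> carrier (hom_l K A Z Y)"
      unfolding hom_l_sel(6) by (rule hom_lI) (simp_all add: lin_comp [OF hom_lD(1) [OF f] wbD(3) [OF Y a]]
        hom_lD [OF f] a wbD(6) [OF Y])
  qed (auto simp: hom_l_sel(3-) a dest: hom_lD(4) intro!: restrict_ext
      lin_add [OF wbD(3) [OF Y a]] lin_smult [OF wbD(3) [OF Y a]])
  show "lin K (hom_l K A Z Y) (hom_l K A Z Y) (lact (hom_l K A Z Y) a)"
  proof (rule linI)
    fix f assume f: "f \<in> carrier (hom_l K A Z Y)"
    show "lact (hom_l K A Z Y) a f \<in> carrier (hom_l K A Z Y)"
      unfolding hom_l_sel(5) by (rule hom_lI) (simp_all add: lin_comp [OF wbD(3) [OF Z a] hom_lD(1) [OF f]]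
        hom_lD [OF f] a wbD(5) [OF Z] wbD(6) [OF Z])
  qed (auto simp: hom_l_sel(3-) a wbD(5) [OF Z] intro!: restrict_ext)
  fix b f assume "b \<in> carrier A" "f \<in> carrier (hom_l K A Z Y)"
  then show "ract (hom_l K A Z Y) (lact (hom_l K A Z Y) a f) b = lact (hom_l K A Z Y) a (ract (hom_l K A Z Y) f b)"
    by (auto simp: hom_l_sel(5,6) wbD(5) [OF Z] a intro!: restrict_ext)
qed

text \<open>Balancedness holds by the definition of the right action on \<open>hom_r\<close>, left
  linearity by that of its left action, and right linearity because the elements of
  \<open>hom_r\<close> are right linear.\<close>

lemma eval_r:
  shows "eval_r K A Z Y \<in> bimod_hom K A (hom_r K A Z Y \<otimes>\<^sub>A Z) Y" (is ?A)
    and "\<lbrakk>f \<in> carrier (hom_r K A Z Y); z \<in> carrier Z\<rbrakk> \<Longrightarrow> eval_r K A Z Y (cl (hom_r K A Z Y) Z f z) = f z"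
proof -
  have v: "bilin K (hom_r K A Z Y) Z Y (\<lambda>f z. f z)"
    by (intro bilinI linI) (simp_all add: hom_rD lin_add [OF hom_rD(1)] lin_smult [OF hom_rD(1)] hom_r_sel(3,4))
  note s = hom_r_sel(5,6) hom_rD
  show ?A
    unfolding eval_r_def by (rule the_tensor_over_hom(1) [OF wb_hom_r Z Y v]) (simp_all add: s)
  show "eval_r K A Z Y (cl (hom_r K A Z Y) Z f z) = f z" if "f \<in> carrier (hom_r K A Z Y)" "z \<in> carrier Z"
    unfolding eval_r_def by (rule the_tensor_over_hom(2) [OF wb_hom_r Z Y v, rule_format, rotated -2, OF that])
      (simp_all add: s)
qed

lemma eval_l:
  shows "eval_l K A Z Y \<in> bimod_hom K A (Z \<otimes>\<^sub>A hom_l K A Z Y) Y" (is ?A)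
    and "\<lbrakk>z \<in> carrier Z; f \<in> carrier (hom_l K A Z Y)\<rbrakk> \<Longrightarrow> eval_l K A Z Y (cl Z (hom_l K A Z Y) z f) = f z"
proof -
  have v: "bilin K Z (hom_l K A Z Y) Y (\<lambda>z f. f z)"
    by (intro bilinI linI) (simp_all add: hom_lD lin_add [OF hom_lD(1)] lin_smult [OF hom_lD(1)] hom_l_sel(3,4))
  note s = hom_l_sel(5,6) hom_lD
  show ?A
    unfolding eval_l_def by (rule the_tensor_over_hom(1) [OF Z wb_hom_l Y v]) (simp_all add: s)
  show "eval_l K A Z Y (cl Z (hom_l K A Z Y) z f) = f z" if "z \<in> carrier Z" "f \<in> carrier (hom_l K A Z Y)"
    unfolding eval_l_def by (rule the_tensor_over_hom(2) [OF Z wb_hom_l Y v, rule_format, rotated -2, OF that])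
      (simp_all add: s)
qed

end

lemma bimod_hom_compose:
  assumes "wb M" "f \<in> bimod_hom K A M N" "g \<in> bimod_hom K A N P"
  shows "comp_on M g f \<in> bimod_hom K A M P"
proof -
  note f = bimod_hom_bh [OF assms(2)] and g = bimod_hom_bh [OF assms(3)]
  have "lin K M P (comp_on M g f)"
    unfolding compose_def using lin_comp [OF bhomD(1) [OF f] bhomD(1) [OF g]] by (simp add: lin_restrict wbD(1) [OF assms(1)])
  then show ?thesis
    unfolding bimod_hom_iff
    by (auto simp: compose_eq bhomD [OF f] bhomD [OF g] lin_closed [OF bhomD(1) [OF f]] wbD [OF assms(1)] intro!: bhomI)
qed

section \<open>Maps out of triple tensor products and the associator over \<open>A\<close>\<close>

context
  fixes X :: "('a, 'k, 'x) bimodule" and Y :: "('a, 'k, 'y) bimodule" and Z :: "('a, 'k, 'z) bimodule"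
  assumes X: "wb X" and Y: "wb Y" and Z: "wb Z"
begin

private lemmas XYo = wb_tensor_over [OF X Y] and YZo = wb_tensor_over [OF Y Z]

lemma tensor_over_ext3_left:
  assumes W: "module K W" and f: "lin K ((X \<otimes>\<^sub>A Y) \<otimes>\<^sub>A Z) W f" and g: "lin K ((X \<otimes>\<^sub>A Y) \<otimes>\<^sub>A Z) W g"
    and eq: "\<And>x y z. \<lbrakk>x \<in> carrier X; y \<in> carrier Y; z \<in> carrier Z\<rbrakk> \<Longrightarrow>
      f (cl (X \<otimes>\<^sub>A Y) Z (cl X Y x y) z) = g (cl (X \<otimes>\<^sub>A Y) Z (cl X Y x y) z)"
    and u: "u \<in> carrier ((X \<otimes>\<^sub>A Y) \<otimes>\<^sub>A Z)"
  shows "f u = g u"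
proof (rule tensor_over_ext [OF XYo Z W f g _ u])
  fix s z assume s: "s \<in> carrier (X \<otimes>\<^sub>A Y)" and z: "z \<in> carrier Z"
  note c = bilinD(2) [OF cl_bilin [OF XYo Z] z]
  show "f (cl (X \<otimes>\<^sub>A Y) Z s z) = g (cl (X \<otimes>\<^sub>A Y) Z s z)"
    by (rule tensor_over_ext [OF X Y W lin_comp [OF c f] lin_comp [OF c g] _ s]) (simp add: eq z)
qed

lemma tensor_over_ext3_right:
  assumes W: "module K W" and f: "lin K (X \<otimes>\<^sub>A (Y \<otimes>\<^sub>A Z)) W f" and g: "lin K (X \<otimes>\<^sub>A (Y \<otimes>\<^sub>A Z)) W g"
    and eq: "\<And>x y z. \<lbrakk>x \<in> carrier X; y \<in> carrier Y; z \<in> carrier Z\<rbrakk> \<Longrightarrow>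
      f (cl X (Y \<otimes>\<^sub>A Z) x (cl Y Z y z)) = g (cl X (Y \<otimes>\<^sub>A Z) x (cl Y Z y z))"
    and u: "u \<in> carrier (X \<otimes>\<^sub>A (Y \<otimes>\<^sub>A Z))"
  shows "f u = g u"
proof (rule tensor_over_ext [OF X YZo W f g _ u])
  fix x t assume x: "x \<in> carrier X" and t: "t \<in> carrier (Y \<otimes>\<^sub>A Z)"
  note c = bilinD(1) [OF cl_bilin [OF X YZo] x]
  show "f (cl X (Y \<otimes>\<^sub>A Z) x t) = g (cl X (Y \<otimes>\<^sub>A Z) x t)"
    by (rule tensor_over_ext [OF Y Z W lin_comp [OF c f] lin_comp [OF c g] eq [OF x] t])
qed

context
  fixes W :: "('k, 'w, 'm) module_scheme" and c :: "'x \<Rightarrow> 'y \<Rightarrow> 'z \<Rightarrow> 'w"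
  assumes W: "module K W"
    and c1: "\<And>y z. \<lbrakk>y \<in> carrier Y; z \<in> carrier Z\<rbrakk> \<Longrightarrow> lin K X W (\<lambda>x. c x y z)"
    and c2: "\<And>x z. \<lbrakk>x \<in> carrier X; z \<in> carrier Z\<rbrakk> \<Longrightarrow> lin K Y W (\<lambda>y. c x y z)"
    and c3: "\<And>x y. \<lbrakk>x \<in> carrier X; y \<in> carrier Y\<rbrakk> \<Longrightarrow> lin K Z W (\<lambda>z. c x y z)"
    and bal1: "\<And>x a y z. \<lbrakk>x \<in> carrier X; a \<in> carrier A; y \<in> carrier Y; z \<in> carrier Z\<rbrakk> \<Longrightarrow>
      c (ract X x a) y z = c x (lact Y a y) z"
    and bal2: "\<And>x y a z. \<lbrakk>x \<in> carrier X; y \<in> carrier Y; a \<in> carrier A; z \<in> carrier Z\<rbrakk> \<Longrightarrow>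
      c x (ract Y y a) z = c x y (lact Z a z)"
begin

interpretation LX: module K X by (rule wbD(1) [OF X])
interpretation LZ: module K Z by (rule wbD(1) [OF Z])

text \<open>For each fixed \<open>z\<close> the trilinear map lifts to a linear map on
  \<open>X \<otimes>\<^sub>A Y\<close>. Uniqueness of these lifts makes them depend linearly on
  \<open>z\<close>, after which a second lift is possible.\<close>

lemma tensor_over_lift3_left:
  "\<exists>h. h \<in> linear_maps K ((X \<otimes>\<^sub>A Y) \<otimes>\<^sub>A Z) W \<and> lin K ((X \<otimes>\<^sub>A Y) \<otimes>\<^sub>A Z) W h \<and>
    (\<forall>x\<in>carrier X. \<forall>y\<in>carrier Y. \<forall>z\<in>carrier Z. h (cl (X \<otimes>\<^sub>A Y) Z (cl X Y x y) z) = c x y z)"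
proof -
  have "\<exists>q. lin K (X \<otimes>\<^sub>A Y) W q \<and> (\<forall>x\<in>carrier X. \<forall>y\<in>carrier Y. q (cl X Y x y) = c x y z)"
    if z: "z \<in> carrier Z" for z
    using tensor_over_lift [OF X Y W bilinI [of X K Y W "\<lambda>x y. c x y z", OF c2 [OF _ z] c1 [OF _ z]] bal1 [OF _ _ _ z]] by blast
  then obtain q where q: "\<And>z. z \<in> carrier Z \<Longrightarrow> lin K (X \<otimes>\<^sub>A Y) W (q z)"
    and qc: "\<And>x y z. \<lbrakk>x \<in> carrier X; y \<in> carrier Y; z \<in> carrier Z\<rbrakk> \<Longrightarrow> q z (cl X Y x y) = c x y z"
    by metis
  have "bilin K (X \<otimes>\<^sub>A Y) Z W (\<lambda>s z. q z s)"
  proof (rule bilinI)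
    fix s assume s: "s \<in> carrier (X \<otimes>\<^sub>A Y)"
    show "lin K Z W (\<lambda>z. q z s)"
    proof (rule linI)
      show "q (z \<oplus>\<^bsub>Z\<^esub> z') s = q z s \<oplus>\<^bsub>W\<^esub> q z' s" if "z \<in> carrier Z" "z' \<in> carrier Z" for z z'
        by (rule tensor_over_ext [OF X Y W q lin_plus [OF W q q] _ s]) (simp_all add: that qc lin_add [OF c3])
      show "q (d \<odot>\<^bsub>Z\<^esub> z) s = d \<odot>\<^bsub>W\<^esub> q z s" if "d \<in> carrier K" "z \<in> carrier Z" for d z
        by (rule tensor_over_ext [OF X Y W q lin_scale [OF W q] _ s]) (simp_all add: that qc lin_smult [OF c3])
    qed (rule lin_closed [OF q s])
  qed (rule q)
  \<comment> \<open>The right action on \<open>X \<otimes>\<^sub>A Y\<close> is that of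
    \<open>Y\<close>, so balancedness over the outer tensor sign reduces to
    \<open>bal2\<close>.\<close>
  moreover have "q z (ract (X \<otimes>\<^sub>A Y) s a) = q (lact Z a z) s"
    if "s \<in> carrier (X \<otimes>\<^sub>A Y)" "a \<in> carrier A" "z \<in> carrier Z" for s a z
    by (rule tensor_over_ext [OF X Y W lin_comp [OF wbD(3) [OF XYo that(2)] q] q _ that(1)])
      (simp_all add: that wbD(4) [OF Z] ract_cl [OF X Y] qc wbD(5) [OF Y] bal2)
  ultimately obtain h where "h \<in> linear_maps K ((X \<otimes>\<^sub>A Y) \<otimes>\<^sub>A Z) W" "lin K ((X \<otimes>\<^sub>A Y) \<otimes>\<^sub>A Z) W h"
    and "\<forall>s\<in>carrier (X \<otimes>\<^sub>A Y). \<forall>z\<in>carrier Z. h (cl (X \<otimes>\<^sub>A Y) Z s z) = q z s"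
    using tensor_over_lift [OF XYo Z W, of "\<lambda>s z. q z s"] by blast
  then show ?thesis
    by (intro exI [of _ h]) (simp add: qc cl_closed [OF X Y])
qed

lemma tensor_over_lift3_right:
  "\<exists>h. h \<in> linear_maps K (X \<otimes>\<^sub>A (Y \<otimes>\<^sub>A Z)) W \<and> lin K (X \<otimes>\<^sub>A (Y \<otimes>\<^sub>A Z)) W h \<and>
    (\<forall>x\<in>carrier X. \<forall>y\<in>carrier Y. \<forall>z\<in>carrier Z. h (cl X (Y \<otimes>\<^sub>A Z) x (cl Y Z y z)) = c x y z)"
proof -
  have "\<exists>q. lin K (Y \<otimes>\<^sub>A Z) W q \<and> (\<forall>y\<in>carrier Y. \<forall>z\<in>carrier Z. q (cl Y Z y z) = c x y z)"
    if x: "x \<in> carrier X" for x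
    using tensor_over_lift [OF Y Z W bilinI [of Y K Z W "c x", OF c3 [OF x] c2 [OF x]] bal2 [OF x]] by blast
  then obtain q where q: "\<And>x. x \<in> carrier X \<Longrightarrow> lin K (Y \<otimes>\<^sub>A Z) W (q x)"
    and qc: "\<And>x y z. \<lbrakk>x \<in> carrier X; y \<in> carrier Y; z \<in> carrier Z\<rbrakk> \<Longrightarrow> q x (cl Y Z y z) = c x y z"
    by metis
  have "bilin K X (Y \<otimes>\<^sub>A Z) W q"
  proof (rule bilinI)
    fix t assume t: "t \<in> carrier (Y \<otimes>\<^sub>A Z)"
    show "lin K X W (\<lambda>x. q x t)"
    proof (rule linI)
      show "q (x \<oplus>\<^bsub>X\<^esub> x') t = q x t \<oplus>\<^bsub>W\<^esub> q x' t" if "x \<in> carrier X" "x' \<in> carrier X" for x x'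
        by (rule tensor_over_ext [OF Y Z W q lin_plus [OF W q q] _ t]) (simp_all add: that qc lin_add [OF c1])
      show "q (d \<odot>\<^bsub>X\<^esub> x) t = d \<odot>\<^bsub>W\<^esub> q x t" if "d \<in> carrier K" "x \<in> carrier X" for d x
        by (rule tensor_over_ext [OF Y Z W q lin_scale [OF W q] _ t]) (simp_all add: that qc lin_smult [OF c1])
    qed (rule lin_closed [OF q t])
  qed (rule q)
  moreover have "q (ract X x a) t = q x (lact (Y \<otimes>\<^sub>A Z) a t)"
    if "x \<in> carrier X" "a \<in> carrier A" "t \<in> carrier (Y \<otimes>\<^sub>A Z)" for x a t
    by (rule tensor_over_ext [OF Y Z W q lin_comp [OF wbD(2) [OF YZo that(2)] q] _ that(3)])
      (simp_all add: that wbD(5) [OF X] lact_cl [OF Y Z] qc wbD(4) [OF Y] bal1)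
  ultimately obtain h where "h \<in> linear_maps K (X \<otimes>\<^sub>A (Y \<otimes>\<^sub>A Z)) W" "lin K (X \<otimes>\<^sub>A (Y \<otimes>\<^sub>A Z)) W h"
    and "\<forall>x\<in>carrier X. \<forall>t\<in>carrier (Y \<otimes>\<^sub>A Z). h (cl X (Y \<otimes>\<^sub>A Z) x t) = q x t"
    using tensor_over_lift [OF X YZo W, of q] by blast
  then show ?thesis
    by (intro exI [of _ h]) (simp add: qc cl_closed [OF Y Z])
qed

end

lemma assoc_over:
  shows "assoc_over K A X Y Z \<in> bimod_hom K A ((X \<otimes>\<^sub>A Y) \<otimes>\<^sub>A Z) (X \<otimes>\<^sub>A (Y \<otimes>\<^sub>A Z))" (is ?A)
    and "\<lbrakk>x \<in> carrier X; y \<in> carrier Y; z \<in> carrier Z\<rbrakk> \<Longrightarrow>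
      assoc_over K A X Y Z (cl (X \<otimes>\<^sub>A Y) Z (cl X Y x y) z) = cl X (Y \<otimes>\<^sub>A Z) x (cl Y Z y z)"
proof -
  note W = wb_tensor_over [OF X YZo] and D = wb_tensor_over [OF XYo Z]
  note b1 = cl_bilin [OF X YZo] and b2 = cl_bilin [OF Y Z]
  have "\<exists>h. h \<in> linear_maps K ((X \<otimes>\<^sub>A Y) \<otimes>\<^sub>A Z) (X \<otimes>\<^sub>A (Y \<otimes>\<^sub>A Z)) \<and>
      lin K ((X \<otimes>\<^sub>A Y) \<otimes>\<^sub>A Z) (X \<otimes>\<^sub>A (Y \<otimes>\<^sub>A Z)) h \<and>
      (\<forall>x\<in>carrier X. \<forall>y\<in>carrier Y. \<forall>z\<in>carrier Z.
        h (cl (X \<otimes>\<^sub>A Y) Z (cl X Y x y) z) = cl X (Y \<otimes>\<^sub>A Z) x (cl Y Z y z))"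
    \<comment> \<open>The lifted map sends a triple to \<open>[x \<otimes> [y \<otimes> z]]\<close>,
      which is balanced at both tensor signs: the first balance passes through the outer class, the
      second takes place inside the inner one.\<close>
    by (rule tensor_over_lift3_left [OF wbD(1) [OF W]])
      (simp_all add: bilinD(2) [OF b1] lin_comp [OF bilinD(1) [OF b2] bilinD(1) [OF b1]]
        lin_comp [OF bilinD(2) [OF b2] bilinD(1) [OF b1]] cl_closed [OF Y Z] cl_balanced [OF X YZo] cl_balanced [OF Y Z] lact_cl [OF Y Z])
  then obtain h where h: "h \<in> linear_maps K ((X \<otimes>\<^sub>A Y) \<otimes>\<^sub>A Z) (X \<otimes>\<^sub>A (Y \<otimes>\<^sub>A Z))"
      and hl: "lin K ((X \<otimes>\<^sub>A Y) \<otimes>\<^sub>A Z) (X \<otimes>\<^sub>A (Y \<otimes>\<^sub>A Z)) h"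
      and hc: "\<forall>x\<in>carrier X. \<forall>y\<in>carrier Y. \<forall>z\<in>carrier Z.
        h (cl (X \<otimes>\<^sub>A Y) Z (cl X Y x y) z) = cl X (Y \<otimes>\<^sub>A Z) x (cl Y Z y z)"
    by blast
  have "bh ((X \<otimes>\<^sub>A Y) \<otimes>\<^sub>A Z) (X \<otimes>\<^sub>A (Y \<otimes>\<^sub>A Z)) h"
  proof (rule bhomI [OF hl])
    fix a u assume a: "a \<in> carrier A" and u: "u \<in> carrier ((X \<otimes>\<^sub>A Y) \<otimes>\<^sub>A Z)"
    note s = a hc cl_closed [OF X Y] cl_closed [OF Y Z] wbD(4) [OF X] wbD(5) [OF Z]
      lact_cl [OF XYo Z] lact_cl [OF X Y] lact_cl [OF X YZo] ract_cl [OF XYo Z] ract_cl [OF Y Z] ract_cl [OF X YZo]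
    show "h (lact ((X \<otimes>\<^sub>A Y) \<otimes>\<^sub>A Z) a u) = lact (X \<otimes>\<^sub>A (Y \<otimes>\<^sub>A Z)) a (h u)"
      by (rule tensor_over_ext3_left [OF wbD(1) [OF W] lin_comp [OF wbD(2) [OF D a] hl] lin_comp [OF hl wbD(2) [OF W a]] _ u])
        (simp add: s)
    show "h (ract ((X \<otimes>\<^sub>A Y) \<otimes>\<^sub>A Z) u a) = ract (X \<otimes>\<^sub>A (Y \<otimes>\<^sub>A Z)) (h u) a"
      by (rule tensor_over_ext3_left [OF wbD(1) [OF W] lin_comp [OF wbD(3) [OF D a] hl] lin_comp [OF hl wbD(3) [OF W a]] _ u])
        (simp add: s)
  qed
  then have hb: "h \<in> bimod_hom K A ((X \<otimes>\<^sub>A Y) \<otimes>\<^sub>A Z) (X \<otimes>\<^sub>A (Y \<otimes>\<^sub>A Z))"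
    by (rule bimod_hom_intro [OF h])
  have "assoc_over K A X Y Z = h"
    unfolding assoc_over_def
  proof (rule the_equality)
    fix h' assume h': "h' \<in> bimod_hom K A ((X \<otimes>\<^sub>A Y) \<otimes>\<^sub>A Z) (X \<otimes>\<^sub>A (Y \<otimes>\<^sub>A Z)) \<and>
      (\<forall>x\<in>carrier X. \<forall>y\<in>carrier Y. \<forall>z\<in>carrier Z.
        h' (cl (X \<otimes>\<^sub>A Y) Z (cl X Y x y) z) = cl X (Y \<otimes>\<^sub>A Z) x (cl Y Z y z))"
    show "h' = h"
    proof (rule linear_maps_ext [OF bimod_hom_linear_maps [OF conjunct1 [OF h']] h])
      fix u assume u: "u \<in> carrier ((X \<otimes>\<^sub>A Y) \<otimes>\<^sub>A Z)"
      show "h' u = h u"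
        by (rule tensor_over_ext3_left [OF wbD(1) [OF W] bimod_hom_lin [OF conjunct1 [OF h']] hl _ u])
          (simp add: hc conjunct2 [OF h'])
    qed
  qed (simp add: hb hc)
  then show ?A
    "\<lbrakk>x \<in> carrier X; y \<in> carrier Y; z \<in> carrier Z\<rbrakk> \<Longrightarrow>
      assoc_over K A X Y Z (cl (X \<otimes>\<^sub>A Y) Z (cl X Y x y) z) = cl X (Y \<otimes>\<^sub>A Z) x (cl Y Z y z)"
    by (simp_all add: hb hc)
qed

text \<open>As over \<open>K\<close>, an inverse is constructed from the other bracketing and then
  identified with the one chosen in the definition.\<close>

lemma assoc_over_inv:
  shows "assoc_over_inv K A X Y Z \<in> bimod_hom K A (X \<otimes>\<^sub>A (Y \<otimes>\<^sub>A Z)) ((X \<otimes>\<^sub>A Y) \<otimes>\<^sub>A Z)" (is ?A)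
    and "\<lbrakk>x \<in> carrier X; y \<in> carrier Y; z \<in> carrier Z\<rbrakk> \<Longrightarrow>
      assoc_over_inv K A X Y Z (cl X (Y \<otimes>\<^sub>A Z) x (cl Y Z y z)) = cl (X \<otimes>\<^sub>A Y) Z (cl X Y x y) z"
    (is "_ \<Longrightarrow> _ \<Longrightarrow> _ \<Longrightarrow> ?B")
proof -
  note W = wb_tensor_over [OF XYo Z] and D = wb_tensor_over [OF X YZo]
  note b1 = cl_bilin [OF XYo Z] and b2 = cl_bilin [OF X Y]
  note f = bimod_hom_bh [OF assoc_over(1)] and fl = bimod_hom_lin [OF assoc_over(1)]
  have "\<exists>h. h \<in> linear_maps K (X \<otimes>\<^sub>A (Y \<otimes>\<^sub>A Z)) ((X \<otimes>\<^sub>A Y) \<otimes>\<^sub>A Z) \<and>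
      lin K (X \<otimes>\<^sub>A (Y \<otimes>\<^sub>A Z)) ((X \<otimes>\<^sub>A Y) \<otimes>\<^sub>A Z) h \<and>
      (\<forall>x\<in>carrier X. \<forall>y\<in>carrier Y. \<forall>z\<in>carrier Z.
        h (cl X (Y \<otimes>\<^sub>A Z) x (cl Y Z y z)) = cl (X \<otimes>\<^sub>A Y) Z (cl X Y x y) z)"
    by (rule tensor_over_lift3_right [OF wbD(1) [OF W]])
      (simp_all add: bilinD(1) [OF b1] lin_comp [OF bilinD(1) [OF b2] bilinD(2) [OF b1]]
        lin_comp [OF bilinD(2) [OF b2] bilinD(2) [OF b1]] cl_closed [OF X Y] cl_balanced [OF XYo Z, symmetric]
        cl_balanced [OF X Y] ract_cl [OF X Y])
  then obtain h where hl: "lin K (X \<otimes>\<^sub>A (Y \<otimes>\<^sub>A Z)) ((X \<otimes>\<^sub>A Y) \<otimes>\<^sub>A Z) h"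
      and hc: "\<forall>x\<in>carrier X. \<forall>y\<in>carrier Y. \<forall>z\<in>carrier Z.
        h (cl X (Y \<otimes>\<^sub>A Z) x (cl Y Z y z)) = cl (X \<otimes>\<^sub>A Y) Z (cl X Y x y) z"
    by blast
  have gf: "h (assoc_over K A X Y Z u) = u" if u: "u \<in> carrier ((X \<otimes>\<^sub>A Y) \<otimes>\<^sub>A Z)" for u
    by (rule tensor_over_ext3_left [OF wbD(1) [OF W] lin_comp [OF fl hl] lin_ident _ u]) (simp add: assoc_over(2) hc)
  have fg: "assoc_over K A X Y Z (h u) = u" if u: "u \<in> carrier (X \<otimes>\<^sub>A (Y \<otimes>\<^sub>A Z))" for u
    by (rule tensor_over_ext3_right [OF wbD(1) [OF D] lin_comp [OF hl fl] lin_ident _ u]) (simp add: assoc_over(2) hc)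
  have eq: "assoc_over_inv K A X Y Z = restrict h (carrier (X \<otimes>\<^sub>A (Y \<otimes>\<^sub>A Z)))"
    unfolding assoc_over_inv_def by (rule inv_on_eq [OF fl hl gf fg])
  \<comment> \<open>The inverse of an equivariant bijection is equivariant: apply \<open>gf\<close>
    to the translate of \<open>h u\<close>.\<close>
  have hact: "h (lact (X \<otimes>\<^sub>A (Y \<otimes>\<^sub>A Z)) a u) = lact ((X \<otimes>\<^sub>A Y) \<otimes>\<^sub>A Z) a (h u)"
    "h (ract (X \<otimes>\<^sub>A (Y \<otimes>\<^sub>A Z)) u a) = ract ((X \<otimes>\<^sub>A Y) \<otimes>\<^sub>A Z) (h u) a"
    if a: "a \<in> carrier A" and u: "u \<in> carrier (X \<otimes>\<^sub>A (Y \<otimes>\<^sub>A Z))" for a u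
    using gf [of "lact ((X \<otimes>\<^sub>A Y) \<otimes>\<^sub>A Z) a (h u)"] gf [of "ract ((X \<otimes>\<^sub>A Y) \<otimes>\<^sub>A Z) (h u) a"]
    by (simp_all add: a bhomD(2,3) [OF f] lin_closed [OF hl u] fg [OF u] wbD(4,5) [OF W])
  show ?A
    by (simp add: eq bimod_hom_iff bhom_def lin_restrict wbD(1) [OF D] hl wbD(4,5) [OF D] hact)
  show ?B
    if "x \<in> carrier X" "y \<in> carrier Y" "z \<in> carrier Z"
    using that by (simp add: eq hc cl_closed [OF X YZo] cl_closed [OF Y Z])
qed

end

section \<open>The adjunctions as explicit currying\<close>

context
  fixes W :: "('a, 'k, 'w) bimodule" and Z :: "('a, 'k, 'z) bimodule" and Y :: "('a, 'k, 'y) bimodule"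
  assumes W: "wb W" and Z: "wb Z" and Y: "wb Y"
begin

interpretation TW: module K W by (rule wbD(1) [OF W])

text \<open>The description of the transpose by means of the evaluation is solved by currying,
  \<open>w \<mapsto> (z \<mapsto> f [w \<otimes> z])\<close>. That this is a bimodule map into
  \<open>hom_r\<close> combines the equivariance of \<open>f\<close> with the balancedness of the
  class.\<close>

lemma transpose_r:
  assumes f: "f \<in> bimod_hom K A (W \<otimes>\<^sub>A Z) Y"
  shows "transpose_r K A W Z Y f \<in> bimod_hom K A W (hom_r K A Z Y)"
    and "\<lbrakk>w \<in> carrier W; z \<in> carrier Z\<rbrakk> \<Longrightarrow> transpose_r K A W Z Y f w z = f (cl W Z w z)"
proof -
  let ?H = "hom_r K A Z Y"
  note H = wb_hom_r [OF Z Y] and c = cl_bilin [OF W Z]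
  note fl = bimod_hom_lin [OF f] and fb = bimod_hom_bh [OF f]
  define g where "g = (\<lambda>w\<in>carrier W. \<lambda>z\<in>carrier Z. f (cl W Z w z))"
  have gl: "(\<lambda>z\<in>carrier Z. f (cl W Z w z)) \<in> carrier ?H" if w: "w \<in> carrier W" for w
    by (rule hom_rI [OF Z Y lin_comp [OF bilinD(1) [OF c w] fl]])
        (simp add: w ract_cl [OF W Z, symmetric] bhomD(3) [OF fb] cl_closed [OF W Z])
  then have gc: "g w \<in> carrier ?H" if "w \<in> carrier W" for w
    using that by (simp add: g_def)
  have "lin K W ?H g"
    by (rule linI) (auto simp: gl g_def hom_r_sel(3,4)
      lin_add [OF lin_comp [OF bilinD(2) [OF c] fl]] lin_smult [OF lin_comp [OF bilinD(2) [OF c] fl]]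
      intro!: restrict_ext)
  then have gb: "g \<in> bimod_hom K A W ?H"
    by (auto simp: bimod_hom_iff g_def hom_r_sel(5,6) wbD(4,5) [OF W] wbD(4) [OF Z] cl_balanced [OF W Z]
      lact_cl [OF W Z, symmetric] bhomD(2) [OF fb] cl_closed [OF W Z] intro!: bhomI restrict_ext)
  have iff: "comp_on (W \<otimes>\<^sub>A Z) (eval_r K A Z Y) (tensor_over_map K A W Z ?H Z g' (idm Z)) = f \<longleftrightarrow>
      (\<forall>w\<in>carrier W. \<forall>z\<in>carrier Z. g' w z = f (cl W Z w z))" if g': "g' \<in> bimod_hom K A W ?H" for g'
  proof -
    note tom = tensor_over_map [OF W Z H Z bimod_hom_bh [OF g'] bhom_idm [OF Z]]
    \<comment> \<open>Extensionality of \<open>f\<close> puts the adjunction equation into the form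
      of two restrictions, so that it can be tested on classes.\<close>
    have "f = restrict f (carrier (W \<otimes>\<^sub>A Z))"
      using f by (simp add: bimod_hom_iff extensional_restrict)
    then have "comp_on (W \<otimes>\<^sub>A Z) (eval_r K A Z Y) (tensor_over_map K A W Z ?H Z g' (idm Z)) = f \<longleftrightarrow>
      comp_on (W \<otimes>\<^sub>A Z) (eval_r K A Z Y) (tensor_over_map K A W Z ?H Z g' (idm Z)) = restrict f (carrier (W \<otimes>\<^sub>A Z))"
      by simp
    also have "\<dots> \<longleftrightarrow> (\<forall>w\<in>carrier W. \<forall>z\<in>carrier Z. g' w z = f (cl W Z w z))"
      unfolding compose_def
      by (subst tensor_over_restrict_eq_iff [OF W Z wbD(1) [OF Y]
          lin_comp [OF bimod_hom_lin [OF tom(1)] bimod_hom_lin [OF eval_r(1) [OF Z Y]]] fl])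
        (simp add: tom(2) eval_r(2) [OF Z Y] lin_closed [OF bimod_hom_lin [OF g']])
    finally show ?thesis .
  qed
  have "transpose_r K A W Z Y f = g"
    unfolding transpose_r_def
  proof (rule the_equality)
    show "g \<in> bimod_hom K A W ?H \<and> comp_on (W \<otimes>\<^sub>A Z) (eval_r K A Z Y) (tensor_over_map K A W Z ?H Z g (idm Z)) = f"
      using iff [OF gb] gb by (simp add: g_def)
    fix g' assume g': "g' \<in> bimod_hom K A W ?H \<and>
      comp_on (W \<otimes>\<^sub>A Z) (eval_r K A Z Y) (tensor_over_map K A W Z ?H Z g' (idm Z)) = f"
    then have e: "\<forall>w\<in>carrier W. \<forall>z\<in>carrier Z. g' w z = f (cl W Z w z)"
      using iff by blast
    show "g' = g"
    \<comment> \<open>Extensionality acts at two levels, for the functions of \<open>w\<close> and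
      then for their values as functions of \<open>z\<close>.\<close>
    proof (rule linear_maps_ext [OF bimod_hom_linear_maps [OF conjunct1 [OF g']] bimod_hom_linear_maps [OF gb]])
      fix w assume w: "w \<in> carrier W"
      note g'w = lin_closed [OF bimod_hom_lin [OF conjunct1 [OF g']] w]
      show "g' w = g w"
        by (rule linear_maps_ext [OF hom_rD(2) [OF Z Y g'w] hom_rD(2) [OF Z Y gc [OF w]]])
          (use e w in \<open>simp add: g_def\<close>)
    qed
  qed
  then show "transpose_r K A W Z Y f \<in> bimod_hom K A W ?H"
    "\<lbrakk>w \<in> carrier W; z \<in> carrier Z\<rbrakk> \<Longrightarrow> transpose_r K A W Z Y f w z = f (cl W Z w z)"
    using gb by (simp_all add: g_def)
qed

lemma transpose_l:
  assumes f: "f \<in> bimod_hom K A (Z \<otimes>\<^sub>A W) Y"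
  shows "transpose_l K A Z W Y f \<in> bimod_hom K A W (hom_l K A Z Y)"
    and "\<lbrakk>w \<in> carrier W; z \<in> carrier Z\<rbrakk> \<Longrightarrow> transpose_l K A Z W Y f w z = f (cl Z W z w)"
proof -
  let ?H = "hom_l K A Z Y"
  note H = wb_hom_l [OF Z Y] and c = cl_bilin [OF Z W]
  note fl = bimod_hom_lin [OF f] and fb = bimod_hom_bh [OF f]
  define g where "g = (\<lambda>w\<in>carrier W. \<lambda>z\<in>carrier Z. f (cl Z W z w))"
  have gl: "(\<lambda>z\<in>carrier Z. f (cl Z W z w)) \<in> carrier ?H" if w: "w \<in> carrier W" for w
    by (rule hom_lI [OF Z Y lin_comp [OF bilinD(2) [OF c w] fl]])
        (simp add: w lact_cl [OF Z W, symmetric] bhomD(2) [OF fb] cl_closed [OF Z W])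
  then have gc: "g w \<in> carrier ?H" if "w \<in> carrier W" for w
    using that by (simp add: g_def)
  have "lin K W ?H g"
    by (rule linI) (auto simp: gl g_def hom_l_sel(3,4)
      lin_add [OF lin_comp [OF bilinD(1) [OF c] fl]] lin_smult [OF lin_comp [OF bilinD(1) [OF c] fl]]
      intro!: restrict_ext)
  then have gb: "g \<in> bimod_hom K A W ?H"
    by (auto simp: bimod_hom_iff g_def hom_l_sel(5,6) wbD(4,5) [OF W] wbD(5) [OF Z] cl_balanced [OF Z W]
      ract_cl [OF Z W, symmetric] bhomD(3) [OF fb] cl_closed [OF Z W] intro!: bhomI restrict_ext)
  have iff: "comp_on (Z \<otimes>\<^sub>A W) (eval_l K A Z Y) (tensor_over_map K A Z W Z ?H (idm Z) g') = f \<longleftrightarrow>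
      (\<forall>z\<in>carrier Z. \<forall>w\<in>carrier W. g' w z = f (cl Z W z w))" if g': "g' \<in> bimod_hom K A W ?H" for g'
  proof -
    note tom = tensor_over_map [OF Z W Z H bhom_idm [OF Z] bimod_hom_bh [OF g']]
    have "f = restrict f (carrier (Z \<otimes>\<^sub>A W))"
      using f by (simp add: bimod_hom_iff extensional_restrict)
    then have "comp_on (Z \<otimes>\<^sub>A W) (eval_l K A Z Y) (tensor_over_map K A Z W Z ?H (idm Z) g') = f \<longleftrightarrow>
      comp_on (Z \<otimes>\<^sub>A W) (eval_l K A Z Y) (tensor_over_map K A Z W Z ?H (idm Z) g') = restrict f (carrier (Z \<otimes>\<^sub>A W))"
      by simp
    also have "\<dots> \<longleftrightarrow> (\<forall>z\<in>carrier Z. \<forall>w\<in>carrier W. g' w z = f (cl Z W z w))"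
      unfolding compose_def
      by (subst tensor_over_restrict_eq_iff [OF Z W wbD(1) [OF Y]
          lin_comp [OF bimod_hom_lin [OF tom(1)] bimod_hom_lin [OF eval_l(1) [OF Z Y]]] fl])
        (simp add: tom(2) eval_l(2) [OF Z Y] lin_closed [OF bimod_hom_lin [OF g']])
    finally show ?thesis .
  qed
  have "transpose_l K A Z W Y f = g"
    unfolding transpose_l_def
  proof (rule the_equality)
    show "g \<in> bimod_hom K A W ?H \<and> comp_on (Z \<otimes>\<^sub>A W) (eval_l K A Z Y) (tensor_over_map K A Z W Z ?H (idm Z) g) = f"
      using iff [OF gb] gb by (simp add: g_def)
    fix g' assume g': "g' \<in> bimod_hom K A W ?H \<and>
      comp_on (Z \<otimes>\<^sub>A W) (eval_l K A Z Y) (tensor_over_map K A Z W Z ?H (idm Z) g') = f"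
    then have e: "\<forall>z\<in>carrier Z. \<forall>w\<in>carrier W. g' w z = f (cl Z W z w)"
      using iff by blast
    show "g' = g"
    proof (rule linear_maps_ext [OF bimod_hom_linear_maps [OF conjunct1 [OF g']] bimod_hom_linear_maps [OF gb]])
      fix w assume w: "w \<in> carrier W"
      note g'w = lin_closed [OF bimod_hom_lin [OF conjunct1 [OF g']] w]
      show "g' w = g w"
        by (rule linear_maps_ext [OF hom_lD(2) [OF Z Y g'w] hom_lD(2) [OF Z Y gc [OF w]]])
          (use e w in \<open>simp add: g_def\<close>)
    qed
  qed
  then show "transpose_l K A Z W Y f \<in> bimod_hom K A W ?H"
    "\<lbrakk>w \<in> carrier W; z \<in> carrier Z\<rbrakk> \<Longrightarrow> transpose_l K A Z W Y f w z = f (cl Z W z w)"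
    using gb by (simp_all add: g_def)
qed

end

section \<open>Values of the lax structures on classes\<close>

context
  fixes X :: "('a, 'k, 'x) bimodule" and Y :: "('a, 'k, 'y) bimodule" and Z :: "('a, 'k, 'z) bimodule"
  assumes X: "wb X" and Y: "wb Y" and Z: "wb Z"
begin

text \<open>Currying feeds \<open>[[x \<otimes> f] \<otimes> z]\<close> to the associator, which
  gives \<open>[x \<otimes> [f \<otimes> z]]\<close>; the evaluation then acts on the inner
  class.\<close>

lemma delta_r:
  shows "delta_r K A Z X Y \<in> bimod_hom K A (X \<otimes>\<^sub>A hom_r K A Z Y) (hom_r K A Z (X \<otimes>\<^sub>A Y))"
    and "\<lbrakk>x \<in> carrier X; f \<in> carrier (hom_r K A Z Y); z \<in> carrier Z\<rbrakk> \<Longrightarrow>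
      delta_r K A Z X Y (cl X (hom_r K A Z Y) x f) z = cl X Y x (f z)"
proof -
  let ?H = "hom_r K A Z Y"
  note H = wb_hom_r [OF Z Y]
  note XH = wb_tensor_over [OF X H] and HZ = wb_tensor_over [OF H Z] and XoY = wb_tensor_over [OF X Y]
  note tom = tensor_over_map [OF X HZ X Y bhom_idm [OF X] bimod_hom_bh [OF eval_r(1) [OF Z Y]]]
  note ass = assoc_over [OF X H Z]
  note f = bimod_hom_compose [OF wb_tensor_over [OF XH Z] ass(1) tom(1)]
  note t = transpose_r [OF XH Z XoY f, folded delta_r_def]
  show "delta_r K A Z X Y \<in> bimod_hom K A (X \<otimes>\<^sub>A ?H) (hom_r K A Z (X \<otimes>\<^sub>A Y))" by (rule t(1))
  show "delta_r K A Z X Y (cl X ?H x f) z = cl X Y x (f z)"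
    if "x \<in> carrier X" "f \<in> carrier ?H" "z \<in> carrier Z"
    using that by (simp add: t(2) cl_closed [OF X H] cl_closed [OF XH Z] cl_closed [OF H Z] compose_eq ass(2) tom(2)
      eval_r(2) [OF Z Y])
qed

text \<open>The argument \<open>z\<close> now enters from the left, so it is the inverse associator
  that brings it next to \<open>f\<close>.\<close>

lemma delta_l:
  shows "delta_l K A Z X Y \<in> bimod_hom K A (hom_l K A Z X \<otimes>\<^sub>A Y) (hom_l K A Z (X \<otimes>\<^sub>A Y))"
    and "\<lbrakk>f \<in> carrier (hom_l K A Z X); y \<in> carrier Y; z \<in> carrier Z\<rbrakk> \<Longrightarrow>
      delta_l K A Z X Y (cl (hom_l K A Z X) Y f y) z = cl X Y (f z) y"
proof -
  let ?H = "hom_l K A Z X"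
  note H = wb_hom_l [OF Z X]
  note HY = wb_tensor_over [OF H Y] and ZH = wb_tensor_over [OF Z H] and XoY = wb_tensor_over [OF X Y]
  note tom = tensor_over_map [OF ZH Y X Y bimod_hom_bh [OF eval_l(1) [OF Z X]] bhom_idm [OF Y]]
  note ass = assoc_over_inv [OF Z H Y]
  note f = bimod_hom_compose [OF wb_tensor_over [OF Z HY] ass(1) tom(1)]
  note t = transpose_l [OF HY Z XoY f, folded delta_l_def]
  show "delta_l K A Z X Y \<in> bimod_hom K A (?H \<otimes>\<^sub>A Y) (hom_l K A Z (X \<otimes>\<^sub>A Y))" by (rule t(1))
  show "delta_l K A Z X Y (cl ?H Y f y) z = cl X Y (f z) y"
    if "f \<in> carrier ?H" "y \<in> carrier Y" "z \<in> carrier Z"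
    using that by (simp add: t(2) cl_closed [OF H Y] cl_closed [OF Z HY] cl_closed [OF Z H] compose_eq ass(2) tom(2)
      eval_l(2) [OF Z X])
qed

end

section \<open>Duals and contractions\<close>

lemma ground_module_sel:
  "carrier (ground_module K) = carrier K" "\<zero>\<^bsub>ground_module K\<^esub> = \<zero>\<^bsub>K\<^esub>"
  "x \<oplus>\<^bsub>ground_module K\<^esub> y = x \<oplus>\<^bsub>K\<^esub> y" "x \<odot>\<^bsub>ground_module K\<^esub> y = x \<otimes>\<^bsub>K\<^esub> y"
  by (simp_all add: ground_module_def ring.defs module.defs)

lemma ground_module_module:
  assumes "cring K" shows "module K (ground_module K)"
proof -
  interpret K: cring K by (rule assms)
  show ?thesis
  proof (rule moduleI)
    show "abelian_group (ground_module K)"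
      by (rule abelian_groupI) (auto simp: ground_module_sel K.a_ac intro: K.l_neg bexI [of _ "\<ominus>\<^bsub>K\<^esub> _"])
  qed (auto simp: ground_module_sel K.l_distr K.r_distr K.m_assoc assms)
qed

lemma dual_sel:
  "carrier (dual K X) = linear_maps K X (ground_module K)"
  "\<zero>\<^bsub>dual K X\<^esub> = (\<lambda>x\<in>carrier X. \<zero>\<^bsub>K\<^esub>)"
  "\<beta> \<oplus>\<^bsub>dual K X\<^esub> \<beta>' = (\<lambda>x\<in>carrier X. \<beta> x \<oplus>\<^bsub>K\<^esub> \<beta>' x)"
  "c \<odot>\<^bsub>dual K X\<^esub> \<beta> = (\<lambda>x\<in>carrier X. c \<otimes>\<^bsub>K\<^esub> \<beta> x)"
  "lact (dual K X) a \<beta> = (\<lambda>x\<in>carrier X. \<beta> (ract X x a))"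
  "ract (dual K X) \<beta> a = (\<lambda>x\<in>carrier X. \<beta> (lact X a x))"
  by (simp_all add: dual_def module.defs bimodule.defs lin_hom_def ground_module_sel)

context
  fixes X :: "('a, 'k, 'x) bimodule"
  assumes X: "wb X"
begin

interpretation DX: module K X by (rule wbD(1) [OF X])

private lemmas GM = ground_module_module [OF DX.is_cring]

lemma dualD:
  assumes "\<beta> \<in> carrier (dual K X)"
  shows "lin K X (ground_module K) \<beta>" "x \<in> carrier X \<Longrightarrow> \<beta> x \<in> carrier K"
    "\<lbrakk>x \<in> carrier X; y \<in> carrier X\<rbrakk> \<Longrightarrow> \<beta> (x \<oplus>\<^bsub>X\<^esub> y) = \<beta> x \<oplus>\<^bsub>K\<^esub> \<beta> y"
    "\<lbrakk>c \<in> carrier K; x \<in> carrier X\<rbrakk> \<Longrightarrow> \<beta> (c \<odot>\<^bsub>X\<^esub> x) = c \<otimes>\<^bsub>K\<^esub> \<beta> x"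
  using assms lin_closed [of K X "ground_module K" \<beta>] lin_add [of K X "ground_module K" \<beta>]
    lin_smult [of K X "ground_module K" \<beta>]
  by (auto simp: dual_sel linear_maps_iff ground_module_sel)

lemma wb_dual: "wb (dual K X)"
proof (rule weak_bimodule.intro)
  show "module K (dual K X)"
    by (rule module_cong [OF lin_hom_module [OF DX.module_axioms GM]])
      (simp_all add: dual_sel lin_hom_sel ground_module_sel)
  fix a assume a: "a \<in> carrier A"
  have lc: "(\<lambda>x\<in>carrier X. \<beta> (ract X x a)) \<in> carrier (dual K X)"
    "(\<lambda>x\<in>carrier X. \<beta> (lact X a x)) \<in> carrier (dual K X)"
    if "\<beta> \<in> carrier (dual K X)" for \<beta>
    using restrict_linear_maps [OF DX.module_axioms lin_comp [OF wbD(3) [OF X a] dualD(1) [OF that]]]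
      restrict_linear_maps [OF DX.module_axioms lin_comp [OF wbD(2) [OF X a] dualD(1) [OF that]]]
    by (simp_all add: dual_sel)
  show "lin K (dual K X) (dual K X) (lact (dual K X) a)"
    by (rule linI) (auto simp: lc dual_sel(3-5) wbD(5) [OF X] a intro!: restrict_ext)
  show "lin K (dual K X) (dual K X) (\<lambda>\<beta>. ract (dual K X) \<beta> a)"
    by (rule linI) (auto simp: lc dual_sel(3,4,6) wbD(4) [OF X] a intro!: restrict_ext)
  \<comment> \<open>Dualising exchanges the sides, so the required commutation is that of the
    actions on \<open>X\<close> with their roles interchanged.\<close>
  fix b \<beta> assume "b \<in> carrier A" "\<beta> \<in> carrier (dual K X)"
  then show "ract (dual K X) (lact (dual K X) a \<beta>) b = lact (dual K X) a (ract (dual K X) \<beta> b)"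
    by (auto simp: dual_sel(5,6) wbD(4,5,6) [OF X] a intro!: restrict_ext)
qed

end

text \<open>Dualising twice exchanges left and right twice, so evaluation at \<open>x\<close>
  respects the sides.\<close>

lemma bidual_map_bh:
  assumes X: "wb X"
  shows "bh X (dual K (dual K X)) (bidual_map K X)"
proof (rule bhomI)
  note D = wb_dual [OF X]
  interpret DX: module K X by (rule wbD(1) [OF X])
  have c: "(\<lambda>\<beta>\<in>carrier (dual K X). \<beta> x) \<in> carrier (dual K (dual K X))" if "x \<in> carrier X" for x
    unfolding dual_sel(1) [of "dual K X"]
    by (rule restrict_linear_maps [OF wbD(1) [OF D]], rule linI)
      (simp_all add: that dualD [OF X] ground_module_sel dual_sel(3,4))
  show "lin K X (dual K (dual K X)) (bidual_map K X)"
    by (rule linI) (auto simp: bidual_map_def c dual_sel(3,4) dualD [OF X] intro!: restrict_ext)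
  fix a x assume a: "a \<in> carrier A" and x: "x \<in> carrier X"
  \<comment> \<open>Evaluating at a translate of \<open>x\<close> is evaluating the translated
    functional at \<open>x\<close>; the translated functional is how the actions on the bidual are
    defined.\<close>
  have "\<beta> (lact X a x) = ract (dual K X) \<beta> a x" "\<beta> (ract X x a) = lact (dual K X) a \<beta> x" for \<beta>
    using x by (simp_all add: dual_sel(5,6))
  then show "bidual_map K X (lact X a x) = lact (dual K (dual K X)) a (bidual_map K X x)"
    "bidual_map K X (ract X x a) = ract (dual K (dual K X)) (bidual_map K X x) a"
    unfolding dual_sel(5,6) [where X = "dual K X"]
    by (simp_all add: bidual_map_def a x wbD(4,5) [OF X] wbD(4,5) [OF D] cong: restrict_cong)
qed

text \<open>The contraction \<open>id \<otimes> \<zeta>\<close>. It is chosen by \<open>SOME\<close>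
  because a map linear in the sense of \<open>lin\<close> is determined only on the carrier.\<close>

definition contract_r ::
  "('a, 'k, 'y) bimodule \<Rightarrow> ('a, 'k, 'z) bimodule \<Rightarrow> ('z \<Rightarrow> 'k) \<Rightarrow> ('k, 'y, 'z) tensor \<Rightarrow> 'y" where
  "contract_r Y Z \<zeta> = (SOME h. lin K (Y \<otimes>\<^sub>K Z) Y h \<and>
     (\<forall>y\<in>carrier Y. \<forall>z\<in>carrier Z. h (pt Y Z y z) = \<zeta> z \<odot>\<^bsub>Y\<^esub> y))"

definition contract_l ::
  "('a, 'k, 'x) bimodule \<Rightarrow> ('a, 'k, 'y) bimodule \<Rightarrow> ('x \<Rightarrow> 'k) \<Rightarrow> ('k, 'x, 'y) tensor \<Rightarrow> 'y" where
  "contract_l X Y \<xi> = (SOME h. lin K (X \<otimes>\<^sub>K Y) Y h \<and>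
     (\<forall>x\<in>carrier X. \<forall>y\<in>carrier Y. h (pt X Y x y) = \<xi> x \<odot>\<^bsub>Y\<^esub> y))"

context
  fixes Y :: "('a, 'k, 'y) bimodule" and Z :: "('a, 'k, 'z) bimodule"
  assumes Y: "wb Y" and Z: "wb Z"
begin

interpretation CY: module K Y by (rule wbD(1) [OF Y])
interpretation CZ: module K Z by (rule wbD(1) [OF Z])

private lemmas CM = wbD(1) [OF Y] wbD(1) [OF Z]

lemma scale_lin: "\<lbrakk>\<zeta> \<in> carrier (dual K Z); y \<in> carrier Y\<rbrakk> \<Longrightarrow> lin K Z Y (\<lambda>z. \<zeta> z \<odot>\<^bsub>Y\<^esub> y)"
  by (rule linI) (simp_all add: dualD [OF Z] CY.smult_l_distr CY.smult_assoc1)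

lemma scale_lin': "\<lbrakk>\<zeta> \<in> carrier (dual K Z); z \<in> carrier Z\<rbrakk> \<Longrightarrow> lin K Y Y (\<lambda>y. \<zeta> z \<odot>\<^bsub>Y\<^esub> y)"
  by (rule lin_scale [OF CM(1) lin_ident dualD(2) [OF Z]])

lemma contract_r:
  assumes "\<zeta> \<in> carrier (dual K Z)"
  shows "lin K (Y \<otimes>\<^sub>K Z) Y (contract_r Y Z \<zeta>)" (is ?A)
    and "\<lbrakk>y \<in> carrier Y; z \<in> carrier Z\<rbrakk> \<Longrightarrow> contract_r Y Z \<zeta> (pt Y Z y z) = \<zeta> z \<odot>\<^bsub>Y\<^esub> y"
proof -
  have "bilin K Y Z Y (\<lambda>y z. \<zeta> z \<odot>\<^bsub>Y\<^esub> y)"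
    by (rule bilinI) (simp_all add: assms scale_lin scale_lin')
  from tensor_field_lift [OF CM CM(1) this]
  have "\<exists>h. lin K (Y \<otimes>\<^sub>K Z) Y h \<and> (\<forall>y\<in>carrier Y. \<forall>z\<in>carrier Z. h (pt Y Z y z) = \<zeta> z \<odot>\<^bsub>Y\<^esub> y)"
    by blast
  from someI_ex [OF this, folded contract_r_def]
  show ?A
    "\<lbrakk>y \<in> carrier Y; z \<in> carrier Z\<rbrakk> \<Longrightarrow> contract_r Y Z \<zeta> (pt Y Z y z) = \<zeta> z \<odot>\<^bsub>Y\<^esub> y"
    by simp_all
qed

lemma contract_l:
  assumes "\<zeta> \<in> carrier (dual K Z)"
  shows "lin K (Z \<otimes>\<^sub>K Y) Y (contract_l Z Y \<zeta>)" (is ?A)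
    and "\<lbrakk>z \<in> carrier Z; y \<in> carrier Y\<rbrakk> \<Longrightarrow> contract_l Z Y \<zeta> (pt Z Y z y) = \<zeta> z \<odot>\<^bsub>Y\<^esub> y"
proof -
  have "bilin K Z Y Y (\<lambda>z y. \<zeta> z \<odot>\<^bsub>Y\<^esub> y)"
    by (rule bilinI) (simp_all add: assms scale_lin scale_lin')
  from tensor_field_lift [OF CM(2,1,1) this]
  have "\<exists>h. lin K (Z \<otimes>\<^sub>K Y) Y h \<and> (\<forall>z\<in>carrier Z. \<forall>y\<in>carrier Y. h (pt Z Y z y) = \<zeta> z \<odot>\<^bsub>Y\<^esub> y)"
    by blast
  from someI_ex [OF this, folded contract_l_def]
  show ?A
    "\<lbrakk>z \<in> carrier Z; y \<in> carrier Y\<rbrakk> \<Longrightarrow> contract_l Z Y \<zeta> (pt Z Y z y) = \<zeta> z \<odot>\<^bsub>Y\<^esub> y"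
    by simp_all
qed

lemma lin_eval: "z \<in> carrier Z \<Longrightarrow> lin K (lin_hom K Z Y) Y (\<lambda>f. f z)"
  by (rule linI) (simp_all add: lin_hom_sel linear_maps_closed [of _ Z Y])

text \<open>Bilinearity of the rank-one operators \<open>z \<mapsto> \<beta>(z) y\<close> in
  \<open>\<beta>\<close> and \<open>y\<close>. It resolves the descriptions in
  \<open>hom_r_ident\<close> and \<open>hom_l_ident\<close>.\<close>

lemma rank_one_lin:
  shows "y \<in> carrier Y \<Longrightarrow> lin K (dual K Z) (lin_hom K Z Y) (\<lambda>\<beta>. \<lambda>z\<in>carrier Z. \<beta> z \<odot>\<^bsub>Y\<^esub> y)"
    and "\<beta> \<in> carrier (dual K Z) \<Longrightarrow> lin K Y (lin_hom K Z Y) (\<lambda>y. \<lambda>z\<in>carrier Z. \<beta> z \<odot>\<^bsub>Y\<^esub> y)"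
proof -
  note c = restrict_linear_maps [OF CM(2) scale_lin] and d = dualD(2) [OF Z]
  show "lin K (dual K Z) (lin_hom K Z Y) (\<lambda>\<beta>. \<lambda>z\<in>carrier Z. \<beta> z \<odot>\<^bsub>Y\<^esub> y)" if y: "y \<in> carrier Y"
    by (rule linI) (auto simp: lin_hom_sel c d dual_sel(3,4) y CY.smult_l_distr CY.smult_assoc1 intro!: restrict_ext)
  show "lin K Y (lin_hom K Z Y) (\<lambda>y. \<lambda>z\<in>carrier Z. \<beta> z \<odot>\<^bsub>Y\<^esub> y)" if \<beta>: "\<beta> \<in> carrier (dual K Z)"
    by (rule linI) (auto simp: lin_hom_sel c \<beta> lin_closed [OF scale_lin' [OF \<beta>]] lin_add [OF scale_lin' [OF \<beta>]]
      lin_smult [OF scale_lin' [OF \<beta>]] intro!: restrict_ext)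
qed

end

section \<open>The identifications with Hom spaces as families of contractions\<close>

context
  fixes Y :: "('a, 'k, 'y) bimodule" and Z :: "('a, 'k, 'z) bimodule"
  assumes Y: "wb Y" and Z: "wb Z"
begin

private lemmas EM = wbD(1) [OF Y] wbD(1) [OF Z]
private lemmas ED = wb_dual [OF Z]
private lemmas EDD = wb_dual [OF ED]

text \<open>On a pure tensor the bidual replaces \<open>z\<close> by evaluation at \<open>z\<close>,
  and the rank-one operator then sends \<open>\<zeta>\<close> to \<open>\<zeta>(z) y\<close>, which
  is the contraction. The general case follows by linearity on the ambient tensor product.\<close>

lemma cotensor_hom_r_apply:
  assumes t: "t \<in> carrier (Y \<otimes>\<^sup>A Z)"
  shows "cotensor_hom_r K A Y Z t \<in> linear_maps K (dual K Z) Y"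
    and "\<zeta> \<in> carrier (dual K Z) \<Longrightarrow> cotensor_hom_r K A Y Z t \<zeta> = contract_r Y Z \<zeta> t"
proof -
  let ?D = "dual K Z"
  note L = lin_hom_module [OF wbD(1) [OF ED] EM(1)]
  \<comment> \<open>The identification before its restriction: a linear map on all of
    \<open>Y \<otimes>\<^sub>K Z\<close> after the bidual, and so accessible on pure
    tensors.\<close>
  define T where "T = (THE h. h \<in> linear_maps K (Y \<otimes>\<^sub>K dual K ?D) (lin_hom K ?D Y) \<and>
    (\<forall>y\<in>carrier Y. \<forall>\<beta>\<in>carrier (dual K ?D). h (pt Y (dual K ?D) y \<beta>) = (\<lambda>z\<in>carrier ?D. \<beta> z \<odot>\<^bsub>Y\<^esub> y)))"
  have v: "bilin K Y (dual K ?D) (lin_hom K ?D Y) (\<lambda>y \<beta>. \<lambda>z\<in>carrier ?D. \<beta> z \<odot>\<^bsub>Y\<^esub> y)"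
    by (intro bilinI rank_one_lin [OF Y ED])
  note the = the_tensor_field_map [OF EM(1) wbD(1) [OF EDD] L v, OF refl, folded T_def]
  have Tl: "lin K (Y \<otimes>\<^sub>K dual K ?D) (lin_hom K ?D Y) T"
    using the(1) by (simp add: linear_maps_iff)
  let ?m = "tensor_map K Y Z Y (dual K ?D) (idm Y) (bidual_map K Z)"
  note b = bidual_map_bh [OF Z]
  note tm = EM(1,2) EM(1) wbD(1) [OF EDD] lin_idm [OF EM(1)] bhomD(1) [OF b]
  \<comment> \<open>The map into the bidual preserves the subspace, so the restriction in
    \<open>hom_r_ident\<close> returns the value of \<open>T\<close> here and not the
    default.\<close>
  have m: "?m t \<in> carrier (Y \<otimes>\<^sup>A dual K ?D)"
    by (rule tensor_map_cotensor [OF Y Z Y EDD lin_idm [OF EM(1)] bhomD(1) [OF b] _ bhomD(2) [OF b] t])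
      (simp_all add: wbD(5) [OF Y])
  have eq: "cotensor_hom_r K A Y Z t = T (?m t)"
    using t m by (simp add: cotensor_hom_r_def hom_r_ident_def compose_eq cotensor_map_def T_def)
  show "cotensor_hom_r K A Y Z t \<in> linear_maps K ?D Y"
    using lin_closed [OF Tl cotensor_subset [OF m]] by (simp add: eq lin_hom_sel)
  assume z: "\<zeta> \<in> carrier ?D"
  have "T (?m t) \<zeta> = contract_r Y Z \<zeta> t"
    by (rule tensor_field_ext [OF EM EM(1) lin_comp [OF lin_comp [OF tensor_map_lin [OF tm] Tl] lin_eval [OF Y ED z]]
          contract_r(1) [OF Y Z z] _ cotensor_subset [OF t]])
      (simp add: tensor_map_pure [OF tm] the(2) lin_closed [OF bhomD(1) [OF b]] contract_r(2) [OF Y Z] z, simp add: bidual_map_def z)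
  then show "cotensor_hom_r K A Y Z t \<zeta> = contract_r Y Z \<zeta> t" by (simp add: eq)
qed

lemma cotensor_hom_l_apply:
  assumes t: "t \<in> carrier (Z \<otimes>\<^sup>A Y)"
  shows "cotensor_hom_l K A Z Y t \<in> linear_maps K (dual K Z) Y"
    and "\<zeta> \<in> carrier (dual K Z) \<Longrightarrow> cotensor_hom_l K A Z Y t \<zeta> = contract_l Z Y \<zeta> t"
proof -
  let ?D = "dual K Z"
  note L = lin_hom_module [OF wbD(1) [OF ED] EM(1)]
  define T where "T = (THE h. h \<in> linear_maps K (dual K ?D \<otimes>\<^sub>K Y) (lin_hom K ?D Y) \<and>
    (\<forall>\<beta>\<in>carrier (dual K ?D). \<forall>y\<in>carrier Y. h (pt (dual K ?D) Y \<beta> y) = (\<lambda>z\<in>carrier ?D. \<beta> z \<odot>\<^bsub>Y\<^esub> y)))"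
  have v: "bilin K (dual K ?D) Y (lin_hom K ?D Y) (\<lambda>\<beta> y. \<lambda>z\<in>carrier ?D. \<beta> z \<odot>\<^bsub>Y\<^esub> y)"
    by (intro bilinI rank_one_lin [OF Y ED])
  note the = the_tensor_field_map [OF wbD(1) [OF EDD] EM(1) L v, OF refl, folded T_def]
  have Tl: "lin K (dual K ?D \<otimes>\<^sub>K Y) (lin_hom K ?D Y) T"
    using the(1) by (simp add: linear_maps_iff)
  let ?m = "tensor_map K Z Y (dual K ?D) Y (bidual_map K Z) (idm Y)"
  note b = bidual_map_bh [OF Z]
  note tm = EM(2,1) wbD(1) [OF EDD] EM(1) bhomD(1) [OF b] lin_idm [OF EM(1)]
  have m: "?m t \<in> carrier (dual K ?D \<otimes>\<^sup>A Y)"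
    by (rule tensor_map_cotensor [OF Z Y EDD Y bhomD(1) [OF b] lin_idm [OF EM(1)] bhomD(3) [OF b] _ t])
      (simp_all add: wbD(4) [OF Y])
  have eq: "cotensor_hom_l K A Z Y t = T (?m t)"
    using t m by (simp add: cotensor_hom_l_def hom_l_ident_def compose_eq cotensor_map_def T_def)
  show "cotensor_hom_l K A Z Y t \<in> linear_maps K ?D Y"
    using lin_closed [OF Tl cotensor_subset [OF m]] by (simp add: eq lin_hom_sel)
  assume z: "\<zeta> \<in> carrier ?D"
  have "T (?m t) \<zeta> = contract_l Z Y \<zeta> t"
    by (rule tensor_field_ext [OF EM(2,1,1) lin_comp [OF lin_comp [OF tensor_map_lin [OF tm] Tl] lin_eval [OF Y ED z]]
          contract_l(1) [OF Y Z z] _ cotensor_subset [OF t]])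
      (simp add: tensor_map_pure [OF tm] the(2) lin_closed [OF bhomD(1) [OF b]] contract_l(2) [OF Y Z] z, simp add: bidual_map_def z)
  then show "cotensor_hom_l K A Z Y t \<zeta> = contract_l Z Y \<zeta> t" by (simp add: eq)
qed
end

context
  fixes Y :: "('a, 'k, 'y) bimodule" and Z :: "('a, 'k, 'z) bimodule"
  assumes Y: "wb Y" and Z: "wb Z"
begin

private lemmas HM = wbD(1) [OF Y] wbD(1) [OF Z]
private lemmas HD = wb_dual [OF Z]
private lemmas HYZ = wb_tensor_field [OF Y Z] and HZY = wb_tensor_field [OF Z Y]

interpretation HZ': module K Z by (rule HM)
interpretation HY': module K Y by (rule HM)

text \<open>The actions on the factor \<open>Y\<close> pass through the contraction, while those on
  \<open>Z\<close> move to \<open>\<zeta>\<close> with the side exchanged. The last two equations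
  concern the inner actions, which agree on the cotensor subspace.\<close>

lemma contract_r_act:
  assumes \<zeta>: "\<zeta> \<in> carrier (dual K Z)" and a: "a \<in> carrier A" and t: "t \<in> carrier (Y \<otimes>\<^sub>K Z)"
  shows "contract_r Y Z \<zeta> (lact (Y \<otimes>\<^sub>K Z) a t) = lact Y a (contract_r Y Z \<zeta> t)"
    and "contract_r Y Z \<zeta> (ract (Y \<otimes>\<^sub>K Z) t a) = contract_r Y Z (lact (dual K Z) a \<zeta>) t"
    and "contract_r Y Z \<zeta> (tensor_map K Y Z Y Z (\<lambda>y. ract Y y a) (idm Z) t) = ract Y (contract_r Y Z \<zeta> t) a"
    and "contract_r Y Z \<zeta> (tensor_map K Y Z Y Z (idm Y) (lact Z a) t) = contract_r Y Z (ract (dual K Z) \<zeta> a) t"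
proof -
  note c = contract_r [OF Y Z \<zeta>] and d = dualD(2) [OF Z \<zeta>]
  show "contract_r Y Z \<zeta> (lact (Y \<otimes>\<^sub>K Z) a t) = lact Y a (contract_r Y Z \<zeta> t)"
    by (rule tensor_field_ext [OF HM HM(1) lin_comp [OF wbD(2) [OF HYZ a] c(1)] lin_comp [OF c(1) wbD(2) [OF Y a]] _ t])
      (simp add: a lact_pt [OF Y Z] c wbD(4) [OF Y] lin_smult [OF wbD(2) [OF Y a]] d)
  show "contract_r Y Z \<zeta> (ract (Y \<otimes>\<^sub>K Z) t a) = contract_r Y Z (lact (dual K Z) a \<zeta>) t"
    by (rule tensor_field_ext [OF HM HM(1) lin_comp [OF wbD(3) [OF HYZ a] c(1)] contract_r(1) [OF Y Z wbD(4) [OF HD a \<zeta>]] _ t])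
      (simp add: a ract_pt [OF Y Z] c wbD(5) [OF Z] contract_r(2) [OF Y Z wbD(4) [OF HD a \<zeta>]], simp add: dual_sel)
  show "contract_r Y Z \<zeta> (tensor_map K Y Z Y Z (\<lambda>y. ract Y y a) (idm Z) t) = ract Y (contract_r Y Z \<zeta> t) a"
    by (rule tensor_field_ext [OF HM HM(1) lin_comp [OF inner_ract_lin [OF Y Z a] c(1)] lin_comp [OF c(1) wbD(3) [OF Y a]] _ t])
      (simp add: a inner_ract_pt [OF Y Z] c wbD(5) [OF Y] lin_smult [OF wbD(3) [OF Y a]] d)
  show "contract_r Y Z \<zeta> (tensor_map K Y Z Y Z (idm Y) (lact Z a) t) = contract_r Y Z (ract (dual K Z) \<zeta> a) t"
    by (rule tensor_field_ext [OF HM HM(1) lin_comp [OF inner_lact_lin [OF Y Z a] c(1)] contract_r(1) [OF Y Z wbD(5) [OF HD a \<zeta>]] _ t])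
      (simp add: a inner_lact_pt [OF Y Z] c wbD(4) [OF Z] contract_r(2) [OF Y Z wbD(5) [OF HD a \<zeta>]], simp add: dual_sel)
qed

lemma contract_l_act:
  assumes \<zeta>: "\<zeta> \<in> carrier (dual K Z)" and a: "a \<in> carrier A" and t: "t \<in> carrier (Z \<otimes>\<^sub>K Y)"
  shows "contract_l Z Y \<zeta> (ract (Z \<otimes>\<^sub>K Y) t a) = ract Y (contract_l Z Y \<zeta> t) a"
    and "contract_l Z Y \<zeta> (lact (Z \<otimes>\<^sub>K Y) a t) = contract_l Z Y (ract (dual K Z) \<zeta> a) t"
    and "contract_l Z Y \<zeta> (tensor_map K Z Y Z Y (idm Z) (lact Y a) t) = lact Y a (contract_l Z Y \<zeta> t)"
    and "contract_l Z Y \<zeta> (tensor_map K Z Y Z Y (\<lambda>z. ract Z z a) (idm Y) t) = contract_l Z Y (lact (dual K Z) a \<zeta>) t"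
proof -
  note c = contract_l [OF Y Z \<zeta>] and d = dualD(2) [OF Z \<zeta>] and M = HM(2,1,1)
  show "contract_l Z Y \<zeta> (ract (Z \<otimes>\<^sub>K Y) t a) = ract Y (contract_l Z Y \<zeta> t) a"
    by (rule tensor_field_ext [OF M lin_comp [OF wbD(3) [OF HZY a] c(1)] lin_comp [OF c(1) wbD(3) [OF Y a]] _ t])
      (simp add: a ract_pt [OF Z Y] c wbD(5) [OF Y] lin_smult [OF wbD(3) [OF Y a]] d)
  show "contract_l Z Y \<zeta> (lact (Z \<otimes>\<^sub>K Y) a t) = contract_l Z Y (ract (dual K Z) \<zeta> a) t"
    by (rule tensor_field_ext [OF M lin_comp [OF wbD(2) [OF HZY a] c(1)] contract_l(1) [OF Y Z wbD(5) [OF HD a \<zeta>]] _ t])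
      (simp add: a lact_pt [OF Z Y] c wbD(4) [OF Z] contract_l(2) [OF Y Z wbD(5) [OF HD a \<zeta>]], simp add: dual_sel)
  show "contract_l Z Y \<zeta> (tensor_map K Z Y Z Y (idm Z) (lact Y a) t) = lact Y a (contract_l Z Y \<zeta> t)"
    by (rule tensor_field_ext [OF M lin_comp [OF inner_lact_lin [OF Z Y a] c(1)] lin_comp [OF c(1) wbD(2) [OF Y a]] _ t])
      (simp add: a inner_lact_pt [OF Z Y] c wbD(4) [OF Y] lin_smult [OF wbD(2) [OF Y a]] d)
  show "contract_l Z Y \<zeta> (tensor_map K Z Y Z Y (\<lambda>z. ract Z z a) (idm Y) t) = contract_l Z Y (lact (dual K Z) a \<zeta>) t"
    by (rule tensor_field_ext [OF M lin_comp [OF inner_ract_lin [OF Z Y a] c(1)] contract_l(1) [OF Y Z wbD(4) [OF HD a \<zeta>]] _ t])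
      (simp add: a inner_ract_pt [OF Z Y] c wbD(5) [OF Z] contract_l(2) [OF Y Z wbD(4) [OF HD a \<zeta>]], simp add: dual_sel)
qed

lemma cotensor_hom_r: "cotensor_hom_r K A Y Z \<in> bimod_hom K A (Y \<otimes>\<^sup>A Z) (hom_r K A (dual K Z) Y)"
proof -
  let ?D = "dual K Z" and ?C = "Y \<otimes>\<^sup>A Z"
  note C = wb_cotensor [OF Y Z] and H = wb_hom_r [OF HD Y] and app = cotensor_hom_r_apply [OF Y Z]
  note cl = lin_from_cotensor [OF Y Z contract_r(1) [OF Y Z]]
  interpret TC: module K ?C by (rule wbD(1) [OF C])
  \<comment> \<open>Contracting the equation that defines \<open>Y \<otimes>\<^sup>A Z\<close> with
    \<open>\<zeta>\<close> gives precisely right linearity of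
    \<open>\<zeta> \<mapsto> contract_r Y Z \<zeta> t\<close>.\<close>
  have mem: "cotensor_hom_r K A Y Z t \<in> carrier (hom_r K A ?D Y)" if t: "t \<in> carrier ?C" for t
  proof -
    have "contract_r Y Z (ract ?D \<zeta> a) t = ract Y (contract_r Y Z \<zeta> t) a"
      if "\<zeta> \<in> carrier ?D" "a \<in> carrier A" for \<zeta> a
      using contract_r_act(3,4) [OF that cotensor_subset [OF t]] t that(2) by (simp add: cotensor_iff)
    then show ?thesis
      by (simp add: hom_r_sel(1) app [OF t] wbD(5) [OF HD])
  qed
  have ext: "cotensor_hom_r K A Y Z s = f"
    if "s \<in> carrier ?C" "f \<in> carrier (hom_r K A ?D Y)" "\<And>\<zeta>. \<zeta> \<in> carrier ?D \<Longrightarrow> contract_r Y Z \<zeta> s = f \<zeta>" for s f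
    by (rule linear_maps_ext [OF app(1) [OF that(1)] hom_rD(2) [OF HD Y that(2)]]) (simp add: app(2) that)
  interpret TH: module K "hom_r K A ?D Y" by (rule wbD(1) [OF H])
  have "lin K ?C (hom_r K A ?D Y) (cotensor_hom_r K A Y Z)"
  proof (rule linI)
    show "cotensor_hom_r K A Y Z (s \<oplus>\<^bsub>?C\<^esub> t) = cotensor_hom_r K A Y Z s \<oplus>\<^bsub>hom_r K A ?D Y\<^esub> cotensor_hom_r K A Y Z t"
      if "s \<in> carrier ?C" "t \<in> carrier ?C" for s t
      by (rule ext) (simp_all add: that mem, simp add: hom_r_sel(3) app that lin_add [OF cl])
    show "cotensor_hom_r K A Y Z (c \<odot>\<^bsub>?C\<^esub> t) = c \<odot>\<^bsub>hom_r K A ?D Y\<^esub> cotensor_hom_r K A Y Z t"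
      if "c \<in> carrier K" "t \<in> carrier ?C" for c t
      by (rule ext) (simp_all add: that mem, simp add: hom_r_sel(4) app that lin_smult [OF cl])
  qed (rule mem)
  moreover have "cotensor_hom_r K A Y Z (lact ?C a t) = lact (hom_r K A ?D Y) a (cotensor_hom_r K A Y Z t)"
    if a: "a \<in> carrier A" and t: "t \<in> carrier ?C" for a t
    by (rule ext) (simp_all add: wbD(4,5) [OF C] wbD(4,5) [OF H] mem a t, simp add: hom_r_sel(5,6) app(2) [OF t] cotensor_sel contract_r_act(1,2) a cotensor_subset [OF t] wbD(4) [OF HD])
  moreover have "cotensor_hom_r K A Y Z (ract ?C t a) = ract (hom_r K A ?D Y) (cotensor_hom_r K A Y Z t) a"
    if a: "a \<in> carrier A" and t: "t \<in> carrier ?C" for a t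
    by (rule ext) (simp_all add: wbD(4,5) [OF C] wbD(4,5) [OF H] mem a t, simp add: hom_r_sel(5,6) app(2) [OF t] cotensor_sel contract_r_act(1,2) a cotensor_subset [OF t] wbD(4) [OF HD])
  ultimately show ?thesis
    by (auto simp: bimod_hom_iff cotensor_hom_r_def intro: bhomI)
qed

text \<open>Here contraction acts on the left factor; the same subspace equation expresses left
  linearity in the functional.\<close>

lemma cotensor_hom_l: "cotensor_hom_l K A Z Y \<in> bimod_hom K A (Z \<otimes>\<^sup>A Y) (hom_l K A (dual K Z) Y)"
proof -
  let ?D = "dual K Z" and ?C = "Z \<otimes>\<^sup>A Y"
  note C = wb_cotensor [OF Z Y] and H = wb_hom_l [OF HD Y] and app = cotensor_hom_l_apply [OF Y Z]
  note cl = lin_from_cotensor [OF Z Y contract_l(1) [OF Y Z]]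
  interpret TC: module K ?C by (rule wbD(1) [OF C])
  have mem: "cotensor_hom_l K A Z Y t \<in> carrier (hom_l K A ?D Y)" if t: "t \<in> carrier ?C" for t
  proof -
    have "contract_l Z Y (lact ?D a \<zeta>) t = lact Y a (contract_l Z Y \<zeta> t)"
      if "\<zeta> \<in> carrier ?D" "a \<in> carrier A" for \<zeta> a
      using contract_l_act(3,4) [OF that cotensor_subset [OF t]] t that(2) by (simp add: cotensor_iff)
    then show ?thesis
      by (simp add: hom_l_sel(1) app [OF t] wbD(4) [OF HD])
  qed
  have ext: "cotensor_hom_l K A Z Y s = f"
    if "s \<in> carrier ?C" "f \<in> carrier (hom_l K A ?D Y)" "\<And>\<zeta>. \<zeta> \<in> carrier ?D \<Longrightarrow> contract_l Z Y \<zeta> s = f \<zeta>" for s f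
    by (rule linear_maps_ext [OF app(1) [OF that(1)] hom_lD(2) [OF HD Y that(2)]]) (simp add: app(2) that)
  interpret TH: module K "hom_l K A ?D Y" by (rule wbD(1) [OF H])
  have "lin K ?C (hom_l K A ?D Y) (cotensor_hom_l K A Z Y)"
  proof (rule linI)
    show "cotensor_hom_l K A Z Y (s \<oplus>\<^bsub>?C\<^esub> t) = cotensor_hom_l K A Z Y s \<oplus>\<^bsub>hom_l K A ?D Y\<^esub> cotensor_hom_l K A Z Y t"
      if "s \<in> carrier ?C" "t \<in> carrier ?C" for s t
      by (rule ext) (simp_all add: that mem, simp add: hom_l_sel(3) app that lin_add [OF cl])
    show "cotensor_hom_l K A Z Y (c \<odot>\<^bsub>?C\<^esub> t) = c \<odot>\<^bsub>hom_l K A ?D Y\<^esub> cotensor_hom_l K A Z Y t"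
      if "c \<in> carrier K" "t \<in> carrier ?C" for c t
      by (rule ext) (simp_all add: that mem, simp add: hom_l_sel(4) app that lin_smult [OF cl])
  qed (rule mem)
  moreover have "cotensor_hom_l K A Z Y (lact ?C a t) = lact (hom_l K A ?D Y) a (cotensor_hom_l K A Z Y t)"
    if a: "a \<in> carrier A" and t: "t \<in> carrier ?C" for a t
    by (rule ext) (simp_all add: wbD(4,5) [OF C] wbD(4,5) [OF H] mem a t, simp add: hom_l_sel(5,6) app(2) [OF t] cotensor_sel contract_l_act(1,2) a cotensor_subset [OF t] wbD(5) [OF HD])
  moreover have "cotensor_hom_l K A Z Y (ract ?C t a) = ract (hom_l K A ?D Y) (cotensor_hom_l K A Z Y t) a"
    if a: "a \<in> carrier A" and t: "t \<in> carrier ?C" for a t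
    by (rule ext) (simp_all add: wbD(4,5) [OF C] wbD(4,5) [OF H] mem a t, simp add: hom_l_sel(5,6) app(2) [OF t] cotensor_sel contract_l_act(1,2) a cotensor_subset [OF t] wbD(5) [OF HD])
  ultimately show ?thesis
    by (auto simp: bimod_hom_iff cotensor_hom_l_def intro: bhomI)
qed

context
  assumes K: "field K" and fd: "finite_dim K Z"
begin

text \<open>A tensor is recovered from its contractions with the dual family as
  \<open>\<Sum>b. contract_r Y Z (\<beta> b) t \<otimes> b\<close>, and these contractions are
  values of the identification.\<close>

lemma cotensor_hom_r_inj: "inj_on (cotensor_hom_r K A Y Z) (carrier (Y \<otimes>\<^sup>A Z))"
proof -
  obtain B \<beta> where B: "finite B" "B \<subseteq> carrier Z" and \<beta>': "\<forall>b\<in>B. \<beta> b \<in> carrier (dual K Z)"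
    and sum: "\<forall>z\<in>carrier Z. (\<Oplus>\<^bsub>Z\<^esub>b\<in>B. \<beta> b z \<odot>\<^bsub>Z\<^esub> b) = z"
    using finite_dim_dual_basis [OF K HM(2) fd] unfolding dual_sel by blast
  note \<beta> = bspec [OF \<beta>']
  note YZ = wbD(1) [OF HYZ] and p = pt_bilin [OF HM]
  interpret TT: module K "Y \<otimes>\<^sub>K Z" by (rule YZ)
  have l: "lin K (Y \<otimes>\<^sub>K Z) (Y \<otimes>\<^sub>K Z) (\<lambda>t. pt Y Z (contract_r Y Z (\<beta> b) t) b)" if "b \<in> B" for b
    using that B by (intro lin_comp [OF contract_r(1) [OF Y Z \<beta>] bilinD(2) [OF p]]) auto
  \<comment> \<open>The reconstruction is linear in \<open>t\<close>. On
    \<open>y \<otimes> z\<close> the scalars \<open>\<beta> b z\<close> move across the tensor sign,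
    and the sum over \<open>B\<close> rebuilds \<open>z\<close>.\<close>
  have rec: "(\<Oplus>\<^bsub>Y \<otimes>\<^sub>K Z\<^esub>b\<in>B. pt Y Z (contract_r Y Z (\<beta> b) t) b) = t" if t: "t \<in> carrier (Y \<otimes>\<^sub>K Z)" for t
  proof (rule tensor_field_ext [OF HM YZ lin_finsum_fun [OF YZ YZ B(1) l] lin_ident _ t])
    fix y z assume y: "y \<in> carrier Y" and z: "z \<in> carrier Z"
    have "(\<Oplus>\<^bsub>Y \<otimes>\<^sub>K Z\<^esub>b\<in>B. pt Y Z (contract_r Y Z (\<beta> b) (pt Y Z y z)) b) = (\<Oplus>\<^bsub>Y \<otimes>\<^sub>K Z\<^esub>b\<in>B. pt Y Z y (\<beta> b z \<odot>\<^bsub>Z\<^esub> b))"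
    proof (rule TT.finsum_cong')
      fix b assume b: "b \<in> B"
      then have "b \<in> carrier Z" "\<beta> b z \<in> carrier K" using B dualD(2) [OF Z \<beta> z] by auto
      then show "pt Y Z (contract_r Y Z (\<beta> b) (pt Y Z y z)) b = pt Y Z y (\<beta> b z \<odot>\<^bsub>Z\<^esub> b)"
        by (simp add: contract_r(2) [OF Y Z \<beta>] b y z lin_smult [OF bilinD(2) [OF p]] lin_smult [OF bilinD(1) [OF p]])
    qed (use B dualD(2) [OF Z \<beta> z] in \<open>auto intro!: pt_closed HM y\<close>)
    also have "\<dots> = pt Y Z y (\<Oplus>\<^bsub>Z\<^esub>b\<in>B. \<beta> b z \<odot>\<^bsub>Z\<^esub> b)"
      by (rule lin_finsum [OF HM(2) YZ bilinD(1) [OF p y] B(1), symmetric]) (use B dualD(2) [OF Z \<beta> z] in auto)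
    finally show "(\<Oplus>\<^bsub>Y \<otimes>\<^sub>K Z\<^esub>b\<in>B. pt Y Z (contract_r Y Z (\<beta> b) (pt Y Z y z)) b) = pt Y Z y z"
      by (simp add: sum z)
  qed
  show ?thesis
  proof (rule inj_onI)
    fix s t assume s: "s \<in> carrier (Y \<otimes>\<^sup>A Z)" and t: "t \<in> carrier (Y \<otimes>\<^sup>A Z)"
      and eq: "cotensor_hom_r K A Y Z s = cotensor_hom_r K A Y Z t"
    \<comment> \<open>Equal identifications have equal values at each \<open>\<beta> b\<close>,
      hence equal coefficients in the reconstruction.\<close>
    have e: "contract_r Y Z (\<beta> b) s = contract_r Y Z (\<beta> b) t" if "b \<in> B" for b
      using cotensor_hom_r_apply(2) [OF Y Z s \<beta> [OF that]] cotensor_hom_r_apply(2) [OF Y Z t \<beta> [OF that]] eq by simp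
    have "(\<Oplus>\<^bsub>Y \<otimes>\<^sub>K Z\<^esub>b\<in>B. pt Y Z (contract_r Y Z (\<beta> b) s) b) = (\<Oplus>\<^bsub>Y \<otimes>\<^sub>K Z\<^esub>b\<in>B. pt Y Z (contract_r Y Z (\<beta> b) t) b)"
      by (rule TT.finsum_cong') (use e lin_closed [OF l cotensor_subset [OF t]] in auto)
    then show "s = t" using rec [OF cotensor_subset [OF s]] rec [OF cotensor_subset [OF t]] by simp
  qed
qed

lemma cotensor_hom_l_inj: "inj_on (cotensor_hom_l K A Z Y) (carrier (Z \<otimes>\<^sup>A Y))"
proof -
  obtain B \<beta> where B: "finite B" "B \<subseteq> carrier Z" and \<beta>': "\<forall>b\<in>B. \<beta> b \<in> carrier (dual K Z)"
    and sum: "\<forall>z\<in>carrier Z. (\<Oplus>\<^bsub>Z\<^esub>b\<in>B. \<beta> b z \<odot>\<^bsub>Z\<^esub> b) = z"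
    using finite_dim_dual_basis [OF K HM(2) fd] unfolding dual_sel by blast
  note \<beta> = bspec [OF \<beta>']
  note ZY = wbD(1) [OF HZY] and p = pt_bilin [OF HM(2,1)]
  interpret TT: module K "Z \<otimes>\<^sub>K Y" by (rule ZY)
  have l: "lin K (Z \<otimes>\<^sub>K Y) (Z \<otimes>\<^sub>K Y) (\<lambda>t. pt Z Y b (contract_l Z Y (\<beta> b) t))" if "b \<in> B" for b
    using that B by (intro lin_comp [OF contract_l(1) [OF Y Z \<beta>] bilinD(1) [OF p]]) auto
  have rec: "(\<Oplus>\<^bsub>Z \<otimes>\<^sub>K Y\<^esub>b\<in>B. pt Z Y b (contract_l Z Y (\<beta> b) t)) = t" if t: "t \<in> carrier (Z \<otimes>\<^sub>K Y)" for t
  proof (rule tensor_field_ext [OF HM(2,1) ZY lin_finsum_fun [OF ZY ZY B(1) l] lin_ident _ t])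
    fix z y assume z: "z \<in> carrier Z" and y: "y \<in> carrier Y"
    have "(\<Oplus>\<^bsub>Z \<otimes>\<^sub>K Y\<^esub>b\<in>B. pt Z Y b (contract_l Z Y (\<beta> b) (pt Z Y z y))) = (\<Oplus>\<^bsub>Z \<otimes>\<^sub>K Y\<^esub>b\<in>B. pt Z Y (\<beta> b z \<odot>\<^bsub>Z\<^esub> b) y)"
    proof (rule TT.finsum_cong')
      fix b assume b: "b \<in> B"
      then have "b \<in> carrier Z" "\<beta> b z \<in> carrier K" using B dualD(2) [OF Z \<beta> z] by auto
      then show "pt Z Y b (contract_l Z Y (\<beta> b) (pt Z Y z y)) = pt Z Y (\<beta> b z \<odot>\<^bsub>Z\<^esub> b) y"
        by (simp add: contract_l(2) [OF Y Z \<beta>] b y z lin_smult [OF bilinD(2) [OF p]] lin_smult [OF bilinD(1) [OF p]])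
    qed (use B dualD(2) [OF Z \<beta> z] in \<open>auto intro!: pt_closed HM y\<close>)
    also have "\<dots> = pt Z Y (\<Oplus>\<^bsub>Z\<^esub>b\<in>B. \<beta> b z \<odot>\<^bsub>Z\<^esub> b) y"
      by (rule lin_finsum [OF HM(2) ZY bilinD(2) [OF p y] B(1), symmetric]) (use B dualD(2) [OF Z \<beta> z] in auto)
    finally show "(\<Oplus>\<^bsub>Z \<otimes>\<^sub>K Y\<^esub>b\<in>B. pt Z Y b (contract_l Z Y (\<beta> b) (pt Z Y z y))) = pt Z Y z y"
      by (simp add: sum z)
  qed
  show ?thesis
  proof (rule inj_onI)
    fix s t assume s: "s \<in> carrier (Z \<otimes>\<^sup>A Y)" and t: "t \<in> carrier (Z \<otimes>\<^sup>A Y)"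
      and eq: "cotensor_hom_l K A Z Y s = cotensor_hom_l K A Z Y t"
    have e: "contract_l Z Y (\<beta> b) s = contract_l Z Y (\<beta> b) t" if "b \<in> B" for b
      using cotensor_hom_l_apply(2) [OF Y Z s \<beta> [OF that]] cotensor_hom_l_apply(2) [OF Y Z t \<beta> [OF that]] eq by simp
    have "(\<Oplus>\<^bsub>Z \<otimes>\<^sub>K Y\<^esub>b\<in>B. pt Z Y b (contract_l Z Y (\<beta> b) s)) = (\<Oplus>\<^bsub>Z \<otimes>\<^sub>K Y\<^esub>b\<in>B. pt Z Y b (contract_l Z Y (\<beta> b) t))"
      by (rule TT.finsum_cong') (use e lin_closed [OF l cotensor_subset [OF t]] in auto)
    then show "s = t" using rec [OF cotensor_subset [OF s]] rec [OF cotensor_subset [OF t]] by simp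
  qed
qed

end

end

text \<open>The inverse is junk outside the image of \<open>c\<close>; here \<open>p\<close> itself provides the preimages.\<close>

lemma inv_on_comp_eqI:
  assumes "p \<in> extensional (carrier M)" "inj_on c (carrier N)"
    and "\<And>x. x \<in> carrier M \<Longrightarrow> p x \<in> carrier N" "\<And>x. x \<in> carrier M \<Longrightarrow> d (e x) \<in> carrier P"
    and "\<And>x. x \<in> carrier M \<Longrightarrow> c (p x) = d (e x)"
  shows "comp_on M (inv_on N P c) (comp_on M d e) = p"
proof (rule extensionalityI [of _ "carrier M"])
  show "comp_on M (inv_on N P c) (comp_on M d e) x = p x" if "x \<in> carrier M" for x
    using assms(2-5) that by (simp add: compose_eq inv_into_f_eq)
qed (use assms(1) in auto)

section \<open>Comparison of the lax structures with the maps on tensors\<close>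

context
  fixes X :: "('a, 'k, 'x) bimodule" and Y :: "('a, 'k, 'y) bimodule" and Z :: "('a, 'k, 'z) bimodule"
  assumes X: "wb X" and Y: "wb Y" and Z: "wb Z" and K: "field K"
begin

private lemmas NM = wbD(1) [OF X] wbD(1) [OF Y] wbD(1) [OF Z]

interpretation NX: module K X by (rule NM)
interpretation NZ: module K Z by (rule NM)

lemma delta_r_dual_eq:
  assumes fd: "finite_dim K Z"
  shows "delta_r_dual K A X Y Z = partial_l K A X Y Z"
proof -
  let ?D = "dual K Z" and ?c = "cotensor_hom_r K A Y Z" and ?p = "partial_l K A X Y Z"
  let ?c' = "cotensor_hom_r K A (X \<otimes>\<^sub>A Y) Z"
  note D = wb_dual [OF Z] and XoY = wb_tensor_over [OF X Y] and YcZ = wb_cotensor [OF Y Z]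
  note H = wb_hom_r [OF D Y] and H' = wb_hom_r [OF D XoY]
  note c = cotensor_hom_r [OF Y Z] and c' = cotensor_hom_r [OF XoY Z]
  note tom = tensor_over_map [OF X YcZ X H bhom_idm [OF X] bimod_hom_bh [OF c]]
  note del = delta_r [OF X Y D] and p = partial_l [OF X Y Z] and b = cl_bilin [OF X Y]
  let ?e = "tensor_over_map K A X (Y \<otimes>\<^sup>A Z) X (hom_r K A ?D Y) (idm X) ?c"
  note pl = bimod_hom_lin [OF p(1)] and el = bimod_hom_lin [OF tom(1)] and dl = bimod_hom_lin [OF del(1)]
  \<comment> \<open>The claim with the inverse identification moved to the other side, where it
    becomes an equality of linear maps and can be checked on classes.\<close>
  have key: "?c' (?p u) = delta_r K A ?D X Y (?e u)" if u: "u \<in> carrier (X \<otimes>\<^sub>A (Y \<otimes>\<^sup>A Z))" for u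
  proof (rule tensor_over_ext [OF X YcZ wbD(1) [OF H'] lin_comp [OF pl bimod_hom_lin [OF c']] lin_comp [OF el dl] _ u])
    fix x t assume x: "x \<in> carrier X" and t: "t \<in> carrier (Y \<otimes>\<^sup>A Z)"
    note ct = lin_closed [OF bimod_hom_lin [OF c] t]
    note xt = cl_closed [OF X YcZ x t]
    have "?c' (?p (cl X (Y \<otimes>\<^sup>A Z) x t)) = delta_r K A ?D X Y (cl X (hom_r K A ?D Y) x (?c t))"
    proof (rule linear_maps_ext)
      show "?c' (?p (cl X (Y \<otimes>\<^sup>A Z) x t)) \<in> linear_maps K ?D (X \<otimes>\<^sub>A Y)"
        by (rule cotensor_hom_r_apply(1) [OF XoY Z lin_closed [OF pl xt]])
      show "delta_r K A ?D X Y (cl X (hom_r K A ?D Y) x (?c t)) \<in> linear_maps K ?D (X \<otimes>\<^sub>A Y)"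
        by (rule hom_rD(2) [OF D XoY lin_closed [OF dl cl_closed [OF X H x ct]]])
      fix \<zeta> assume z: "\<zeta> \<in> carrier ?D"
      note k = contract_r [OF Y Z z] and k' = contract_r [OF XoY Z z]
      \<comment> \<open>On \<open>y \<otimes> z\<close> both sides equal
        \<open>\<zeta>(z) [x \<otimes> y]\<close>. As linear maps on all of
        \<open>Y \<otimes>\<^sub>K Z\<close> they then agree at the given \<open>t\<close>.\<close>
      have "contract_r (X \<otimes>\<^sub>A Y) Z \<zeta> (tensor_left Y Z (X \<otimes>\<^sub>A Y) (cl X Y) x t) = cl X Y x (contract_r Y Z \<zeta> t)"
        by (rule tensor_field_ext [OF NM(2,3) wbD(1) [OF XoY]
              lin_comp [OF bilinD(1) [OF tensor_left_bilin [OF NM wbD(1) [OF XoY] b] x] k'(1)]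
              lin_comp [OF k(1) bilinD(1) [OF b x]] _ cotensor_subset [OF t]])
          (simp add: tensor_left_pt [OF NM wbD(1) [OF XoY] b] x k k' cl_closed [OF X Y] lin_smult [OF bilinD(1) [OF b]]
            dualD(2) [OF Z z])
      then show "?c' (?p (cl X (Y \<otimes>\<^sup>A Z) x t)) \<zeta> = delta_r K A ?D X Y (cl X (hom_r K A ?D Y) x (?c t)) \<zeta>"
        by (simp add: cotensor_hom_r_apply(2) [OF XoY Z lin_closed [OF pl xt, unfolded p(2) [OF x t]] z] p(2) x t del(2) ct z
          cotensor_hom_r_apply(2) [OF Y Z t z])
    qed
    then show "?c' (?p (cl X (Y \<otimes>\<^sup>A Z) x t)) = delta_r K A ?D X Y (?e (cl X (Y \<otimes>\<^sup>A Z) x t))"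
      by (simp add: tom(2) x t)
  qed
  show ?thesis
    unfolding delta_r_dual_def
  \<comment> \<open>It is the last factor \<open>Z\<close> that is dualised in
    \<open>(X \<otimes>\<^sub>A Y) \<otimes>\<^sup>A Z\<close>, so injectivity draws on a dual basis
    of \<open>Z\<close>.\<close>
  proof (rule inv_on_comp_eqI [OF _ cotensor_hom_r_inj [OF XoY Z K fd]])
    show "?p \<in> extensional (carrier (X \<otimes>\<^sub>A (Y \<otimes>\<^sup>A Z)))" using p(1) by (simp add: bimod_hom_iff)
  qed (simp_all add: key lin_closed [OF pl] lin_closed [OF dl] lin_closed [OF el])
qed

lemma delta_l_dual_eq:
  assumes fd: "finite_dim K X"
  shows "delta_l_dual K A X Y Z = partial_r K A X Y Z"
proof -
  let ?D = "dual K X" and ?c = "cotensor_hom_l K A X Y" and ?p = "partial_r K A X Y Z"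
  let ?c' = "cotensor_hom_l K A X (Y \<otimes>\<^sub>A Z)"
  note D = wb_dual [OF X] and YoZ = wb_tensor_over [OF Y Z] and XcY = wb_cotensor [OF X Y]
  note H = wb_hom_l [OF D Y] and H' = wb_hom_l [OF D YoZ]
  note c = cotensor_hom_l [OF Y X] and c' = cotensor_hom_l [OF YoZ X]
  note tom = tensor_over_map [OF XcY Z H Z bimod_hom_bh [OF c] bhom_idm [OF Z]]
  note del = delta_l [OF Y Z D] and p = partial_r [OF X Y Z] and b = cl_bilin [OF Y Z]
  let ?e = "tensor_over_map K A (X \<otimes>\<^sup>A Y) Z (hom_l K A ?D Y) Z ?c (idm Z)"
  note pl = bimod_hom_lin [OF p(1)] and el = bimod_hom_lin [OF tom(1)] and dl = bimod_hom_lin [OF del(1)]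
  have key: "?c' (?p u) = delta_l K A ?D Y Z (?e u)" if u: "u \<in> carrier ((X \<otimes>\<^sup>A Y) \<otimes>\<^sub>A Z)" for u
  proof (rule tensor_over_ext [OF XcY Z wbD(1) [OF H'] lin_comp [OF pl bimod_hom_lin [OF c']] lin_comp [OF el dl] _ u])
    fix s z assume s: "s \<in> carrier (X \<otimes>\<^sup>A Y)" and z: "z \<in> carrier Z"
    note cs = lin_closed [OF bimod_hom_lin [OF c] s]
    note sz = cl_closed [OF XcY Z s z]
    have "?c' (?p (cl (X \<otimes>\<^sup>A Y) Z s z)) = delta_l K A ?D Y Z (cl (hom_l K A ?D Y) Z (?c s) z)"
    proof (rule linear_maps_ext)
      show "?c' (?p (cl (X \<otimes>\<^sup>A Y) Z s z)) \<in> linear_maps K ?D (Y \<otimes>\<^sub>A Z)"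
        by (rule cotensor_hom_l_apply(1) [OF YoZ X lin_closed [OF pl sz]])
      show "delta_l K A ?D Y Z (cl (hom_l K A ?D Y) Z (?c s) z) \<in> linear_maps K ?D (Y \<otimes>\<^sub>A Z)"
        by (rule hom_lD(2) [OF D YoZ lin_closed [OF dl cl_closed [OF H Z cs z]]])
      fix \<xi> assume x: "\<xi> \<in> carrier ?D"
      note k = contract_l [OF Y X x] and k' = contract_l [OF YoZ X x]
      \<comment> \<open>The contraction acts in the factor \<open>X\<close> and pairing with
        \<open>z\<close> in the factor \<open>Y\<close>, so the two operations commute.\<close>
      have "contract_l X (Y \<otimes>\<^sub>A Z) \<xi> (tensor_right X Y (Y \<otimes>\<^sub>A Z) (cl Y Z) s z) = cl Y Z (contract_l X Y \<xi> s) z"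
        by (rule tensor_field_ext [OF NM(1,2) wbD(1) [OF YoZ]
              lin_comp [OF bilinD(2) [OF tensor_right_bilin [OF NM wbD(1) [OF YoZ] b] z] k'(1)]
              lin_comp [OF k(1) bilinD(2) [OF b z]] _ cotensor_subset [OF s]])
          (simp add: tensor_right_pt [OF NM wbD(1) [OF YoZ] b] z k k' cl_closed [OF Y Z] lin_smult [OF bilinD(2) [OF b]]
            dualD(2) [OF X x])
      then show "?c' (?p (cl (X \<otimes>\<^sup>A Y) Z s z)) \<xi> = delta_l K A ?D Y Z (cl (hom_l K A ?D Y) Z (?c s) z) \<xi>"
        by (simp add: cotensor_hom_l_apply(2) [OF YoZ X lin_closed [OF pl sz, unfolded p(2) [OF s z]] x] p(2) s z del(2) cs x
          cotensor_hom_l_apply(2) [OF Y X s x])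
    qed
    then show "?c' (?p (cl (X \<otimes>\<^sup>A Y) Z s z)) = delta_l K A ?D Y Z (?e (cl (X \<otimes>\<^sup>A Y) Z s z))"
      by (simp add: tom(2) s z)
  qed
  show ?thesis
    unfolding delta_l_dual_def
  proof (rule inv_on_comp_eqI [OF _ cotensor_hom_l_inj [OF YoZ X K fd]])
    show "?p \<in> extensional (carrier ((X \<otimes>\<^sup>A Y) \<otimes>\<^sub>A Z))" using p(1) by (simp add: bimod_hom_iff)
  qed (simp_all add: key lin_closed [OF pl] lin_closed [OF dl] lin_closed [OF el])
qed

lemma partial_l_tilde_eq: "partial_l_tilde K A X Y Z = partial_l K A X Y Z"
  by (rule tensor_over_hom_eqI [OF X wb_cotensor [OF Y Z] wb_cotensor [OF wb_tensor_over [OF X Y] Z]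
      partial_l_tilde(1) [OF X Y Z] partial_l(1) [OF X Y Z]])
    (simp add: partial_l_tilde(2) [OF X Y Z] partial_l(2) [OF X Y Z])

lemma partial_r_tilde_eq: "partial_r_tilde K A X Y Z = partial_r K A X Y Z"
  by (rule tensor_over_hom_eqI [OF wb_cotensor [OF X Y] Z wb_cotensor [OF X wb_tensor_over [OF Y Z]]
      partial_r_tilde(1) [OF X Y Z] partial_r(1) [OF X Y Z]])
    (simp add: partial_r_tilde(2) [OF X Y Z] partial_r(2) [OF X Y Z])

text \<open>The sums are formed in the tensor products over \<open>K\<close>, since their individual
  terms need not lie in the cotensor subspaces. For fixed \<open>x\<close> the value is a linear
  function on the ambient space and may be applied term by term.\<close>

lemma partial_l_sum:
  assumes x: "x \<in> carrier X" and I: "finite I" and y: "y \<in> I \<rightarrow> carrier Y" and z: "z \<in> I \<rightarrow> carrier Z"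
    and t: "(\<Oplus>\<^bsub>Y \<otimes>\<^sub>K Z\<^esub>i\<in>I. pt Y Z (y i) (z i)) \<in> carrier (Y \<otimes>\<^sup>A Z)"
  shows "partial_l K A X Y Z (cl X (Y \<otimes>\<^sup>A Z) x (\<Oplus>\<^bsub>Y \<otimes>\<^sub>K Z\<^esub>i\<in>I. pt Y Z (y i) (z i))) =
    (\<Oplus>\<^bsub>(X \<otimes>\<^sub>A Y) \<otimes>\<^sub>K Z\<^esub>i\<in>I. pt (X \<otimes>\<^sub>A Y) Z (cl X Y x (y i)) (z i))"
proof -
  note XoY = wb_tensor_over [OF X Y] and b = cl_bilin [OF X Y]
  note l = bilinD(1) [OF tensor_left_bilin [OF NM wbD(1) [OF XoY] b] x]
  note W = wbD(1) [OF wb_tensor_field [OF XoY Z]]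
  interpret TW: module K "(X \<otimes>\<^sub>A Y) \<otimes>\<^sub>K Z" by (rule W)
  have "partial_l K A X Y Z (cl X (Y \<otimes>\<^sup>A Z) x (\<Oplus>\<^bsub>Y \<otimes>\<^sub>K Z\<^esub>i\<in>I. pt Y Z (y i) (z i))) =
      (\<Oplus>\<^bsub>(X \<otimes>\<^sub>A Y) \<otimes>\<^sub>K Z\<^esub>i\<in>I. tensor_left Y Z (X \<otimes>\<^sub>A Y) (cl X Y) x (pt Y Z (y i) (z i)))"
    unfolding partial_l(2) [OF X Y Z x t]
    by (rule lin_finsum [OF wbD(1) [OF wb_tensor_field [OF Y Z]] W l I]) (use y z in \<open>auto intro!: pt_closed NM\<close>)
  also have "\<dots> = (\<Oplus>\<^bsub>(X \<otimes>\<^sub>A Y) \<otimes>\<^sub>K Z\<^esub>i\<in>I. pt (X \<otimes>\<^sub>A Y) Z (cl X Y x (y i)) (z i))"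
    using y z x by (intro TW.finsum_cong')
      (auto simp: tensor_left_pt [OF NM wbD(1) [OF XoY] b] Pi_iff intro!: pt_closed NM wbD(1) [OF XoY] cl_closed [OF X Y])
  finally show ?thesis .
qed

lemma partial_r_sum:
  assumes z: "z \<in> carrier Z" and I: "finite I" and x: "x \<in> I \<rightarrow> carrier X" and y: "y \<in> I \<rightarrow> carrier Y"
    and s: "(\<Oplus>\<^bsub>X \<otimes>\<^sub>K Y\<^esub>i\<in>I. pt X Y (x i) (y i)) \<in> carrier (X \<otimes>\<^sup>A Y)"
  shows "partial_r K A X Y Z (cl (X \<otimes>\<^sup>A Y) Z (\<Oplus>\<^bsub>X \<otimes>\<^sub>K Y\<^esub>i\<in>I. pt X Y (x i) (y i)) z) =
    (\<Oplus>\<^bsub>X \<otimes>\<^sub>K (Y \<otimes>\<^sub>A Z)\<^esub>i\<in>I. pt X (Y \<otimes>\<^sub>A Z) (x i) (cl Y Z (y i) z))"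
proof -
  note YoZ = wb_tensor_over [OF Y Z] and b = cl_bilin [OF Y Z]
  note l = bilinD(2) [OF tensor_right_bilin [OF NM wbD(1) [OF YoZ] b] z]
  note W = wbD(1) [OF wb_tensor_field [OF X YoZ]]
  interpret TW: module K "X \<otimes>\<^sub>K (Y \<otimes>\<^sub>A Z)" by (rule W)
  have "partial_r K A X Y Z (cl (X \<otimes>\<^sup>A Y) Z (\<Oplus>\<^bsub>X \<otimes>\<^sub>K Y\<^esub>i\<in>I. pt X Y (x i) (y i)) z) =
      (\<Oplus>\<^bsub>X \<otimes>\<^sub>K (Y \<otimes>\<^sub>A Z)\<^esub>i\<in>I. tensor_right X Y (Y \<otimes>\<^sub>A Z) (cl Y Z) (pt X Y (x i) (y i)) z)"
    unfolding partial_r(2) [OF X Y Z s z]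
    by (rule lin_finsum [OF wbD(1) [OF wb_tensor_field [OF X Y]] W l I]) (use x y in \<open>auto intro!: pt_closed NM\<close>)
  also have "\<dots> = (\<Oplus>\<^bsub>X \<otimes>\<^sub>K (Y \<otimes>\<^sub>A Z)\<^esub>i\<in>I. pt X (Y \<otimes>\<^sub>A Z) (x i) (cl Y Z (y i) z))"
    using x y z by (intro TW.finsum_cong')
      (auto simp: tensor_right_pt [OF NM wbD(1) [OF YoZ] b] Pi_iff intro!: pt_closed NM wbD(1) [OF YoZ] cl_closed [OF Y Z])
  finally show ?thesis .
qed

end

end

theorem proposition6p2:
  fixes K :: "'k ring" and A :: "('k, 'a) module"
    and X :: "('a, 'k, 'x) bimodule" and Y :: "('a, 'k, 'y) bimodule" and Z :: "('a, 'k, 'z) bimodule"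
  assumes "algebraically_closed K"
    and "fd_algebra K A"
    and "fd_bimodule K A X" and "fd_bimodule K A Y" and "fd_bimodule K A Z"
  shows "partial_r K A X Y Z = delta_l_dual K A X Y Z \<and>
      delta_l_dual K A X Y Z = partial_r_tilde K A X Y Z \<and>
      partial_l K A X Y Z = delta_r_dual K A X Y Z \<and>
      delta_r_dual K A X Y Z = partial_l_tilde K A X Y Z \<and>
      (\<forall>(n::nat) x y z t. x \<in> {..<n} \<rightarrow> carrier X \<and> y \<in> {..<n} \<rightarrow> carrier Y \<and> z \<in> carrier Z \<and>
          t = (\<Oplus>\<^bsub>tensor_field K X Y\<^esub>i\<in>{..<n}. pure_tensor K X Y (x i) (y i)) \<and>
          t \<in> carrier (cotensor K A X Y) \<longrightarrow>
          partial_r K A X Y Z (tensor_class K A (cotensor K A X Y) Z t z) =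
          (\<Oplus>\<^bsub>tensor_field K X (tensor_over K A Y Z)\<^esub>i\<in>{..<n}.
             pure_tensor K X (tensor_over K A Y Z) (x i) (tensor_class K A Y Z (y i) z))) \<and>
      (\<forall>(n::nat) x y z t. x \<in> carrier X \<and> y \<in> {..<n} \<rightarrow> carrier Y \<and> z \<in> {..<n} \<rightarrow> carrier Z \<and>
          t = (\<Oplus>\<^bsub>tensor_field K Y Z\<^esub>j\<in>{..<n}. pure_tensor K Y Z (y j) (z j)) \<and>
          t \<in> carrier (cotensor K A Y Z) \<longrightarrow>
          partial_l K A X Y Z (tensor_class K A X (cotensor K A Y Z) x t) =
          (\<Oplus>\<^bsub>tensor_field K (tensor_over K A X Y) Z\<^esub>j\<in>{..<n}.
             pure_tensor K (tensor_over K A X Y) Z (tensor_class K A X Y x (y j)) (z j)))"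
proof -
  note wb = fd_bimodule_weak [OF assms(3)] fd_bimodule_weak [OF assms(4)] fd_bimodule_weak [OF assms(5)]
  note K = algebraically_closed.axioms(1) [OF assms(1)]
  \<comment> \<open>The spaces that are dualised: \<open>X\<close> for the maps of right type and
    \<open>Z\<close> for those of left type.\<close>
  note fd = fd_bimodule.finite_dim [OF assms(3)] fd_bimodule.finite_dim [OF assms(5)]
  show ?thesis
  proof (intro conjI allI impI; (elim conjE)?)
    show "partial_r K A X Y Z = delta_l_dual K A X Y Z"
      by (rule bimodule_tensors.delta_l_dual_eq [OF wb K fd(1), symmetric])
    show "delta_l_dual K A X Y Z = partial_r_tilde K A X Y Z"
      by (simp add: bimodule_tensors.delta_l_dual_eq [OF wb K fd(1)] bimodule_tensors.partial_r_tilde_eq [OF wb K])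
    show "partial_l K A X Y Z = delta_r_dual K A X Y Z"
      by (rule bimodule_tensors.delta_r_dual_eq [OF wb K fd(2), symmetric])
    show "delta_r_dual K A X Y Z = partial_l_tilde K A X Y Z"
      by (simp add: bimodule_tensors.delta_r_dual_eq [OF wb K fd(2)] bimodule_tensors.partial_l_tilde_eq [OF wb K])
  qed (simp_all add: bimodule_tensors.partial_r_sum [OF wb K] bimodule_tensors.partial_l_sum [OF wb K])
qed

end
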